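(* Let $\mu>-1/2$. Suppose that $1<p\le\infty$, $1\le q<\infty$ and $a>\frac{p'q}{4}-1$, where $p'$ is the conjugate index of $p$. Then the energy-entropy inequality $$\left(p^{-1}-q^{-1}\right)S_{L^2(\nu_{e,\mu})}(f)\le(\log A_e)\,\|f\|^2_{L^2(\nu_{e,\mu})}+\frac{a}{q}\,E_{e,\mu}(f)\qquad( * )$$ holds, where $A_e=A_e(p,q,a,\mu)$ is the operator norm of $K_e$ acting from $L^p(\mathbf{C},\nu_{e,\mu})$ to $\mathcal{B}^q_{e,\mu,a}$, provided that one of the following hypotheses is satisfied: Hypothesis 1: $f\in\mathcal{B}^{2+\epsilon}_{e,\mu}$ for some $\epsilon>0$. Hypothesis 2: $f\in\mathcal{B}^2_{e,\mu}$, $1<p\le2$, $1\le q\le2$ and $S_{L^2(\nu_{e,\mu})}(f)<\infty$. Moreover, for the coefficients of the principal terms in $( * )$, namely the energy term $E_{e,\mu}(f)$ and the entropy term $S_{L^2(\nu_{e,\mu})}(f)$, we have the following cases: Case 1: $p^{-1}>q^{-1}$. This implies that $\frac{p'q}{4}-1>0$ and so $a>0$. Thus the coefficients of both $S_{L^2(\nu_{e,\mu})}(f)$ and $E_{e,\mu}(f)$ are positive and consequently $( * )$ is a direct log-Sobolev inequality in $\mathcal{B}^2_{e,\mu}$ with respect to the $\mu$-deformed energy $E_{e,\mu}$. Case 2: $p^{-1}\le q^{-1}$ and $\frac{p'q}{4}-1\ge0$. Again $a>0$ follows, so that the coefficient of $E_{e,\mu}(f)$ is positive, but now the coefficient of the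 entropy is non-positive. Since $d\nu_{e,\mu}$ is a probability measure, $S_{L^2(\nu_{e,\mu})}(f)\ge0$ and so $( * )$ is trivially true. Case 3: $\frac{p'q}{4}-1<0$. This implies that $p^{-1}<q^{-1}$, namely, that the coefficient of the entropy is negative. Moreover, we choose $a$ such that $0>a>\frac{p'q}{4}-1$, which means that the energy term also has a negative coefficient. (One can also choose $a\ge0$ in this case, but then $( * )$ becomes trivial.) In this case, by putting the energy term on the left and the entropy term on the right, $( * )$ gives a reverse log-Sobolev inequality in $\mathcal{B}^2_{e,\mu}$ with respect to the $\mu$-deformed energy $E_{e,\mu}$. Since $K_e1=1$ (where $1$ is the constant function, which is holomorphic and even), we have that $A_e\ge1$ and so the coefficient of the norm term in $( * )$ is non-negative; here one uses that $a<0$ implies $\|1\|_{\mathcal{B}^q_{e,\mu,a}}\ge1$.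
   Context: Fix $\mu>-1/2$. For $x>0$ and $\alpha\in\mathbf{R}$, $K_\alpha(x)=\int_0^\infty e^{-x\cosh u}\cosh(\alpha u)\,du$ is the Macdonald function. On $\mathbf{C}$ define the finite measure $d\nu_{e,\mu}(z)=\nu_{e,\mu}(z)\,dx\,dy$ with density $$\nu_{e,\mu}(z)=\frac{2^{\frac12-\mu}}{\pi\Gamma(\mu+\frac12)}K_{\mu-\frac12}(|z|^2)\,|z|^{2\mu+1},\qquad z\ne0$$ (it is a probability measure). For $a\in\mathbf{R}$ let $d\nu_{e,\mu,a}(z):=e^{-a|z|^2}d\nu_{e,\mu}(z)$. For $0<s<\infty$, $\mathcal{B}^s_{e,\mu}$ is the space of even entire functions $f:\mathbf{C}\to\mathbf{C}$ with $f\in L^s(\mathbf{C},\nu_{e,\mu})$, with the $L^s(\nu_{e,\mu})$-norm; $\mathcal{B}^q_{e,\mu,a}$ is the space of even entire functions in $L^q(\mathbf{C},\nu_{e,\mu,a})$, with the $L^q(\nu_{e,\mu,a})$-norm. Let $\gamma_\mu(0)=1$ and $\gamma_\mu(k)=(k+2\mu\chi_o(k))\gamma_\mu(k-1)$ for $k\ge1$, where $\chi_o(k)=1$ for $k$ odd and $0$ for $k$ even. The kernel is $K_e(z,w)=\sum_{k\ \mathrm{even},\,k\ge0}(z^*w)^k/\gamma_\mu(k)$, with $z^*$ the complex conjugate of $z$, and the associated operator is $K_ef(w)=\int_{\mathbf{C}}K_e(z,w)f(z)\,d\nu_{e,\mu}(z)$. Under the stated conditions on $p,q,a$ this operator is bounded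 from $L^p(\nu_{e,\mu})$ to $\mathcal{B}^q_{e,\mu,a}$. Conventions: $p'=p/(p-1)$ for $1<p<\infty$, $\infty'=1$, $\infty^{-1}=0$. Entropy: for a finite measure space $(\Omega,\nu)$ and $f\in L^2(\Omega,\nu)$, $S_{L^2(\Omega,\nu)}(f)=\int_\Omega|f|^2\log|f|^2\,d\nu-\|f\|^2_{L^2}\log\|f\|^2_{L^2}\in(-\infty,+\infty]$, with $0\log0=0$; $S_{L^2(\nu_{e,\mu})}$ means $(\Omega,\nu)=(\mathbf{C},\nu_{e,\mu})$. Energy: for $g\in\mathcal{B}^2_{e,\mu}$, the $\mu$-deformed energy is $E_{e,\mu}(g)=\int_{\mathbf{C}}|z|^2|g(z)|^2\,d\nu_{e,\mu}(z)\in[0,+\infty]$. For a closed subspace $X$ of $L^2(\Omega,\nu)$ and a quadratic form $Q:X\to[0,\infty]$, a direct log-Sobolev inequality in $X$ is an inequality $S_{L^2(\Omega,\nu)}(f)\le C_1Q(f)+C_2\|f\|^2_{L^2(\Omega,\nu)}$ for all $f\in X$ with constants $C_1>0$, $C_2\ge0$; a reverse log-Sobolev inequality in $X$ is an inequality $Q(f)\le D_1S_{L^2(\Omega,\nu)}(f)+D_2\|f\|^2_{L^2(\Omega,\nu)}$ for all $f\in X$ with constants $D_1>0$, $D_2\ge0$. *)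

theory Defs
  imports
    "HOL-Complex_Analysis.Complex_Analysis"
    "HOL-Probability.Probability"
begin

section \<open>Lebesgue spaces\<close>

text \<open>Exponents range over the extended reals, so that \<open>p = \<infinity>\<close> is allowed.  Elements of
  \<open>L\<^sup>p\<close> are represented by measurable functions; the norm is only meaningful on
  \<open>Lp_space M p\<close>.\<close>

definition Lp_space :: "'a measure \<Rightarrow> ereal \<Rightarrow> ('a \<Rightarrow> complex) set" where
  "Lp_space M p = {f \<in> borel_measurable M.
     if p = \<infinity> then esssup M (\<lambda>x. ereal (norm (f x))) < \<infinity>
     else integrable M (\<lambda>x. norm (f x) powr real_of_ereal p)}"

definition Lp_norm :: "'a measure \<Rightarrow> ereal \<Rightarrow> ('a \<Rightarrow> complex) \<Rightarrow> real" where
  "Lp_norm M p f =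
     (if p = \<infinity> then real_of_ereal (esssup M (\<lambda>x. ereal (norm (f x))))
      else (LINT x|M. norm (f x) powr real_of_ereal p) powr (1 / real_of_ereal p))"

definition recip_exp :: "ereal \<Rightarrow> real" where
  "recip_exp p = (if p = \<infinity> then 0 else 1 / real_of_ereal p)"

definition conj_exp :: "ereal \<Rightarrow> real" where
  "conj_exp p = (if p = \<infinity> then 1 else real_of_ereal p / (real_of_ereal p - 1))"

section \<open>Entropy and logarithmic Sobolev inequalities\<close>

definition ereal_integral :: "'a measure \<Rightarrow> ('a \<Rightarrow> real) \<Rightarrow> ereal" where
  "ereal_integral M g =
     enn2ereal (\<integral>\<^sup>+x. ennreal (g x) \<partial>M) - enn2ereal (\<integral>\<^sup>+x. ennreal (- g x) \<partial>M)"

text \<open>For a finite measure the negative part of \<open>\<bar>f\<bar>\<^sup>2 log \<bar>f\<bar>\<^sup>2\<close> has a finite integral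
  (\<open>t log t \<ge> - 1 / e\<close>), so the difference in \<open>ereal_integral\<close> is never \<open>\<infinity> - \<infinity>\<close>.\<close>

definition entropy_L2 :: "'a measure \<Rightarrow> ('a \<Rightarrow> complex) \<Rightarrow> ereal" where
  "entropy_L2 M f =
     ereal_integral M (\<lambda>x. (norm (f x))\<^sup>2 * ln ((norm (f x))\<^sup>2))
     - ereal ((Lp_norm M 2 f)\<^sup>2 * ln ((Lp_norm M 2 f)\<^sup>2))"

text \<open>Limits in \<open>L\<^sup>2\<close> are determined only up to null sets, hence the almost everywhere
  clause in the closedness condition.\<close>

definition closed_L2_subspace :: "'a measure \<Rightarrow> ('a \<Rightarrow> complex) set \<Rightarrow> bool" where
  "closed_L2_subspace M X \<longleftrightarrow>
     X \<subseteq> Lp_space M 2 \<and>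
     (\<lambda>x. 0) \<in> X \<and>
     (\<forall>f\<in>X. \<forall>g\<in>X. (\<lambda>x. f x + g x) \<in> X) \<and>
     (\<forall>c. \<forall>f\<in>X. (\<lambda>x. c * f x) \<in> X) \<and>
     (\<forall>F f. (\<forall>n. F n \<in> X) \<longrightarrow> f \<in> Lp_space M 2 \<longrightarrow>
        (\<lambda>n::nat. Lp_norm M 2 (\<lambda>x. F n x - f x)) \<longlonglongrightarrow> 0 \<longrightarrow>
        (\<exists>g\<in>X. AE x in M. f x = g x))"

definition quadratic_form_on ::
  "('a \<Rightarrow> complex) set \<Rightarrow> (('a \<Rightarrow> complex) \<Rightarrow> ennreal) \<Rightarrow> bool" where
  "quadratic_form_on X Q \<longleftrightarrow>
     (\<forall>c. \<forall>f\<in>X. Q (\<lambda>x. c * f x) = ennreal ((norm c)\<^sup>2) * Q f) \<and>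
     (\<forall>f\<in>X. \<forall>g\<in>X. Q (\<lambda>x. f x + g x) + Q (\<lambda>x. f x - g x) = 2 * Q f + 2 * Q g)"

definition direct_log_sobolev ::
  "'a measure \<Rightarrow> ('a \<Rightarrow> complex) set \<Rightarrow> (('a \<Rightarrow> complex) \<Rightarrow> ennreal) \<Rightarrow> real \<Rightarrow> real \<Rightarrow> bool" where
  "direct_log_sobolev M X Q C1 C2 \<longleftrightarrow>
     closed_L2_subspace M X \<and> quadratic_form_on X Q \<and> C1 > 0 \<and> C2 \<ge> 0 \<and>
     (\<forall>f\<in>X. entropy_L2 M f \<le> ereal C1 * enn2ereal (Q f) + ereal (C2 * (Lp_norm M 2 f)\<^sup>2))"

definition reverse_log_sobolev ::
  "'a measure \<Rightarrow> ('a \<Rightarrow> complex) set \<Rightarrow> (('a \<Rightarrow> complex) \<Rightarrow> ennreal) \<Rightarrow> real \<Rightarrow> real \<Rightarrow> bool" where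
  "reverse_log_sobolev M X Q D1 D2 \<longleftrightarrow>
     closed_L2_subspace M X \<and> quadratic_form_on X Q \<and> D1 > 0 \<and> D2 \<ge> 0 \<and>
     (\<forall>f\<in>X. enn2ereal (Q f) \<le> ereal D1 * entropy_L2 M f + ereal (D2 * (Lp_norm M 2 f)\<^sup>2))"

section \<open>The even part of the \<open>\<mu>\<close>-deformed Segal-Bargmann space\<close>

definition macdonald :: "real \<Rightarrow> real \<Rightarrow> real" where
  "macdonald \<alpha> x = (LINT u:{0..}|lborel. exp (- x * cosh u) * cosh (\<alpha> * u))"

definition nu_e_density :: "real \<Rightarrow> complex \<Rightarrow> real" where
  "nu_e_density \<mu> z =
     2 powr (1/2 - \<mu>) / (pi * Gamma (\<mu> + 1/2)) *
     macdonald (\<mu> - 1/2) ((norm z)\<^sup>2) * norm z powr (2 * \<mu> + 1)"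

definition nu_e :: "real \<Rightarrow> complex measure" where
  "nu_e \<mu> = density lborel (\<lambda>z. ennreal (nu_e_density \<mu> z))"

definition nu_ea :: "real \<Rightarrow> real \<Rightarrow> complex measure" where
  "nu_ea \<mu> a = density (nu_e \<mu>) (\<lambda>z. ennreal (exp (- a * (norm z)\<^sup>2)))"

definition even_entire :: "(complex \<Rightarrow> complex) set" where
  "even_entire = {f. f holomorphic_on UNIV \<and> (\<forall>z. f (- z) = f z)}"

definition B_e :: "real \<Rightarrow> real \<Rightarrow> (complex \<Rightarrow> complex) set" where
  "B_e \<mu> s = even_entire \<inter> Lp_space (nu_e \<mu>) (ereal s)"

definition B_ea :: "real \<Rightarrow> real \<Rightarrow> real \<Rightarrow> (complex \<Rightarrow> complex) set" where
  "B_ea \<mu> q a = even_entire \<inter> Lp_space (nu_ea \<mu> a) (ereal q)"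

definition chi_o :: "nat \<Rightarrow> real" where
  "chi_o k = (if odd k then 1 else 0)"

fun gamma_mu :: "real \<Rightarrow> nat \<Rightarrow> real" where
  "gamma_mu \<mu> 0 = 1"
| "gamma_mu \<mu> (Suc k) = (real (Suc k) + 2 * \<mu> * chi_o (Suc k)) * gamma_mu \<mu> k"

definition kernel_e :: "real \<Rightarrow> complex \<Rightarrow> complex \<Rightarrow> complex" where
  "kernel_e \<mu> z w =
     (\<Sum>k. if even k then (cnj z * w) ^ k / complex_of_real (gamma_mu \<mu> k) else 0)"

definition K_e :: "real \<Rightarrow> (complex \<Rightarrow> complex) \<Rightarrow> complex \<Rightarrow> complex" where
  "K_e \<mu> f w = (LINT z|nu_e \<mu>. kernel_e \<mu> z w * f z)"

text \<open>The operator norm of \<open>K_e\<close> from \<open>L\<^sup>p(\<nu>)\<close> to \<open>B_ea \<mu> q a\<close>, as the least bound.\<close>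

definition A_e :: "ereal \<Rightarrow> real \<Rightarrow> real \<Rightarrow> real \<Rightarrow> real" where
  "A_e p q a \<mu> = Inf {C. C \<ge> 0 \<and>
     (\<forall>f \<in> Lp_space (nu_e \<mu>) p.
        K_e \<mu> f \<in> B_ea \<mu> q a \<and>
        Lp_norm (nu_ea \<mu> a) (ereal q) (K_e \<mu> f) \<le> C * Lp_norm (nu_e \<mu>) p f)}"

definition energy_e :: "real \<Rightarrow> (complex \<Rightarrow> complex) \<Rightarrow> ennreal" where
  "energy_e \<mu> g = (\<integral>\<^sup>+z. ennreal ((norm z)\<^sup>2 * (norm (g z))\<^sup>2) \<partial>nu_e \<mu>)"

text \<open>The two sides of the energy-entropy inequality.  Recall that \<open>0 * \<infinity> = 0\<close> in \<open>ereal\<close>.\<close>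

definition ee_lhs :: "ereal \<Rightarrow> real \<Rightarrow> real \<Rightarrow> (complex \<Rightarrow> complex) \<Rightarrow> ereal" where
  "ee_lhs p q \<mu> f = ereal (recip_exp p - 1 / q) * entropy_L2 (nu_e \<mu>) f"

definition ee_rhs :: "ereal \<Rightarrow> real \<Rightarrow> real \<Rightarrow> real \<Rightarrow> (complex \<Rightarrow> complex) \<Rightarrow> ereal" where
  "ee_rhs p q a \<mu> f =
     ereal (ln (A_e p q a \<mu>) * (Lp_norm (nu_e \<mu>) 2 f)\<^sup>2) + ereal (a / q) * enn2ereal (energy_e \<mu> f)"

end

theory Submission
  imports Defs
begin

text \<open>
  For even polynomials \<open>f\<close> the function
  \<open>F \<zeta> = \<integral>\<integral> K(z, w) f(z) \<bar>f(z)\<bar>\<^bsup>(2/p - 1) \<zeta>\<^esup> cnj (f(w)) \<bar>f(w)\<bar>\<^bsup>(1 - 2/q) \<zeta>\<^esup> exp (- a \<zeta> \<bar>w\<bar>\<^sup>2 / q)\<close>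
  is analytic on the strip \<open>0 \<le> Re \<zeta> \<le> 1\<close>.  On \<open>Re \<zeta> = 0\<close> it is bounded by \<open>\<parallel>f\<parallel>\<^sup>2 = F 0\<close>, because the
  monomials are orthogonal and \<open>K_e\<close> is therefore an \<open>L\<^sup>2\<close> contraction; on \<open>Re \<zeta> = 1\<close> it is bounded by
  \<open>A_e\<close> times a power of \<open>\<parallel>f\<parallel>\<close>.  The three lines theorem bounds \<open>F' 0\<close>, and by the reproducing property
  \<open>F' 0\<close> consists of the entropy and the energy of \<open>f\<close>.  A general \<open>f \<in> B\<^sup>2\<close> is approximated by its Fejer means:
  they average the rotations of \<open>f\<close> with a positive kernel, so convexity and the rotation invariance of the measure
  make norm, energy and entropy converge, whether finite or not.  Hence the inequality holds on all of \<open>B\<^sup>2\<close>.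
  Where it is trivial, its right-hand side is nonnegative by \<open>A_e \<ge> \<parallel>1\<parallel>\<close>, Jensen's inequality and
  \<open>E f \<ge> E 1 \<parallel>f\<parallel>\<^sup>2\<close>.
\<close>

hide_fact (open) Henstock_Kurzweil_Integration.integrable_bound Henstock_Kurzweil_Integration.integral_add
  Henstock_Kurzweil_Integration.integral_diff Henstock_Kurzweil_Integration.integrable_add
  Henstock_Kurzweil_Integration.integrable_diff Henstock_Kurzweil_Integration.integrable_sum
  Henstock_Kurzweil_Integration.integral_sum Henstock_Kurzweil_Integration.integral_cong
  Henstock_Kurzweil_Integration.integral_cnj

text \<open>Two facts carry the estimates: \<open>exp (b * nsq z)\<close> is integrable for b < 1,
  and the kernel is bounded by C exp ((1 + \<delta>) |z| |w|) for every \<delta> > 0. Completing the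
  square splits |z| |w| into a Gaussian in z of weight just below 1 and one in w of weight just
  above 1/4. With Hoelder's inequality for p' the second weight becomes p'/4, and the q-th power
  against exp (- a |w|^2) converges because a > p'q/4 - 1. Differentiating F under the integral
  needs a majorant on the whole strip, and entropy or energy may be infinite. Polynomials supply the
  majorant. For the passage to general f the entropy is split into a part that may diverge and a
  bounded one, and the signs of the coefficients exclude infinity minus infinity: a < 0 forces p'q <
  4, and since p p' \<ge> 4 the entropy coefficient is then negative. The Macdonald function enters
  only through its integral representation, which makes the measure a superposition of Gaussians;
  the moments follow from a recursion for integrals of hyperbolic cosines.\<close>

abbreviation nsq :: "'a::real_normed_vector \<Rightarrow> real" where
  "nsq x \<equiv> (norm x)\<^sup>2"

section \<open>Lebesgue measure on the complex plane\<close>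

text \<open>Boxes determine Lebesgue measure, and a box in the plane is a product of intervals. This
  opens plane integrals to Tonelli in the real and imaginary parts.\<close>

lemma lborel_complex: "lborel = distr (lborel \<Otimes>\<^sub>M lborel) borel (\<lambda>(x, y). Complex x y)"
proof (rule lborel_eqI)
  fix l u :: complex assume le: "\<And>b. b \<in> Basis \<Longrightarrow> l \<bullet> b \<le> u \<bullet> b"
  have l1: "Re l \<le> Re u" and l2: "Im l \<le> Im u"
    using le[of 1] le[of \<i>] by (auto simp: Basis_complex_def inner_complex_def)
  have m: "(\<lambda>(x, y). Complex x y) \<in> lborel \<Otimes>\<^sub>M lborel \<rightarrow>\<^sub>M borel"
    by (simp add: Complex_eq)
  have "(\<lambda>(x, y). Complex x y) -` box l u \<inter> space (lborel \<Otimes>\<^sub>M lborel) = {Re l<..<Re u} \<times> {Im l<..<Im u}"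
    by (auto simp: space_pair_measure box_def Basis_complex_def inner_complex_def)
  then have "emeasure (distr (lborel \<Otimes>\<^sub>M lborel) borel (\<lambda>(x, y). Complex x y)) (box l u)
     = emeasure (lborel \<Otimes>\<^sub>M lborel) ({Re l<..<Re u} \<times> {Im l<..<Im u})"
    by (simp add: emeasure_distr m)
  also have "\<dots> = ennreal (Re u - Re l) * ennreal (Im u - Im l)"
    using l1 l2 by (simp add: lborel.emeasure_pair_measure_Times)
  also have "\<dots> = (\<Prod>b\<in>Basis. (u - l) \<bullet> b)"
    using l1 l2 by (simp add: Basis_complex_def inner_complex_def ennreal_mult[symmetric])
  finally show "emeasure (distr (lborel \<Otimes>\<^sub>M lborel) borel (\<lambda>(x, y). Complex x y)) (box l u)
     = (\<Prod>b\<in>Basis. (u - l) \<bullet> b)" .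
qed simp

lemma measurable_Complex [measurable]:
  "f \<in> borel_measurable M \<Longrightarrow> g \<in> borel_measurable M \<Longrightarrow> (\<lambda>x. Complex (f x) (g x)) \<in> borel_measurable M"
  by (subst borel_measurable_complex_iff) simp

lemma nn_integral_lborel_complex:
  assumes [measurable]: "f \<in> borel_measurable borel"
  shows "(\<integral>\<^sup>+z. f z \<partial>lborel) = (\<integral>\<^sup>+x. \<integral>\<^sup>+y. f (Complex x y) \<partial>lborel \<partial>lborel)"
    and "(\<integral>\<^sup>+z. f z \<partial>lborel) = (\<integral>\<^sup>+y. \<integral>\<^sup>+x. f (Complex x y) \<partial>lborel \<partial>lborel)"
proof -
  have e: "(\<integral>\<^sup>+z. f z \<partial>lborel) = (\<integral>\<^sup>+z. f (Complex (fst z) (snd z)) \<partial>(lborel \<Otimes>\<^sub>M lborel))"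
    by (subst lborel_complex) (simp add: nn_integral_distr case_prod_unfold)
  show "(\<integral>\<^sup>+z. f z \<partial>lborel) = (\<integral>\<^sup>+x. \<integral>\<^sup>+y. f (Complex x y) \<partial>lborel \<partial>lborel)"
    unfolding e by (subst lborel.nn_integral_fst[symmetric]) simp_all
  show "(\<integral>\<^sup>+z. f z \<partial>lborel) = (\<integral>\<^sup>+y. \<integral>\<^sup>+x. f (Complex x y) \<partial>lborel \<partial>lborel)"
    unfolding e by (subst lborel_pair.nn_integral_snd[symmetric]) simp_all
qed

lemma nn_integral_shear_Re:
  assumes [measurable]: "f \<in> borel_measurable borel"
  shows "(\<integral>\<^sup>+z. f (Complex (Re z + t * Im z) (Im z)) \<partial>lborel) = (\<integral>\<^sup>+z. f z \<partial>lborel)"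
proof -
  have "(\<integral>\<^sup>+x. f (Complex (x + t * y) y) \<partial>lborel) = (\<integral>\<^sup>+x. f (Complex x y) \<partial>lborel)" for y
    using nn_integral_real_affine[of "\<lambda>x. f (Complex x y)" 1 "t * y"] by (simp add: add.commute)
  then show ?thesis by (simp add: nn_integral_lborel_complex(2))
qed

lemma nn_integral_shear_Im:
  assumes [measurable]: "f \<in> borel_measurable borel"
  shows "(\<integral>\<^sup>+z. f (Complex (Re z) (Im z + t * Re z)) \<partial>lborel) = (\<integral>\<^sup>+z. f z \<partial>lborel)"
proof -
  have "(\<integral>\<^sup>+y. f (Complex x (y + t * x)) \<partial>lborel) = (\<integral>\<^sup>+y. f (Complex x y) \<partial>lborel)" for x
    using nn_integral_real_affine[of "\<lambda>y. f (Complex x y)" 1 "t * x"] by (simp add: add.commute)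
  then show ?thesis by (simp add: nn_integral_lborel_complex(1))
qed

text \<open>A rotation by an angle other than \<open>\<pi>\<close> is a product of three shears, and shears preserve
  Lebesgue measure by translation invariance on the lines parallel to an axis.\<close>

lemma nn_integral_rotate:
  fixes f :: "complex \<Rightarrow> ennreal"
  assumes [measurable]: "f \<in> borel_measurable borel" and "norm \<omega> = 1"
  shows "(\<integral>\<^sup>+z. f (\<omega> * z) \<partial>lborel) = (\<integral>\<^sup>+z. f z \<partial>lborel)"
proof -
  have rot: "(\<integral>\<^sup>+z. g (\<omega> * z) \<partial>lborel) = (\<integral>\<^sup>+z. g z \<partial>lborel)"
    if [measurable]: "g \<in> borel_measurable borel" and "norm \<omega> = 1" "Im \<omega> \<noteq> 0"
    for g :: "complex \<Rightarrow> ennreal" and \<omega>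
  proof -
    \<comment> \<open>With \<omega> = exp (i \<theta>) one has a = cos \<theta>, b = sin \<theta>
      and t = - tan (\<theta> / 2); the three shears are horizontal by t, vertical by b, horizontal
      by t.\<close>
    define a b t where "a = Re \<omega>" and "b = Im \<omega>" and "t = (a - 1) / b"
    have ab: "a\<^sup>2 + b\<^sup>2 = 1" using that by (simp add: a_def b_def cmod_def)
    have tb: "t * b = a - 1" using that by (simp add: t_def b_def)
    have ta: "t * (a + 1) = - b"
      using that ab unfolding t_def b_def[symmetric] by (simp add: field_simps power2_eq_square)
    define h where "h = (\<lambda>z. g (Complex (Re z + t * Im z) (Im z)))"
    define k where "k = (\<lambda>z. h (Complex (Re z) (Im z + b * Re z)))"
    have [measurable]: "h \<in> borel_measurable borel" "k \<in> borel_measurable borel"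
      by (simp_all add: h_def k_def)
    have "g (\<omega> * z) = k (Complex (Re z + t * Im z) (Im z))" for z
    proof -
      have aeq: "a = 1 + t * b" using tb by simp
      have i: "Im (\<omega> * z) = Im z + b * (Re z + t * Im z)"
        unfolding times_complex.sel a_def[symmetric] b_def[symmetric] by (subst aeq) (simp add: algebra_simps)
      have "Re (\<omega> * z) = a * Re z - b * Im z"
        by (simp add: a_def b_def)
      also have "\<dots> = (1 + t * b) * Re z + t * (a + 1) * Im z" using ta tb by simp
      also have "\<dots> = Re z + t * Im z + t * (Im z + b * (Re z + t * Im z))"
        by (subst aeq) (simp add: algebra_simps)
      finally have r: "Re (\<omega> * z) = Re z + t * Im z + t * (Im z + b * (Re z + t * Im z))" .
      have "\<omega> * z = Complex (Re z + t * Im z + t * (Im z + b * (Re z + t * Im z))) (Im z + b * (Re z + t * Im z))"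
        using i r complex_eq_iff by simp
      then show ?thesis by (simp add: k_def h_def)
    qed
    then have "(\<integral>\<^sup>+z. g (\<omega> * z) \<partial>lborel) = (\<integral>\<^sup>+z. k (Complex (Re z + t * Im z) (Im z)) \<partial>lborel)" by simp
    also have "\<dots> = (\<integral>\<^sup>+z. k z \<partial>lborel)" by (rule nn_integral_shear_Re) simp
    also have "\<dots> = (\<integral>\<^sup>+z. h z \<partial>lborel)" unfolding k_def by (rule nn_integral_shear_Im) simp
    also have "\<dots> = (\<integral>\<^sup>+z. g z \<partial>lborel)" unfolding h_def by (rule nn_integral_shear_Re) simp
    finally show ?thesis .
  qed
  show ?thesis
  proof (cases "Im \<omega> = 0")
    case False then show ?thesis using rot assms by simp
  next
    case True
    \<comment> \<open>A real \<omega> is the product of the two non-real units \<omega> i and -i, to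
      which the shear argument applies one after the other.\<close>
    have "Im (\<omega> * \<i>) \<noteq> 0" "norm (\<omega> * \<i>) = 1" using True assms
      by (auto simp: norm_mult cmod_def)
    moreover have "(\<integral>\<^sup>+z. f (\<omega> * z) \<partial>lborel) = (\<integral>\<^sup>+z. f ((\<omega> * \<i>) * (- \<i> * z)) \<partial>lborel)"
      by (intro nn_integral_cong arg_cong[of _ _ f]) (simp add: complex_eq_iff)
    moreover have "\<dots> = (\<integral>\<^sup>+z. f ((\<omega> * \<i>) * z) \<partial>lborel)"
      by (rule rot) simp_all
    ultimately show ?thesis using rot[of f "\<omega> * \<i>"] by simp
  qed
qed

text \<open>A disc of radius sqrt a has area \<pi> a, so |z|^2 has constant density \<pi> on the
  half-line. This takes the place of polar coordinates.\<close>

lemma distr_lborel_norm_sq: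
  "distr lborel borel (\<lambda>z::complex. nsq z) = density lborel (\<lambda>s. ennreal (pi * indicator {0..} s))"
    (is "?M = ?N")
proof (rule measure_eqI_generator_eq)
  let ?E = "range (\<lambda>a::real. {..a})"
  show "Int_stable ?E" by (auto simp: Int_stable_def)
  show "?E \<subseteq> Pow UNIV" by auto
  show "sets ?M = sigma_sets UNIV ?E" "sets ?N = sigma_sets UNIV ?E"
    by (simp_all add: borel_eq_atMost)
  have *: "emeasure ?M {..a} = ennreal (pi * max 0 a)" for a
  proof -
    have "emeasure ?M {..a} = emeasure lborel {z::complex. nsq z \<le> a}"
      by (simp add: emeasure_distr vimage_def)
    also have "\<dots> = ennreal (pi * max 0 a)"
    proof (cases "a \<ge> 0")
      case True
      then have "{z::complex. nsq z \<le> a} = cball 0 (sqrt a)"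
        by (auto simp: dist_norm real_le_rsqrt) (metis norm_ge_zero real_sqrt_le_iff real_sqrt_unique sqrt_le_D)
      then show ?thesis using True by (simp add: emeasure_cball unit_ball_vol_numeral)
    next
      case False
      then have "{z::complex. nsq z \<le> a} = {}" by (auto simp: not_le) (smt (verit) zero_le_power2)
      then show ?thesis using False by simp
    qed
    finally show ?thesis .
  qed
  have **: "emeasure ?N {..a} = ennreal (pi * max 0 a)" for a
  proof -
    have "emeasure ?N {..a} = (\<integral>\<^sup>+s. ennreal pi * indicator {0..a} s \<partial>lborel)"
      by (subst emeasure_density) (auto intro!: nn_integral_cong split: split_indicator)
    also have "\<dots> = ennreal pi * emeasure lborel {0..a}" by (simp add: nn_integral_cmult)
    also have "\<dots> = ennreal (pi * max 0 a)"
      by (cases "0 \<le> a") (simp_all add: ennreal_mult max_def)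
    finally show ?thesis .
  qed
  show "\<And>X. X \<in> ?E \<Longrightarrow> emeasure ?M X = emeasure ?N X" using * ** by auto
  show "range (\<lambda>n::nat. {..real n}) \<subseteq> ?E" by auto
  show "(\<Union>n. {..real n}) = UNIV" by (auto intro: real_arch_simple)
  show "\<And>i. emeasure ?M {..real i} \<noteq> \<infinity>" using * by simp
qed

lemma nn_integral_radial:
  assumes [measurable]: "g \<in> borel_measurable borel"
  shows "(\<integral>\<^sup>+z. g (nsq (z::complex)) \<partial>lborel) = ennreal pi * (\<integral>\<^sup>+s. g s * indicator {0..} s \<partial>lborel)"
proof -
  have "(\<integral>\<^sup>+z. g (nsq (z::complex)) \<partial>lborel) = (\<integral>\<^sup>+s. g s \<partial>distr lborel borel (\<lambda>z::complex. nsq z))"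
    by (subst nn_integral_distr) simp_all
  also have "\<dots> = (\<integral>\<^sup>+s. ennreal (pi * indicator {0..} s) * g s \<partial>lborel)"
    by (subst distr_lborel_norm_sq, subst nn_integral_density) simp_all
  also have "\<dots> = (\<integral>\<^sup>+s. ennreal pi * (g s * indicator {0..} s) \<partial>lborel)"
    by (intro nn_integral_cong) (auto split: split_indicator simp: mult.commute)
  finally show ?thesis by (simp add: nn_integral_cmult)
qed

text \<open>In the variable s = |z|^2 this is Euler's integral for Gamma, rescaled by t.\<close>

lemma nn_integral_powr_exp_norm:
  assumes "\<kappa> > -1" "t > 0"
  shows "(\<integral>\<^sup>+z. ennreal (exp (- t * nsq (z::complex)) * (nsq z) powr \<kappa>) \<partial>lborel)
    = ennreal (pi * Gamma (\<kappa> + 1) * t powr (- (\<kappa> + 1)))"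
proof -
  have G: "Gamma (\<kappa> + 1) \<ge> 0" using assms Gamma_real_pos[of "\<kappa> + 1"] by simp
  let ?h = "\<lambda>s. ennreal (indicator {0..} s * s powr \<kappa> / exp s)"
  have "(\<integral>\<^sup>+s. ennreal (exp (- t * s) * s powr \<kappa>) * indicator {0..} s \<partial>lborel)
      = (\<integral>\<^sup>+s. ennreal (t powr (-\<kappa>)) * ?h (t * s) \<partial>lborel)"
  proof (intro nn_integral_cong)
    fix s :: real
    show "ennreal (exp (- t * s) * s powr \<kappa>) * indicator {0..} s = ennreal (t powr (-\<kappa>)) * ?h (t * s)"
      using assms by (auto split: split_indicator simp: zero_le_mult_iff ennreal_mult[symmetric] powr_mult exp_minus
        field_simps powr_minus)
  qed
  also have "\<dots> = ennreal (t powr (-\<kappa>)) * (\<integral>\<^sup>+s. ?h (t * s) \<partial>lborel)"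
    by (rule nn_integral_cmult) simp
  also have "(\<integral>\<^sup>+s. ?h (t * s) \<partial>lborel) = ennreal (1 / t) * (\<integral>\<^sup>+s. ?h s \<partial>lborel)"
    using assms nn_integral_real_affine[of ?h t 0]
    by (simp add: mult.assoc[symmetric] ennreal_mult[symmetric])
  also have "(\<integral>\<^sup>+s. ?h s \<partial>lborel) = Gamma (\<kappa> + 1)"
    using Gamma_conv_nn_integral_real[of "\<kappa> + 1"] assms by simp
  also have "ennreal (t powr - \<kappa>) * (ennreal (1 / t) * ennreal (Gamma (\<kappa> + 1)))
      = ennreal (Gamma (\<kappa> + 1) * t powr (- (\<kappa> + 1)))"
    using assms G by (subst ennreal_mult[symmetric], simp, simp, subst ennreal_mult[symmetric])
       (auto simp: powr_diff powr_minus field_simps powr_add)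
  finally have "(\<integral>\<^sup>+s. ennreal (exp (- t * s) * s powr \<kappa>) * indicator {0..} s \<partial>lborel)
      = ennreal (Gamma (\<kappa> + 1) * t powr (- (\<kappa> + 1)))" .
  then show ?thesis using nn_integral_radial[of "\<lambda>s. ennreal (exp (- t * s) * s powr \<kappa>)"] G
    by (simp add: ennreal_mult[symmetric] mult.assoc)
qed

section \<open>Integrals of hyperbolic cosines\<close>

lemma cosh_eq_half_exp: "cosh (u::real) = (exp u + exp (- u)) / 2"
  by (simp add: cosh_def)

text \<open>For the exponent \<alpha> + 2 the integrand has an explicit antiderivative, by the
  addition theorem for cosh ((\<alpha> + 1) u - u). With \<alpha> = \<mu> - 1/2 it is the exponent
  that occurs in the total mass of the measure.\<close>

lemma nn_integral_cosh_base:
  assumes "\<alpha> > -1"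
  shows "(\<integral>\<^sup>+u. ennreal (cosh (\<alpha> * u) * cosh u powr (- (\<alpha> + 2))) * indicator {0..} u \<partial>lborel)
    = ennreal (2 powr \<alpha> / (\<alpha> + 1))"
proof -
  let ?F = "\<lambda>u. sinh ((\<alpha> + 1) * u) * cosh u powr (- (\<alpha> + 1)) / (\<alpha> + 1)"
  have "(\<integral>\<^sup>+u. ennreal (cosh (\<alpha> * u) * cosh u powr (- (\<alpha> + 2))) * indicator {0..} u \<partial>lborel)
    = ennreal (2 powr \<alpha> / (\<alpha> + 1) - ?F 0)"
  proof (rule nn_integral_FTC_atLeast)
    fix u :: real
    have p: "cosh u powr (- (\<alpha> + 1)) = cosh u * cosh u powr (- (\<alpha> + 2))"
      by (simp add: powr_mult_base algebra_simps)
    have q: "cosh u powr (- (\<alpha> + 1) - 1) = cosh u powr (- (\<alpha> + 2))" by (simp add: algebra_simps)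
    have "cosh (\<alpha> * u) = cosh ((\<alpha> + 1) * u - u)" by (simp add: algebra_simps)
    then have c: "cosh (\<alpha> * u) = cosh ((\<alpha> + 1) * u) * cosh u - sinh ((\<alpha> + 1) * u) * sinh u"
      by (simp add: cosh_diff)
    have "(?F has_real_derivative
       (cosh ((\<alpha> + 1) * u) * (\<alpha> + 1) * cosh u powr (- (\<alpha> + 1))
        + sinh ((\<alpha> + 1) * u) * ((- (\<alpha> + 1)) * cosh u powr (- (\<alpha> + 1) - 1) * sinh u)) / (\<alpha> + 1)) (at u)"
      using assms by (auto intro!: derivative_eq_intros simp: mult.commute)
    also have "(cosh ((\<alpha> + 1) * u) * (\<alpha> + 1) * cosh u powr (- (\<alpha> + 1))
        + sinh ((\<alpha> + 1) * u) * ((- (\<alpha> + 1)) * cosh u powr (- (\<alpha> + 1) - 1) * sinh u)) / (\<alpha> + 1)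
       = cosh (\<alpha> * u) * cosh u powr (- (\<alpha> + 2))"
      unfolding q unfolding p c using assms by (simp add: field_simps)
    finally show "(?F has_real_derivative cosh (\<alpha> * u) * cosh u powr (- (\<alpha> + 2))) (at u)" .
  next
    \<comment> \<open>Both hyperbolic functions are divided by their leading exponentials, which
      cancel each other; what remains has an evident limit.\<close>
    have e: "sinh ((\<alpha> + 1) * u) * cosh u powr (- (\<alpha> + 1)) / (\<alpha> + 1)
      = (1 - exp (- 2 * (\<alpha> + 1) * u)) / 2 * ((1 + exp (- 2 * u)) / 2) powr (- (\<alpha> + 1)) / (\<alpha> + 1)" for u :: real
    proof -
      have c: "cosh u = exp u * ((1 + exp (- 2 * u)) / 2)"
      proof -
        have "exp u * exp (- 2 * u) = exp (- u)" by (simp flip: exp_add)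
        then show ?thesis by (simp add: cosh_def distrib_left)
      qed
      have "cosh u powr (- (\<alpha> + 1)) = exp (- (\<alpha> + 1) * u) * ((1 + exp (- 2 * u)) / 2) powr (- (\<alpha> + 1))"
        unfolding c by (subst powr_mult) (simp_all add: exp_powr_real mult.commute add_nonneg_nonneg)
      moreover have "sinh ((\<alpha> + 1) * u) = exp ((\<alpha> + 1) * u) * ((1 - exp (- 2 * (\<alpha> + 1) * u)) / 2)"
        by (simp add: sinh_def right_diff_distrib flip: exp_add) (simp add: algebra_simps)
      moreover have "exp ((\<alpha> + 1) * u) * exp (- (\<alpha> + 1) * u) = 1" by (simp flip: exp_add add: algebra_simps)
      moreover have "E * X * (E' * Y) / d = X * Y / d" if "E * E' = 1" for E E' X Y d :: real
        using that by (metis mult.assoc mult.commute mult.left_neutral)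
      ultimately show ?thesis by presburger
    qed
    have l1: "((\<lambda>u. exp (- 2 * (\<alpha> + 1) * u)) \<longlongrightarrow> 0) at_top"
      using assms by real_asymp
    have l2: "((\<lambda>u::real. exp (- 2 * u)) \<longlongrightarrow> 0) at_top" by real_asymp
    have "((\<lambda>u. (1 - exp (- 2 * (\<alpha> + 1) * u)) / 2 * ((1 + exp (- 2 * u)) / 2) powr (- (\<alpha> + 1)) / (\<alpha> + 1))
       \<longlongrightarrow> (1 - 0) / 2 * ((1 + 0) / 2) powr (- (\<alpha> + 1)) / (\<alpha> + 1)) at_top"
      using assms by (intro tendsto_intros l1 l2) auto
    also have "(1 - 0) / 2 * ((1 + 0) / 2) powr (- (\<alpha> + 1)) / (\<alpha> + 1) = 2 powr \<alpha> / (\<alpha> + 1)"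
    proof -
      have "(1 / 2 :: real) powr (- (\<alpha> + 1)) = 2 powr (\<alpha> + 1)"
        by (simp only: powr_minus powr_divide powr_one_eq_one) simp
      then show ?thesis by (simp add: powr_add)
    qed
    finally show "(?F \<longlongrightarrow> 2 powr \<alpha> / (\<alpha> + 1)) at_top" unfolding e .
  qed (auto intro!: mult_nonneg_nonneg less_imp_le[OF cosh_real_pos] borel_measurable_continuous_onI continuous_intros)
  then show ?thesis by simp
qed

text \<open>What is left of a moment of the measure once the radial integral has been carried out
  inside the integral representation of the Macdonald function.\<close>

definition cosh_int :: "real \<Rightarrow> real \<Rightarrow> real" where
  "cosh_int \<alpha> \<beta> = (LINT u:{0..}|lborel. cosh (\<alpha> * u) * cosh u powr (- \<beta>))"

lemma cosh_int_measurable [measurable]: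
  "(\<lambda>u::real. cosh (\<alpha> * u) * cosh u powr b) \<in> borel_measurable borel"
  by (intro borel_measurable_continuous_onI continuous_intros) auto

lemma set_integrable_cosh:
  fixes \<alpha> \<beta> :: real
  assumes "\<alpha> > -1" "\<beta> \<ge> \<alpha> + 2"
  shows "set_integrable lborel {0..} (\<lambda>u. cosh (\<alpha> * u) * cosh u powr (- \<beta>))"
proof -
  have "set_integrable lborel {0..} (\<lambda>u. cosh (\<alpha> * u) * cosh u powr (- (\<alpha> + 2)))"
    unfolding set_integrable_def
  proof (rule integrableI_nonneg)
    have "(\<integral>\<^sup>+u. ennreal (indicator {0..} u *\<^sub>R (cosh (\<alpha> * u) * cosh u powr - (\<alpha> + 2))) \<partial>lborel)
       = (\<integral>\<^sup>+u. ennreal (cosh (\<alpha> * u) * cosh u powr (- (\<alpha> + 2))) * indicator {0..} u \<partial>lborel)"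
      by (intro nn_integral_cong) (auto split: split_indicator)
    then show "(\<integral>\<^sup>+u. ennreal (indicator {0..} u *\<^sub>R (cosh (\<alpha> * u) * cosh u powr - (\<alpha> + 2))) \<partial>lborel) < \<infinity>"
      using nn_integral_cosh_base[OF assms(1)] by simp
  qed (auto simp: less_imp_le[OF cosh_real_pos])
  then show ?thesis
  proof (rule set_integrable_bound)
    show "set_borel_measurable lborel {0..} (\<lambda>u. cosh (\<alpha> * u) * cosh u powr - \<beta>)"
      by (simp add: set_borel_measurable_def)
    show "AE x in lborel. x \<in> {0..} \<longrightarrow> norm (cosh (\<alpha> * x) * cosh x powr - \<beta>)
            \<le> norm (cosh (\<alpha> * x) * cosh x powr - (\<alpha> + 2))"
      using assms by (auto simp: abs_mult cosh_real_ge_1 intro!: AE_I2 mult_left_mono powr_mono)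
  qed
qed

lemma cosh_int_base:
  assumes "\<alpha> > -1"
  shows "cosh_int \<alpha> (\<alpha> + 2) = 2 powr \<alpha> / (\<alpha> + 1)"
proof -
  have "cosh_int \<alpha> (\<alpha> + 2) = enn2real (\<integral>\<^sup>+u. ennreal (indicator {0..} u *\<^sub>R (cosh (\<alpha> * u) * cosh u powr - (\<alpha> + 2))) \<partial>lborel)"
    unfolding cosh_int_def set_lebesgue_integral_def
    by (rule integral_eq_nn_integral) (auto simp: less_imp_le[OF cosh_real_pos])
  also have "(\<integral>\<^sup>+u. ennreal (indicator {0..} u *\<^sub>R (cosh (\<alpha> * u) * cosh u powr - (\<alpha> + 2))) \<partial>lborel)
       = (\<integral>\<^sup>+u. ennreal (cosh (\<alpha> * u) * cosh u powr (- (\<alpha> + 2))) * indicator {0..} u \<partial>lborel)"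
    by (intro nn_integral_cong) (auto split: split_indicator)
  finally show ?thesis using nn_integral_cosh_base[OF assms] assms by simp
qed

lemma nn_integral_cosh:
  assumes "\<alpha> > -1" "\<beta> \<ge> \<alpha> + 2"
  shows "(\<integral>\<^sup>+u. ennreal (cosh (\<alpha> * u) * cosh u powr (- \<beta>)) * indicator {0..} u \<partial>lborel) = ennreal (cosh_int \<alpha> \<beta>)"
proof -
  have "(\<integral>\<^sup>+u. ennreal (cosh (\<alpha> * u) * cosh u powr (- \<beta>)) * indicator {0..} u \<partial>lborel)
      = (\<integral>\<^sup>+u. ennreal (indicator {0..} u *\<^sub>R (cosh (\<alpha> * u) * cosh u powr - \<beta>)) \<partial>lborel)"
    by (intro nn_integral_cong) (auto split: split_indicator)
  also have "\<dots> = ennreal (cosh_int \<alpha> \<beta>)"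
    unfolding cosh_int_def set_lebesgue_integral_def
    using set_integrable_cosh[OF assms]
    by (intro nn_integral_eq_integral) (auto simp: set_integrable_def less_imp_le[OF cosh_real_pos])
  finally show ?thesis .
qed

text \<open>The derivative of \<open>\<alpha> sinh (\<alpha> u) cosh u powr (- \<beta>) + \<beta> cosh (\<alpha> u) sinh u cosh u powr (- \<beta> - 1)\<close>
  is the difference of the two integrands.\<close>

lemma cosh_int_rec:
  assumes "\<alpha> > -1" "\<beta> \<ge> \<alpha> + 2" "\<beta> > \<bar>\<alpha>\<bar>"
  shows "\<beta> * (\<beta> + 1) * cosh_int \<alpha> (\<beta> + 2) = (\<beta>\<^sup>2 - \<alpha>\<^sup>2) * cosh_int \<alpha> \<beta>"
proof -
  let ?G = "\<lambda>u. \<alpha> * sinh (\<alpha> * u) * cosh u powr (- \<beta>) + \<beta> * cosh (\<alpha> * u) * sinh u * cosh u powr (- \<beta> - 1)"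
  let ?g = "\<lambda>u. \<beta> * (\<beta> + 1) * (cosh (\<alpha> * u) * cosh u powr (- (\<beta> + 2)))
      - (\<beta>\<^sup>2 - \<alpha>\<^sup>2) * (cosh (\<alpha> * u) * cosh u powr (- \<beta>))"
  have int: "set_integrable lborel {0..} (\<lambda>u. cosh (\<alpha> * u) * cosh u powr (- \<beta>))"
    "set_integrable lborel {0..} (\<lambda>u. cosh (\<alpha> * u) * cosh u powr (- (\<beta> + 2)))"
    using assms by (intro set_integrable_cosh; simp)+
  have gint: "set_integrable lborel {0..} ?g"
    using int by (intro set_integral_diff set_integrable_mult_right) auto
  have ga: "(LINT u:{0..}|lborel. ?g u) = \<beta> * (\<beta> + 1) * cosh_int \<alpha> (\<beta> + 2) - (\<beta>\<^sup>2 - \<alpha>\<^sup>2) * cosh_int \<alpha> \<beta>"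
    using int unfolding cosh_int_def by (subst set_integral_diff) auto
  have der: "(?G has_real_derivative ?g u) (at u)" for u :: real
  proof -
    have p: "cosh u powr (- \<beta>) = (cosh u)\<^sup>2 * cosh u powr (- (\<beta> + 2))"
      by (simp add: powr_mult_base power2_eq_square mult.assoc)
    have q: "cosh u powr (- \<beta> - 1) = cosh u * cosh u powr (- (\<beta> + 2))"
    proof -
      have e: "- \<beta> - 1 = 1 + - (\<beta> + 2)" by simp
      show ?thesis by (subst e, subst powr_add) simp
    qed
    have r: "cosh u powr (- \<beta> - 1 - 1) = cosh u powr (- (\<beta> + 2))" by (simp add: algebra_simps)
    have s: "(sinh u)\<^sup>2 = (cosh u)\<^sup>2 - 1" using cosh_square_eq[of u] by simp
    have "(?G has_real_derivative
      (\<alpha> * (cosh (\<alpha> * u) * \<alpha>) * cosh u powr (- \<beta>) + \<alpha> * sinh (\<alpha> * u) * ((- \<beta>) * cosh u powr (- \<beta> - 1) * sinh u)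
      + (\<beta> * (sinh (\<alpha> * u) * \<alpha>) * sinh u * cosh u powr (- \<beta> - 1)
         + \<beta> * cosh (\<alpha> * u) * cosh u * cosh u powr (- \<beta> - 1)
         + \<beta> * cosh (\<alpha> * u) * sinh u * ((- \<beta> - 1) * cosh u powr (- \<beta> - 1 - 1) * sinh u)))) (at u)"
      by (auto intro!: derivative_eq_intros simp: algebra_simps)
    also have "(\<alpha> * (cosh (\<alpha> * u) * \<alpha>) * cosh u powr (- \<beta>) + \<alpha> * sinh (\<alpha> * u) * ((- \<beta>) * cosh u powr (- \<beta> - 1) * sinh u)
      + (\<beta> * (sinh (\<alpha> * u) * \<alpha>) * sinh u * cosh u powr (- \<beta> - 1)
         + \<beta> * cosh (\<alpha> * u) * cosh u * cosh u powr (- \<beta> - 1)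
         + \<beta> * cosh (\<alpha> * u) * sinh u * ((- \<beta> - 1) * cosh u powr (- \<beta> - 1 - 1) * sinh u))) =
      cosh (\<alpha> * u) * cosh u powr (- (\<beta> + 2)) * (\<alpha>\<^sup>2 * (cosh u)\<^sup>2 + \<beta> * (cosh u)\<^sup>2 - \<beta> * (\<beta> + 1) * (sinh u)\<^sup>2)"
      unfolding r unfolding p q by (simp add: algebra_simps power2_eq_square)
    also have "\<dots> = ?g u"
      unfolding s unfolding p by (simp add: algebra_simps power2_eq_square)
    finally show ?thesis .
  qed
  have lim: "(?G \<longlongrightarrow> 0) at_top"
  proof (rule Lim_null_comparison)
    show "((\<lambda>u. (\<bar>\<alpha>\<bar> + \<bar>\<beta>\<bar>) * (2 powr \<beta> * exp ((\<bar>\<alpha>\<bar> - \<beta>) * u))) \<longlongrightarrow> 0) at_top"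
    proof -
      have "((\<lambda>u. exp ((\<bar>\<alpha>\<bar> - \<beta>) * u)) \<longlongrightarrow> 0) at_top"
        using assms(3) by real_asymp
      then show ?thesis by (intro tendsto_mult_right_zero)
    qed
    show "\<forall>\<^sub>F u in at_top. norm (?G u) \<le> (\<bar>\<alpha>\<bar> + \<bar>\<beta>\<bar>) * (2 powr \<beta> * exp ((\<bar>\<alpha>\<bar> - \<beta>) * u))"
    proof (rule eventually_mono[OF eventually_ge_at_top[of 0]])
      fix u :: real assume u: "0 \<le> u"
      have ca: "cosh (\<alpha> * u) \<le> exp (\<bar>\<alpha>\<bar> * u)"
      proof -
        have "exp (\<alpha> * u) \<le> exp (\<bar>\<alpha>\<bar> * u)" "exp (- (\<alpha> * u)) \<le> exp (\<bar>\<alpha>\<bar> * u)"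
          using u by (auto simp: mult_right_mono abs_le_iff intro!: mult_right_mono)
             (metis abs_ge_minus_self minus_mult_left mult_right_mono)
        moreover have "(x + y) / 2 \<le> z" if "x \<le> z" "y \<le> z" for x y z :: real
          using that by simp
        ultimately show ?thesis unfolding cosh_eq_half_exp by blast
      qed
      have sc: "\<bar>sinh v\<bar> \<le> cosh v" for v :: real
        by (metis cosh_real_abs cosh_real_nonneg abs_le_square_iff abs_of_nonneg cosh_square_eq less_add_one less_imp_le)
      have cp: "cosh u powr (- \<beta>) \<le> 2 powr \<beta> * exp (- \<beta> * u)"
      proof -
        have "exp u / 2 \<le> cosh u" by (simp add: cosh_def)
        then have "cosh u powr (- \<beta>) \<le> (exp u / 2) powr (- \<beta>)"
          using assms by (intro powr_mono2') auto
        also have "\<dots> = 2 powr \<beta> * exp (- \<beta> * u)"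
          by (simp add: powr_divide exp_powr_real powr_minus field_simps exp_minus)
        finally show ?thesis .
      qed
      have pp: "cosh u powr (- \<beta>) = cosh u * cosh u powr (- \<beta> - 1)" by (simp add: powr_mult_base)
      have "norm (?G u) \<le> \<bar>\<alpha>\<bar> * \<bar>sinh (\<alpha> * u)\<bar> * cosh u powr (- \<beta>) + \<bar>\<beta>\<bar> * cosh (\<alpha> * u) * \<bar>sinh u\<bar> * cosh u powr (- \<beta> - 1)"
        by (rule order_trans[OF norm_triangle_ineq]) (simp add: abs_mult)
      also have "\<dots> \<le> \<bar>\<alpha>\<bar> * cosh (\<alpha> * u) * cosh u powr (- \<beta>) + \<bar>\<beta>\<bar> * cosh (\<alpha> * u) * cosh u * cosh u powr (- \<beta> - 1)"
        by (intro add_mono mult_right_mono mult_left_mono sc) auto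
      also have "\<dots> = (\<bar>\<alpha>\<bar> + \<bar>\<beta>\<bar>) * (cosh (\<alpha> * u) * cosh u powr (- \<beta>))"
        unfolding pp by (simp add: algebra_simps)
      also have "\<dots> \<le> (\<bar>\<alpha>\<bar> + \<bar>\<beta>\<bar>) * (exp (\<bar>\<alpha>\<bar> * u) * (2 powr \<beta> * exp (- \<beta> * u)))"
        by (intro mult_left_mono mult_mono ca cp) auto
      also have "\<dots> = (\<bar>\<alpha>\<bar> + \<bar>\<beta>\<bar>) * (2 powr \<beta> * exp ((\<bar>\<alpha>\<bar> - \<beta>) * u))"
        by (simp add: left_diff_distrib exp_diff exp_minus field_simps)
      finally show "norm (?G u) \<le> (\<bar>\<alpha>\<bar> + \<bar>\<beta>\<bar>) * (2 powr \<beta> * exp ((\<bar>\<alpha>\<bar> - \<beta>) * u))" .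
    qed
  qed
  \<comment> \<open>Each summand of G contains a factor sinh, so G vanishes at 0 as it does at
    infinity, and the recursion has no boundary term.\<close>
  have "(LBINT u=ereal 0..\<infinity>. ?g u) = 0 - ?G 0"
  proof (rule interval_integral_FTC_integrable)
    show "\<And>u. (?G has_vector_derivative ?g u) (at u)"
      using der by (simp add: has_real_derivative_iff_has_vector_derivative)
    show "\<And>u. isCont ?g u" by (intro continuous_intros) auto
    show "set_integrable lborel (einterval (ereal 0) \<infinity>) ?g"
      using gint by (rule set_integrable_subset) (auto simp: einterval_def)
    show "((?G \<circ> real_of_ereal) \<longlongrightarrow> ?G 0) (at_right (ereal 0))"
    proof -
      have "isCont ?G 0" by (rule DERIV_isCont[OF der])
      then show ?thesis
        by (auto simp: ereal_tendsto_simps isCont_def intro: tendsto_within_subset)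
    qed
    show "((?G \<circ> real_of_ereal) \<longlongrightarrow> 0) (at_left \<infinity>)"
      using lim by (simp add: ereal_tendsto_simps)
  qed simp
  moreover have "(LBINT u=ereal 0..\<infinity>. ?g u) = (LINT u:{0..}|lborel. ?g u)"
    by (simp add: interval_lebesgue_integral_0_infty interval_lebesgue_integral_def einterval_def)
       (rule set_integral_cong_set, auto simp: set_borel_measurable_def intro!: AE_I'[of "{0}"])
  ultimately show ?thesis using ga by simp
qed

section \<open>The measure and its moments\<close>

lemma borel_measurable_cosh [measurable (raw)]:
  "f \<in> borel_measurable M \<Longrightarrow> (\<lambda>x. cosh (f x :: real)) \<in> borel_measurable M"
  by (rule measurable_compose[OF _ borel_measurable_continuous_onI[OF continuous_on_cosh[OF continuous_on_id]]])

lemma macdonald_measurable [measurable (raw)]: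
  "f \<in> borel_measurable M \<Longrightarrow> (\<lambda>x. macdonald \<alpha> (f x)) \<in> borel_measurable M"
proof (rule measurable_compose[of f M borel])
  show "macdonald \<alpha> \<in> borel_measurable borel"
    unfolding macdonald_def[abs_def] set_lebesgue_integral_def
    by (rule lborel.borel_measurable_lebesgue_integral) simp
qed

lemma macdonald_nonneg: "macdonald \<alpha> x \<ge> 0"
  unfolding macdonald_def set_lebesgue_integral_def
  by (intro integral_nonneg_AE AE_I2) (auto simp: less_imp_le[OF cosh_real_pos] split: split_indicator)

text \<open>A Bochner integral is 0 by convention when it diverges, so convergence has to be
  established before the function can enter Tonelli arguments. The exponential beats every power of
  cosh u, in particular the power with exponent -(\<alpha> + 2) handled above.\<close>

lemma nn_integral_macdonald:
  assumes "\<alpha> > -1" "x > 0"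
  shows "ennreal (macdonald \<alpha> x) = (\<integral>\<^sup>+u. ennreal (exp (- x * cosh u) * cosh (\<alpha> * u)) * indicator {0..} u \<partial>lborel)"
proof -
  define b where "b = \<alpha> + 2"
  have b: "b > 0" using assms b_def by simp
  \<comment> \<open>The maximum of y^b exp (- x y) over y > 0, attained at y = b / x.\<close>
  define C where "C = exp (b * ln (b / x) - b)"
  have bd: "exp (- x * y) \<le> C * y powr (- b)" if "y > 0" for y
  proof -
    have "ln (x * y / b) \<le> x * y / b - 1" using assms that b by (intro ln_le_minus_one) simp
    then have "b * ln (x * y / b) \<le> x * y - b" using b by (simp add: field_simps)
    moreover have "ln (x * y / b) = ln y - ln (b / x)" using assms that b by (simp add: ln_div ln_mult)
    ultimately have "- x * y \<le> b * ln (b / x) - b + - b * ln y" by (simp add: algebra_simps)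
    then have "exp (- x * y) \<le> exp (b * ln (b / x) - b + - b * ln y)" by simp
    also have "\<dots> = C * y powr (- b)" using that by (simp add: C_def powr_def flip: exp_add)
    finally show ?thesis .
  qed
  have "set_integrable lborel {0..} (\<lambda>u. exp (- x * cosh u) * cosh (\<alpha> * u))"
  proof (rule set_integrable_bound)
    show "set_integrable lborel {0..} (\<lambda>u. C * (cosh (\<alpha> * u) * cosh u powr (- b)))"
      using assms by (intro set_integrable_mult_right set_integrable_cosh) (auto simp: b_def)
    show "set_borel_measurable lborel {0..} (\<lambda>u. exp (- x * cosh u) * cosh (\<alpha> * u))"
      by (simp add: set_borel_measurable_def)
    have "exp (- x * cosh u) * cosh (\<alpha> * u) \<le> C * (cosh (\<alpha> * u) * cosh u powr (- b))" for u
      using mult_right_mono[OF bd[OF cosh_real_pos[of u]], of "cosh (\<alpha> * u)"] by (simp add: mult_ac)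
    then show "AE u in lborel. u \<in> {0..} \<longrightarrow> norm (exp (- x * cosh u) * cosh (\<alpha> * u))
         \<le> norm (C * (cosh (\<alpha> * u) * cosh u powr (- b)))"
      by (auto simp: abs_mult C_def)
  qed
  then have "(\<integral>\<^sup>+u. ennreal (indicator {0..} u *\<^sub>R (exp (- x * cosh u) * cosh (\<alpha> * u))) \<partial>lborel) = ennreal (macdonald \<alpha> x)"
    unfolding macdonald_def set_lebesgue_integral_def set_integrable_def
    by (intro nn_integral_eq_integral) (auto intro!: AE_I2 mult_nonneg_nonneg)
  moreover have "(\<integral>\<^sup>+u. ennreal (indicator {0..} u *\<^sub>R (exp (- x * cosh u) * cosh (\<alpha> * u))) \<partial>lborel)
    = (\<integral>\<^sup>+u. ennreal (exp (- x * cosh u) * cosh (\<alpha> * u)) * indicator {0..} u \<partial>lborel)"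
    by (intro nn_integral_cong) (auto split: split_indicator)
  ultimately show ?thesis by simp
qed

section \<open>Gaussian integrals, moments and rotation invariance of the measure\<close>

locale deformed_bargmann =
  fixes \<mu> :: real
  assumes mu: "\<mu> > - 1/2"
begin

abbreviation N where "N \<equiv> nu_e \<mu>"

lemma sets_N [simp, measurable_cong]: "sets N = sets borel" by (simp add: nu_e_def)
lemma space_N [simp]: "space N = UNIV" by (simp add: nu_e_def)

lemma measurable_N [simp]: "borel_measurable N = borel_measurable borel"
  by (rule measurable_cong_sets) simp_all

definition nu_const :: real where "nu_const = 2 powr (1/2 - \<mu>) / (pi * Gamma (\<mu> + 1/2))"

lemma nu_const_pos: "nu_const > 0"
  using mu Gamma_real_pos[of "\<mu> + 1/2"] by (simp add: nu_const_def)

text \<open>The integral representation writes the density as a superposition over u of Gaussians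
  exp (- cosh u |z|^2) times a power of |z|. After Tonelli each of them gives a Gamma value; b < 1
  \<le> cosh u keeps the exponents negative.\<close>

lemma nn_integral_N_exp:
  assumes "b < 1"
  shows "(\<integral>\<^sup>+z. ennreal (norm z ^ (2 * k) * exp (b * nsq z)) \<partial>N)
    = ennreal (nu_const * pi * Gamma (\<mu> + 3/2 + k)) *
      (\<integral>\<^sup>+u. ennreal (cosh ((\<mu> - 1/2) * u) * (cosh u - b) powr (- (\<mu> + 3/2 + k))) * indicator {0..} u \<partial>lborel)"
proof -
  \<comment> \<open>The power (|z|^2)^\<kappa> collects |z|^(2 \<mu> + 1) from the density and
    |z|^(2 k).\<close>
  define \<kappa> where "\<kappa> = \<mu> + 1/2 + real k"
  have \<kappa>: "\<kappa> > 0" "\<kappa> + 1 = \<mu> + 3/2 + k" using mu by (simp_all add: \<kappa>_def)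
  have G: "Gamma (\<kappa> + 1) \<ge> 0" using \<kappa> Gamma_real_pos[of "\<kappa> + 1"] by simp
  define c where "c = nu_const"
  have c: "c > 0" using nu_const_pos c_def by simp
  let ?w = "\<lambda>z::complex. c * ((nsq z) powr \<kappa> * exp (b * nsq z))"
  let ?m = "\<lambda>u. ennreal (cosh ((\<mu> - 1/2) * u)) * indicator {0..} u"
  have pt: "ennreal (nu_e_density \<mu> z) * ennreal (norm z ^ (2 * k) * exp (b * nsq z))
     = (\<integral>\<^sup>+u. ennreal c * ennreal (exp (- (cosh u - b) * nsq z) * (nsq z) powr \<kappa>) * ?m u \<partial>lborel)" for z
  proof (cases "z = 0")
    case True
    then show ?thesis by (simp add: nu_e_density_def)
  next
    case False
    let ?r = "nsq z"
    have r: "?r > 0" using False by simp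
    have "?r powr \<kappa> = norm z powr (2 * \<kappa>)"
      using False by (simp add: powr_powr flip: powr_numeral)
    also have "\<dots> = norm z powr (2 * \<mu> + 1) * norm z powr (real (2 * k))"
      by (subst powr_add[symmetric]) (simp add: \<kappa>_def algebra_simps)
    also have "norm z powr (real (2 * k)) = norm z ^ (2 * k)"
      using False by (subst powr_realpow) auto
    finally have p: "norm z powr (2 * \<mu> + 1) * norm z ^ (2 * k) = ?r powr \<kappa>" by simp
    have "nu_e_density \<mu> z * (norm z ^ (2 * k) * exp (b * ?r)) = ?w z * macdonald (\<mu> - 1/2) ?r"
      unfolding p[symmetric] by (simp add: nu_e_density_def c_def nu_const_def mult_ac)
    then have "ennreal (nu_e_density \<mu> z) * ennreal (norm z ^ (2 * k) * exp (b * ?r))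
       = ennreal (?w z) * ennreal (macdonald (\<mu> - 1/2) ?r)"
      using c nu_const_pos macdonald_nonneg[of "\<mu> - 1/2" ?r]
      by (subst (1 2) ennreal_mult'[symmetric]) (auto simp: nu_e_density_def nu_const_def[symmetric])
    also have "\<dots> = (\<integral>\<^sup>+u. ennreal (?w z) * (ennreal (exp (- ?r * cosh u) * cosh ((\<mu> - 1/2) * u)) * indicator {0..} u) \<partial>lborel)"
      using mu r by (subst nn_integral_macdonald) (simp_all add: nn_integral_cmult)
    also have "\<dots> = (\<integral>\<^sup>+u. ennreal c * ennreal (exp (- (cosh u - b) * ?r) * ?r powr \<kappa>) * ?m u \<partial>lborel)"
    proof (intro nn_integral_cong)
      fix u :: real
      have "?w z * (exp (- ?r * cosh u) * cosh ((\<mu> - 1/2) * u))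
        = c * (exp (- (cosh u - b) * ?r) * ?r powr \<kappa>) * cosh ((\<mu> - 1/2) * u)"
        by (simp add: left_diff_distrib exp_diff exp_minus field_simps)
      then show "ennreal (?w z) * (ennreal (exp (- ?r * cosh u) * cosh ((\<mu> - 1/2) * u)) * indicator {0..} u) =
        ennreal c * ennreal (exp (- (cosh u - b) * ?r) * ?r powr \<kappa>) * ?m u"
        using c by (auto split: split_indicator simp flip: ennreal_mult')
    qed
    finally show ?thesis .
  qed
  have [measurable]: "nu_e_density \<mu> \<in> borel_measurable borel"
    unfolding nu_e_density_def[abs_def] by measurable
  have "(\<integral>\<^sup>+z. ennreal (norm z ^ (2 * k) * exp (b * nsq z)) \<partial>N)
      = (\<integral>\<^sup>+z. ennreal (nu_e_density \<mu> z) * ennreal (norm z ^ (2 * k) * exp (b * nsq z)) \<partial>lborel)"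
    unfolding nu_e_def by (rule nn_integral_density) simp_all
  also have "\<dots> = (\<integral>\<^sup>+z. \<integral>\<^sup>+u. ennreal c * ennreal (exp (- (cosh u - b) * nsq (z::complex)) * (nsq z) powr \<kappa>) * ?m u \<partial>lborel \<partial>lborel)"
    unfolding pt ..
  also have "\<dots> = (\<integral>\<^sup>+u. \<integral>\<^sup>+z. ennreal c * ennreal (exp (- (cosh u - b) * nsq (z::complex)) * (nsq z) powr \<kappa>) * ?m u \<partial>lborel \<partial>lborel)"
    by (rule lborel_pair.Fubini'[symmetric]) simp
  also have "\<dots> = (\<integral>\<^sup>+u. ennreal (c * pi * Gamma (\<kappa> + 1)) *
      (ennreal (cosh ((\<mu> - 1/2) * u) * (cosh u - b) powr (- (\<kappa> + 1))) * indicator {0..} u) \<partial>lborel)"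
  proof (intro nn_integral_cong)
    fix u :: real
    have "cosh u - b > 0" using assms cosh_real_ge_1[of u] by simp
    then have "(\<integral>\<^sup>+z. ennreal c * ennreal (exp (- (cosh u - b) * nsq (z::complex)) * (nsq z) powr \<kappa>) * ?m u \<partial>lborel)
      = ennreal c * ennreal (pi * Gamma (\<kappa> + 1) * (cosh u - b) powr (- (\<kappa> + 1))) * ?m u"
      using \<kappa> by (subst nn_integral_multc, simp, subst nn_integral_cmult, simp, subst nn_integral_powr_exp_norm) auto
    then show "(\<integral>\<^sup>+z. ennreal c * ennreal (exp (- (cosh u - b) * nsq (z::complex)) * (nsq z) powr \<kappa>) * ?m u \<partial>lborel)
      = ennreal (c * pi * Gamma (\<kappa> + 1)) *
      (ennreal (cosh ((\<mu> - 1/2) * u) * (cosh u - b) powr (- (\<kappa> + 1))) * indicator {0..} u)"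
      using c G by (auto split: split_indicator simp: mult_ac simp flip: ennreal_mult')
  qed
  also have "\<dots> = ennreal (c * pi * Gamma (\<kappa> + 1)) *
     (\<integral>\<^sup>+u. (ennreal (cosh ((\<mu> - 1/2) * u) * (cosh u - b) powr (- (\<kappa> + 1))) * indicator {0..} u) \<partial>lborel)"
    by (rule nn_integral_cmult) simp
  finally show ?thesis by (simp add: \<kappa>(2) c_def)
qed

text \<open>The integral of |z|^(2 k), that is, the squared norm of z^k. It is defined by its closed
  form, to which the recursions of Gamma and \<open>cosh_int\<close> apply directly.\<close>

definition moment :: "nat \<Rightarrow> real" where
  "moment k = nu_const * pi * Gamma (\<mu> + 3/2 + k) * cosh_int (\<mu> - 1/2) (\<mu> + 3/2 + k)"

lemma cosh_int_nonneg: "cosh_int \<alpha> \<beta> \<ge> 0"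
  unfolding cosh_int_def set_lebesgue_integral_def
  by (intro integral_nonneg_AE AE_I2) (auto simp: less_imp_le[OF cosh_real_pos] split: split_indicator)

lemma moment_nonneg: "moment k \<ge> 0"
  using nu_const_pos mu Gamma_real_pos[of "\<mu> + 3/2 + k"] cosh_int_nonneg
  by (auto simp: moment_def intro!: mult_nonneg_nonneg)

lemma nn_integral_moment: "(\<integral>\<^sup>+z. ennreal (norm z ^ (2 * k)) \<partial>N) = ennreal (moment k)"
  using nn_integral_N_exp[of 0 k] nn_integral_cosh[of "\<mu> - 1/2" "\<mu> + 3/2 + k"] mu nu_const_pos
    Gamma_real_pos[of "\<mu> + 3/2 + k"]
  by (simp add: moment_def ennreal_mult')

lemma moment_integral: "integrable N (\<lambda>z. norm z ^ (2 * k))" "(LINT z|N. norm z ^ (2 * k)) = moment k"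
proof -
  show "integrable N (\<lambda>z. norm z ^ (2 * k))"
    using nn_integral_moment[of k] by (intro integrableI_nonneg) auto
  show "(LINT z|N. norm z ^ (2 * k)) = moment k"
    using nn_integral_moment[of k] moment_nonneg[of k] by (subst integral_eq_nn_integral) auto
qed

text \<open>The exponent \<mu> + 3/2 equals \<alpha> + 2 for \<alpha> = \<mu> - 1/2, the explicit
  case of \<open>cosh_int\<close>; the constants then cancel against the normalisation of the
  density.\<close>

lemma moment_0: "moment 0 = 1"
proof -
  have "Gamma (\<mu> + 1/2 + 1) = (\<mu> + 1/2) * Gamma (\<mu> + 1/2)"
    using mu by (intro Gamma_plus1) (auto elim!: nonpos_Ints_cases)
  then have g: "Gamma (\<mu> + 3/2) = (\<mu> + 1/2) * Gamma (\<mu> + 1/2)" by (simp add: add.assoc)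
  have "cosh_int (\<mu> - 1/2) (\<mu> - 1/2 + 2) = 2 powr (\<mu> - 1/2) / (\<mu> - 1/2 + 1)"
    using mu by (intro cosh_int_base) simp
  then have h: "cosh_int (\<mu> - 1/2) (\<mu> + 3/2) = 2 powr (\<mu> - 1/2) / (\<mu> + 1/2)" by (simp add: add.commute)
  have "2 powr (1/2 - \<mu>) * 2 powr (\<mu> - 1/2) = (1::real)" by (simp flip: powr_add)
  moreover have "Gamma (\<mu> + 1/2) \<noteq> 0" using Gamma_real_pos[of "\<mu> + 1/2"] mu by force
  ultimately show ?thesis using mu by (simp add: moment_def g h nu_const_def)
qed

text \<open>The functional equation of Gamma produces \<beta> (\<beta> + 1), which is exactly the
  factor on the left of \<open>cosh_int_rec\<close>. What remains is \<beta>^2 - (\<mu> - 1/2)^2, a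
  product of two linear factors in k.\<close>

lemma moment_rec: "moment (Suc (Suc k)) = (real k + 2) * (real k + 1 + 2 * \<mu>) * moment k"
proof -
  define \<beta> where "\<beta> = \<mu> + 3/2 + real k"
  have \<beta>: "\<beta> > 0" "\<beta> > \<bar>\<mu> - 1/2\<bar>" "\<beta> \<ge> \<mu> - 1/2 + 2" using mu by (auto simp: \<beta>_def)
  have "Gamma (\<beta> + 1) = \<beta> * Gamma \<beta>" "Gamma (\<beta> + 1 + 1) = (\<beta> + 1) * Gamma (\<beta> + 1)"
    using \<beta> by (intro Gamma_plus1; auto elim!: nonpos_Ints_cases)+
  then have g: "Gamma (\<beta> + 2) = \<beta> * (\<beta> + 1) * Gamma \<beta>" by (simp add: add.assoc mult_ac)
  have r: "\<beta> * (\<beta> + 1) * cosh_int (\<mu> - 1/2) (\<beta> + 2) = (\<beta>\<^sup>2 - (\<mu> - 1/2)\<^sup>2) * cosh_int (\<mu> - 1/2) \<beta>"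
    using \<beta> mu by (intro cosh_int_rec) auto
  have e: "\<mu> + 3/2 + real (Suc (Suc k)) = \<beta> + 2" by (simp add: \<beta>_def)
  have "moment (Suc (Suc k)) = nu_const * pi * Gamma \<beta> * (\<beta> * (\<beta> + 1) * cosh_int (\<mu> - 1/2) (\<beta> + 2))"
    unfolding moment_def e g by simp
  also have "\<dots> = (\<beta>\<^sup>2 - (\<mu> - 1/2)\<^sup>2) * moment k" unfolding r by (simp add: moment_def \<beta>_def)
  also have "\<beta>\<^sup>2 - (\<mu> - 1/2)\<^sup>2 = (real k + 2) * (real k + 1 + 2 * \<mu>)"
    by (simp add: \<beta>_def power2_eq_square field_simps)
  finally show ?thesis .
qed

text \<open>Two steps of the recursion of \<open>gamma_mu\<close> from an even index are one step of
  \<open>moment_rec\<close>. From an odd index the two recursions differ unless \<mu> = 0, so it is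
  the even kernel that reproduces in this measure.\<close>

lemma moment_even: "even k \<Longrightarrow> moment k = gamma_mu \<mu> k"
proof (induction k rule: induct_nat_012)
  case (ge2 n)
  then show ?case by (simp add: moment_rec chi_o_def add_ac)
qed (simp_all add: moment_0)

lemma gamma_mu_pos: "gamma_mu \<mu> k > 0"
proof (induction k)
  case (Suc k)
  have "real (Suc k) + 2 * \<mu> * chi_o (Suc k) > 0" using mu by (auto simp: chi_o_def)
  with Suc show ?case by simp
qed simp

sublocale N: prob_space N
proof
  have "emeasure N (space N) = (\<integral>\<^sup>+z. ennreal (norm z ^ (2 * 0)) \<partial>N)" by simp
  then show "emeasure N (space N) = 1" unfolding nn_integral_moment moment_0 by simp
qed

text \<open>Compared with the moments, the only change is cosh u - b in place of cosh u, and cosh u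
  - b \<ge> (1 - b) cosh u for 0 \<le> b < 1. This threshold is the source of the 1 in the condition
  on a.\<close>

lemma integrable_exp:
  assumes "b < 1"
  shows "integrable N (\<lambda>z. exp (b * nsq z))"
proof (rule integrableI_nonneg)
  \<comment> \<open>The comparison of cosh u - b with (1 - b) cosh u needs b \<ge> 0; a negative b
    only makes the integrand smaller.\<close>
  define b' where "b' = max 0 b"
  have b': "0 \<le> b'" "b' < 1" "b \<le> b'" using assms by (auto simp: b'_def)
  have "(\<integral>\<^sup>+z. ennreal (exp (b * nsq z)) \<partial>N) \<le> (\<integral>\<^sup>+z. ennreal (norm z ^ (2 * 0) * exp (b' * nsq z)) \<partial>N)"
    using b' by (intro nn_integral_mono ennreal_leI) (auto intro: mult_right_mono)
  also have "\<dots> = ennreal (nu_const * pi * Gamma (\<mu> + 3/2)) *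
      (\<integral>\<^sup>+u. ennreal (cosh ((\<mu> - 1/2) * u) * (cosh u - b') powr (- (\<mu> + 3/2))) * indicator {0..} u \<partial>lborel)"
    using nn_integral_N_exp[OF b'(2), of 0] by simp
  also have "\<dots> \<le> ennreal (nu_const * pi * Gamma (\<mu> + 3/2)) *
      (\<integral>\<^sup>+u. ennreal ((1 - b') powr (- (\<mu> + 3/2))) * (ennreal (cosh ((\<mu> - 1/2) * u) * cosh u powr (- (\<mu> + 3/2))) * indicator {0..} u) \<partial>lborel)"
  proof (intro mult_left_mono nn_integral_mono)
    fix u :: real
    have "(1 - b') * cosh u \<le> cosh u - b'" using b' cosh_real_ge_1[of u] mult_left_mono[of 1 "cosh u" b'] by (simp add: algebra_simps)
    then have "(cosh u - b') powr (- (\<mu> + 3/2)) \<le> ((1 - b') * cosh u) powr (- (\<mu> + 3/2))"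
      using mu b' by (intro powr_mono2') auto
    also have "\<dots> = (1 - b') powr (- (\<mu> + 3/2)) * cosh u powr (- (\<mu> + 3/2))" using b' by (simp add: powr_mult)
    finally have "cosh ((\<mu> - 1/2) * u) * (cosh u - b') powr (- (\<mu> + 3/2))
      \<le> (1 - b') powr (- (\<mu> + 3/2)) * (cosh ((\<mu> - 1/2) * u) * cosh u powr (- (\<mu> + 3/2)))"
      by (subst mult.left_commute) (intro mult_left_mono, simp_all)
    then show "ennreal (cosh ((\<mu> - 1/2) * u) * (cosh u - b') powr (- (\<mu> + 3/2))) * indicator {0..} u
      \<le> ennreal ((1 - b') powr (- (\<mu> + 3/2))) * (ennreal (cosh ((\<mu> - 1/2) * u) * cosh u powr (- (\<mu> + 3/2))) * indicator {0..} u)"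
      by (auto split: split_indicator intro!: ennreal_leI simp flip: ennreal_mult')
  qed simp
  also have "\<dots> < \<infinity>"
    using nn_integral_cosh[of "\<mu> - 1/2" "\<mu> + 3/2"] mu
    by (simp add: nn_integral_cmult ennreal_mult_less_top)
  finally show "(\<integral>\<^sup>+z. ennreal (exp (b * nsq z)) \<partial>N) < \<infinity>" .
qed auto

lemma nn_integral_rotate_N:
  assumes [measurable]: "f \<in> borel_measurable borel" and "norm \<omega> = 1"
  shows "(\<integral>\<^sup>+z. f (\<omega> * z) \<partial>N) = (\<integral>\<^sup>+z. f z \<partial>N)"
proof -
  have [measurable]: "nu_e_density \<mu> \<in> borel_measurable borel"
    unfolding nu_e_density_def[abs_def] by measurable
  have "nu_e_density \<mu> z = nu_e_density \<mu> (\<omega> * z)" for z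
    using assms by (simp add: nu_e_density_def norm_mult)
  then show ?thesis
    using nn_integral_rotate[of "\<lambda>z. ennreal (nu_e_density \<mu> z) * f z" \<omega>] assms(2)
    by (simp add: nu_e_def nn_integral_density)
qed

lemma distr_rotate_N:
  assumes "norm \<omega> = 1"
  shows "distr N borel ((*) \<omega>) = N"
proof (rule measure_eqI)
  fix A assume "A \<in> sets (distr N borel ((*) \<omega>))"
  then have [measurable]: "A \<in> sets borel" by simp
  have "emeasure (distr N borel ((*) \<omega>)) A = (\<integral>\<^sup>+z. indicator A z \<partial>distr N borel ((*) \<omega>))" by simp
  also have "\<dots> = (\<integral>\<^sup>+z. indicator A (\<omega> * z) \<partial>N)" by (subst nn_integral_distr) simp_all
  also have "\<dots> = emeasure N A" using assms by (subst nn_integral_rotate_N) simp_all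
  finally show "emeasure (distr N borel ((*) \<omega>)) A = emeasure N A" .
qed simp

lemma integral_rotate_N:
  fixes f :: "complex \<Rightarrow> 'b::{banach, second_countable_topology}"
  assumes "f \<in> borel_measurable borel" "norm \<omega> = 1"
  shows "(LINT z|N. f (\<omega> * z)) = (LINT z|N. f z)"
proof -
  have "(LINT z|N. f z) = (LINT z|distr N borel ((*) \<omega>). f z)" by (simp add: distr_rotate_N assms)
  also have "\<dots> = (LINT z|N. f (\<omega> * z))" using assms by (subst integral_distr) simp_all
  finally show ?thesis by simp
qed

end

section \<open>Fourier coefficients on circles\<close>

lemma borel_measurable_cnj [measurable (raw)]:
  "f \<in> borel_measurable M \<Longrightarrow> (\<lambda>x. cnj (f x)) \<in> borel_measurable M"
  by (rule measurable_compose[OF _ borel_measurable_continuous_onI[OF continuous_on_cnj[OF continuous_on_id]]])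

definition circ :: "real measure" where
  "circ = density lborel (\<lambda>t. ennreal (indicator {0..1} t))"

definition rot :: "real \<Rightarrow> complex" where
  "rot t = cis (2 * pi * t)"

lemma sets_circ [simp, measurable_cong]: "sets circ = sets borel" by (simp add: circ_def)
lemma space_circ [simp]: "space circ = UNIV" by (simp add: circ_def)

lemma norm_rot [simp]: "norm (rot t) = 1" by (simp add: rot_def)

lemma rot_measurable [measurable]: "rot \<in> borel_measurable borel"
  unfolding rot_def[abs_def] by (intro borel_measurable_continuous_onI continuous_intros)

interpretation circ: prob_space circ
proof
  have "emeasure circ (space circ) = (\<integral>\<^sup>+t. ennreal (indicator {0..1::real} t) \<partial>lborel)"
    unfolding circ_def by (subst emeasure_density) auto
  also have "\<dots> = emeasure lborel {0..1::real}"
    by (simp add: ennreal_indicator)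
  finally show "emeasure circ (space circ) = 1" by simp
qed

lemma integral_circ_cis: "(LINT t|circ. cis (2 * pi * of_int m * t)) = (if m = 0 then 1 else 0)"
proof (cases "m = 0")
  case False
  have "(LINT t|circ. cis (2 * pi * of_int m * t)) = (\<integral>t. indicator {0..1} t *\<^sub>R cis (2 * pi * of_int m * t) \<partial>lborel)"
    unfolding circ_def by (rule integral_density) (auto intro!: borel_measurable_continuous_onI continuous_intros)
  also have "\<dots> = (\<lambda>t. cis (2 * pi * of_int m * t) / (\<i> * of_real (2 * pi * of_int m))) 1
      - (\<lambda>t. cis (2 * pi * of_int m * t) / (\<i> * of_real (2 * pi * of_int m))) 0"
  proof (rule integral_FTC_Icc)
    fix t :: real
    have d: "((\<lambda>t. exp (\<i> * (2 * pi * of_int m * t)) / (\<i> * of_real (2 * pi * of_int m)))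
        has_vector_derivative exp (\<i> * (2 * pi * of_int m * t))) (at t within {0..1})"
      using False by (auto intro!: derivative_eq_intros has_vector_derivative_real_field
          simp: has_field_derivative_def scaleR_conv_of_real)
    then show "((\<lambda>t. cis (2 * pi * of_int m * t) / (\<i> * of_real (2 * pi * of_int m)))
        has_vector_derivative cis (2 * pi * of_int m * t)) (at t within {0..1})"
      by (simp add: cis_conv_exp)
  qed (auto intro!: continuous_intros)
  also have "\<dots> = 0" using cis_multiple_2pi[of "of_int m"] by simp
  finally show ?thesis using False by simp
qed (simp add: circ.prob_space[simplified])

lemma integral_circ_rot:
  "(LINT t|circ. rot t ^ j * cnj (rot t) ^ k) = (if j = k then 1 else 0)"
proof -
  have "rot t ^ j * cnj (rot t) ^ k = cis (2 * pi * of_int (int j - int k) * t)" for t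
    by (simp add: rot_def Complex.DeMoivre cis_cnj cis_mult algebra_simps)
  note e = this
  show ?thesis by (simp only: e integral_circ_cis) simp
qed

text \<open>Cauchy's coefficient formula. The series converges absolutely at z because it converges
  at the larger radius |z| + 1, and this majorant permits termwise integration over the
  circle.\<close>

lemma integral_circ_power_series:
  assumes f: "\<And>z. (\<lambda>k. c k * z ^ k) sums f z"
  shows "(LINT t|circ. cnj (rot t) ^ k * f (rot t * z)) = c k * z ^ k"
proof -
  have sm: "summable (\<lambda>j. norm (c j * z ^ j))"
  proof -
    have "summable (\<lambda>j. c j * complex_of_real (norm z + 1) ^ j)" using f sums_summable by blast
    then show ?thesis by (rule powser_insidea) simp
  qed
  have lim: "(\<lambda>n. \<Sum>j<n. c j * z ^ j * (rot t ^ j * cnj (rot t) ^ k)) \<longlonglongrightarrow> cnj (rot t) ^ k * f (rot t * z)" for t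
    using sums_mult[OF f[of "rot t * z"], of "cnj (rot t) ^ k"] by (simp add: sums_def power_mult_distrib mult_ac)
  have "(\<lambda>n. LINT t|circ. (\<Sum>j<n. c j * z ^ j * (rot t ^ j * cnj (rot t) ^ k)))
     \<longlonglongrightarrow> (LINT t|circ. cnj (rot t) ^ k * f (rot t * z))"
  proof (rule integral_dominated_convergence)
    show "AE t in circ. (\<lambda>n. \<Sum>j<n. c j * z ^ j * (rot t ^ j * cnj (rot t) ^ k)) \<longlonglongrightarrow> cnj (rot t) ^ k * f (rot t * z)"
      using lim by (rule AE_I2)
    show "(\<lambda>t. cnj (rot t) ^ k * f (rot t * z)) \<in> borel_measurable circ"
      by (rule borel_measurable_LIMSEQ_metric[OF _ lim]) measurable
    show "integrable circ (\<lambda>t. \<Sum>j. norm (c j * z ^ j))" by simp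
    fix n
    show "AE t in circ. norm (\<Sum>j<n. c j * z ^ j * (rot t ^ j * cnj (rot t) ^ k)) \<le> (\<Sum>j. norm (c j * z ^ j))"
    proof (rule AE_I2)
      fix t
      have "norm (\<Sum>j<n. c j * z ^ j * (rot t ^ j * cnj (rot t) ^ k)) \<le> (\<Sum>j<n. norm (c j * z ^ j))"
        by (rule order_trans[OF norm_sum]) (simp add: norm_mult norm_power)
      also have "\<dots> \<le> (\<Sum>j. norm (c j * z ^ j))" by (rule sum_le_suminf[OF sm]) auto
      finally show "norm (\<Sum>j<n. c j * z ^ j * (rot t ^ j * cnj (rot t) ^ k)) \<le> (\<Sum>j. norm (c j * z ^ j))" .
    qed
  qed measurable
  moreover have "(LINT t|circ. (\<Sum>j<n. c j * z ^ j * (rot t ^ j * cnj (rot t) ^ k))) = (if k < n then c k * z ^ k else 0)" for n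
  proof -
    have i: "integrable circ (\<lambda>t. rot t ^ j * cnj (rot t) ^ k)" for j
      by (rule circ.integrable_const_bound[of _ 1]) (auto simp: norm_mult norm_power)
    have "(LINT t|circ. (\<Sum>j<n. c j * z ^ j * (rot t ^ j * cnj (rot t) ^ k)))
       = (\<Sum>j<n. c j * z ^ j * (LINT t|circ. rot t ^ j * cnj (rot t) ^ k))"
      by (subst integral_sum) (auto intro: i)
    also have "\<dots> = (\<Sum>j<n. if j = k then c k * z ^ k else 0)"
      by (intro sum.cong) (auto simp: integral_circ_rot)
    finally show ?thesis by (simp add: sum.delta')
  qed
  ultimately have "(\<lambda>n. if k < n then c k * z ^ k else 0) \<longlonglongrightarrow> (LINT t|circ. cnj (rot t) ^ k * f (rot t * z))" by simp
  moreover have "(\<lambda>n. if k < n then c k * z ^ k else 0) \<longlonglongrightarrow> c k * z ^ k"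
    by (rule tendsto_eventually) (auto simp: eventually_at_top_dense intro: exI[of _ k])
  ultimately show ?thesis by (rule LIMSEQ_unique)
qed

text \<open>Averaging the Taylor series with its reflection z -> -z removes the odd terms and, f
  being even, still sums to f.\<close>

lemma even_entire_power_series:
  assumes "f \<in> even_entire"
  obtains c where "\<And>z. (\<lambda>k. c k * z ^ k) sums f z" "\<And>k. odd k \<Longrightarrow> c k = 0"
proof -
  define d where "d k = (deriv ^^ k) f 0 / fact k" for k
  have d: "(\<lambda>k. d k * z ^ k) sums f z" for z
    using holomorphic_power_series[of f 0 "norm z + 1" z] assms
    by (auto simp: even_entire_def d_def intro: holomorphic_on_subset)
  define c where "c k = (if even k then d k else 0)" for k
  have "(\<lambda>k. c k * z ^ k) sums f z" for z
  proof -
    have "(\<lambda>k. (d k * z ^ k + d k * (- z) ^ k) / 2) sums ((f z + f (- z)) / 2)"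
      by (intro sums_divide sums_add d)
    moreover have "(d k * z ^ k + d k * (- z) ^ k) / 2 = c k * z ^ k" for k
      by (auto simp: c_def)
    ultimately show ?thesis using assms by (simp add: even_entire_def)
  qed
  then show ?thesis by (intro that[of c]) (auto simp: c_def)
qed

lemma even_entire_measurable: "f \<in> even_entire \<Longrightarrow> f \<in> borel_measurable borel"
  by (auto simp: even_entire_def intro!: borel_measurable_continuous_onI holomorphic_on_imp_continuous_on)

lemma power_le_fact_exp: "x \<ge> 0 \<Longrightarrow> x ^ k \<le> fact k * exp (x::real)"
proof -
  assume x: "x \<ge> 0"
  have "x ^ k / fact k \<le> (\<Sum>n. x ^ n / fact n)"
    using sum_le_suminf[OF summable_exp, of "{k}" x] x by (simp add: divide_inverse mult.commute)
  also have "\<dots> = exp x" by (simp add: exp_def divide_inverse mult.commute)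
  finally show ?thesis by (simp add: field_simps)
qed

section \<open>The kernel operator\<close>

context deformed_bargmann
begin

text \<open>The integral does not change when z is replaced by \<open>rot t * z\<close>. Averaging
  over t and exchanging the integrals lets the circle extract the k-th Taylor term pointwise in z,
  so orthogonality of monomials holds for f without an expansion of f in the mean.\<close>

lemma integral_cnj_power_mult:
  assumes f: "\<And>z. (\<lambda>k. c k * z ^ k) sums f z" and [measurable]: "f \<in> borel_measurable borel"
    and int: "integrable N (\<lambda>z. norm z ^ k * norm (f z))"
  shows "(LINT z|N. cnj z ^ k * f z) = c k * moment k"
proof -
  interpret P: pair_sigma_finite circ N ..
  let ?G = "\<lambda>(t, z). cnj (rot t * z) ^ k * f (rot t * z)"
  have nr: "(\<integral>\<^sup>+z. ennreal (norm (cnj (rot t * z) ^ k * f (rot t * z))) \<partial>N)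
     = (\<integral>\<^sup>+z. ennreal (norm z ^ k * norm (f z)) \<partial>N)" for t
    using nn_integral_rotate_N[of "\<lambda>z. ennreal (norm z ^ k * norm (f z))" "rot t"]
    by (simp add: norm_mult norm_power)
  have G: "integrable (circ \<Otimes>\<^sub>M N) ?G"
    unfolding integrable_iff_bounded
  proof
    show "?G \<in> borel_measurable (circ \<Otimes>\<^sub>M N)" by measurable
    have "(\<integral>\<^sup>+p. ennreal (norm (?G p)) \<partial>(circ \<Otimes>\<^sub>M N))
       = (\<integral>\<^sup>+t. \<integral>\<^sup>+z. ennreal (norm (cnj (rot t * z) ^ k * f (rot t * z))) \<partial>N \<partial>circ)"
      by (subst N.nn_integral_fst[symmetric]) auto
    also have "\<dots> = (\<integral>\<^sup>+z. ennreal (norm z ^ k * norm (f z)) \<partial>N)"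
      unfolding nr by (simp add: circ.emeasure_space_1[simplified])
    also have "\<dots> < \<infinity>" using int by (auto simp: integrable_iff_bounded norm_mult norm_power)
    finally show "(\<integral>\<^sup>+p. ennreal (norm (?G p)) \<partial>(circ \<Otimes>\<^sub>M N)) < \<infinity>" .
  qed
  have "(LINT t|circ. LINT z|N. cnj (rot t * z) ^ k * f (rot t * z))
      = (LINT z|N. LINT t|circ. cnj (rot t * z) ^ k * f (rot t * z))"
    using P.Fubini_integral[of "\<lambda>t z. cnj (rot t * z) ^ k * f (rot t * z)"] G by simp
  moreover have "(LINT z|N. cnj (rot t * z) ^ k * f (rot t * z)) = (LINT z|N. cnj z ^ k * f z)" for t
    by (rule integral_rotate_N) auto
  moreover have "(LINT t|circ. cnj (rot t * z) ^ k * f (rot t * z)) = c k * complex_of_real (norm z ^ (2 * k))" for z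
  proof -
    have "(LINT t|circ. cnj (rot t * z) ^ k * f (rot t * z)) = (LINT t|circ. cnj z ^ k * (cnj (rot t) ^ k * f (rot t * z)))"
      by (simp add: power_mult_distrib mult_ac)
    also have "\<dots> = cnj z ^ k * (c k * z ^ k)"
      by (simp add: integral_circ_power_series[OF f])
    also have "\<dots> = c k * (z * cnj z) ^ k" by (simp add: power_mult_distrib)
    finally show ?thesis by (simp add: complex_norm_square[symmetric] power_mult)
  qed
  ultimately have "(LINT z|N. cnj z ^ k * f z) = (LINT z|N. c k * complex_of_real (norm z ^ (2 * k)))"
    by (simp add: circ.prob_space[simplified])
  also have "\<dots> = c k * complex_of_real (LINT z|N. norm z ^ (2 * k))"
    by (simp del: of_real_power)
  also have "(LINT z|N. norm z ^ (2 * k)) = moment k"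
    using nn_integral_moment[of k] moment_nonneg[of k]
    by (subst integral_eq_nn_integral) auto
  finally show ?thesis .
qed

section \<open>Growth and symmetry of the kernel\<close>

definition kc :: "nat \<Rightarrow> real" where
  "kc k = (if even k then 1 / gamma_mu \<mu> k else 0)"

lemma kc_nonneg: "kc k \<ge> 0"
  using gamma_mu_pos[of k] by (simp add: kc_def)

lemma kernel_e_eq: "kernel_e \<mu> z w = (\<Sum>k. complex_of_real (kc k) * (cnj z * w) ^ k)"
  unfolding kernel_e_def by (intro suminf_cong) (simp add: kc_def)

text \<open>For \<mu> < 0 the coefficients may exceed 1 / k!, but the quotient of consecutive ratios
  over two steps is (2n + 1) / (2n + 1 + 2 \<mu>), which tends to 1; the geometric factor (1 +
  \<delta>)^k absorbs it.\<close>

lemma kc_bound: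
  assumes "\<delta> > 0"
  obtains C where "C > 0" "\<And>k. kc k \<le> C * (1 + \<delta>) ^ k / fact k"
proof -
  define r where "r n = fact (2 * n) / (gamma_mu \<mu> (2 * n) * (1 + \<delta>) ^ (2 * n))" for n
  have rpos: "r n > 0" for n using assms gamma_mu_pos by (simp add: r_def)
  \<comment> \<open>From here on 2n + 1 \<le> 2n (1 + \<delta>), while 2n \<le> 2n + 1 + 2 \<mu>
    because \<mu> > - 1/2; so r decreases beyond n0 and its maximum lies among the first
    terms.\<close>
  obtain n0 :: nat where n0: "real n0 \<ge> 1 / (2 * \<delta>)" using real_arch_simple by blast
  have dec: "r (Suc n) \<le> r n" if "n \<ge> n0" for n
  proof -
    have "1 \<le> 2 * \<delta> * real n"
      using n0 that assms by (simp add: field_simps) (smt (verit) mult_left_mono of_nat_mono)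
    then have a: "2 * real n + 1 \<le> 2 * real n * (1 + \<delta>) " by (simp add: algebra_simps)
    also have "\<dots> \<le> (2 * real n + 1 + 2 * \<mu>) * (1 + \<delta>)\<^sup>2"
    proof (rule mult_mono)
      show "1 + \<delta> \<le> (1 + \<delta>)\<^sup>2" using assms by (simp add: power2_eq_square algebra_simps)
    qed (use mu assms in auto)
    finally have le: "(2 * real n + 1) \<le> (2 * real n + 1 + 2 * \<mu>) * (1 + \<delta>)\<^sup>2" .
    have "r (Suc n) = r n * ((2 * real n + 1) / ((2 * real n + 1 + 2 * \<mu>) * (1 + \<delta>)\<^sup>2))"
    proof -
      have "gamma_mu \<mu> (2 * Suc n) = (2 * real n + 2) * ((2 * real n + 1 + 2 * \<mu>) * gamma_mu \<mu> (2 * n))"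
        by (simp add: chi_o_def add_ac)
      moreover have "(fact (2 * Suc n) :: real) = (2 * real n + 2) * ((2 * real n + 1) * fact (2 * n))"
        by (simp add: algebra_simps)
      moreover have "(1 + \<delta>) ^ (2 * Suc n) = (1 + \<delta>)\<^sup>2 * (1 + \<delta>) ^ (2 * n)"
        by (simp add: power_add power2_eq_square)
      moreover have "A * (B * F) / (A * (D * G) * (E * H)) = F / (G * H) * (B / (D * E))" if "A \<noteq> 0" for A B D E F G H :: real
        using that by (simp add: field_simps)
      moreover have "2 * real n + 2 \<noteq> 0" by linarith
      ultimately show ?thesis unfolding r_def by presburger
    qed
    also have "\<dots> \<le> r n * 1" using le mu assms rpos[of n]
      by (intro mult_left_mono) (auto simp: divide_le_eq_1 mult_pos_pos)
    finally show ?thesis by simp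
  qed
  define C where "C = Max (r ` {..n0})"
  have C1: "r n \<le> C" if "n \<le> n0" for n unfolding C_def using that by (intro Max_ge) auto
  have C2: "r n \<le> C" for n
  proof (cases "n \<le> n0")
    case False
    then have "n0 \<le> n" by simp
    then have "r n \<le> r n0" by (induction rule: dec_induct) (auto dest: dec intro: order_trans)
    then show ?thesis using C1[of n0] by simp
  qed (rule C1)
  show ?thesis
  proof (rule that)
    show Cp: "C > 0" using C2[of 0] rpos[of 0] by linarith
    fix k
    show "kc k \<le> C * (1 + \<delta>) ^ k / fact k"
    proof (cases "even k")
      case True
      then obtain n where k: "k = 2 * n" by blast
      have "fact k / (gamma_mu \<mu> k * (1 + \<delta>) ^ k) \<le> C" using C2[of n] by (simp add: r_def k)
      moreover have "gamma_mu \<mu> k > 0" "(1 + \<delta>) ^ k > 0" using gamma_mu_pos assms by auto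
      ultimately show ?thesis using True by (simp add: kc_def field_simps)
    next
      case False then show ?thesis using Cp assms by (simp add: kc_def)
    qed
  qed
qed

lemma kc_series_bound:
  assumes "\<delta> > 0"
  obtains C where "C > 0" "\<And>x n. x \<ge> 0 \<Longrightarrow> (\<Sum>k<n. kc k * x ^ k) \<le> C * exp ((1 + \<delta>) * x)"
    "\<And>x. x \<ge> 0 \<Longrightarrow> summable (\<lambda>k. kc k * x ^ k)"
proof -
  obtain C where C: "C > 0" "\<And>k. kc k \<le> C * (1 + \<delta>) ^ k / fact k" using kc_bound[OF assms] by blast
  have t: "kc k * x ^ k \<le> C * (((1 + \<delta>) * x) ^ k /\<^sub>R fact k)" if "x \<ge> 0" for x k
    using mult_right_mono[OF C(2), of "x ^ k" k] that by (simp add: power_mult_distrib divide_inverse mult_ac)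
  have s: "(\<lambda>k. C * (((1 + \<delta>) * x) ^ k /\<^sub>R fact k)) sums (C * exp ((1 + \<delta>) * x))" for x
    by (intro sums_mult exp_converges)
  show ?thesis
  proof (rule that[OF C(1)])
    fix x :: real assume x: "x \<ge> 0"
    show "summable (\<lambda>k. kc k * x ^ k)"
      using s[of x] by (intro summable_comparison_test'[OF sums_summable[OF s[of x]], of 0])
        (use t[OF x] kc_nonneg x in \<open>auto simp: abs_mult\<close>)
    fix n
    have "(\<Sum>k<n. kc k * x ^ k) \<le> (\<Sum>k<n. C * (((1 + \<delta>) * x) ^ k /\<^sub>R fact k))"
      by (intro sum_mono t x)
    also have "\<dots> \<le> C * exp ((1 + \<delta>) * x)"
      unfolding sums_unique[OF s]
      by (rule sum_le_suminf[OF sums_summable[OF s]]) (use C(1) x assms in auto)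
    finally show "(\<Sum>k<n. kc k * x ^ k) \<le> C * exp ((1 + \<delta>) * x)" .
  qed
qed

lemma kernel_e_sums: "(\<lambda>k. complex_of_real (kc k) * (cnj z * w) ^ k) sums kernel_e \<mu> z w"
proof -
  obtain C where "\<And>x. x \<ge> 0 \<Longrightarrow> summable (\<lambda>k. kc k * x ^ k)" by (rule kc_series_bound[OF zero_less_one]) blast
  then have "summable (\<lambda>k. norm (complex_of_real (kc k) * (cnj z * w) ^ k))"
    using kc_nonneg by (simp add: norm_mult norm_power)
  then show ?thesis unfolding kernel_e_eq by (rule summable_sums[OF summable_norm_cancel])
qed

lemma norm_kernel_partial:
  "norm (\<Sum>k<n. complex_of_real (kc k) * (cnj z * w) ^ k) \<le> (\<Sum>k<n. kc k * (norm z * norm w) ^ k)"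
  by (rule order_trans[OF norm_sum]) (simp add: norm_mult norm_power kc_nonneg)

lemma norm_kernel_bound:
  assumes "\<delta> > 0"
  obtains C where "C > 0" "\<And>z w. norm (kernel_e \<mu> z w) \<le> C * exp ((1 + \<delta>) * (norm z * norm w))"
proof -
  obtain C where C: "C > 0" "\<And>x n. x \<ge> 0 \<Longrightarrow> (\<Sum>k<n. kc k * x ^ k) \<le> C * exp ((1 + \<delta>) * x)"
    by (rule kc_series_bound[OF assms]) blast
  show ?thesis
  proof (rule that[OF C(1)])
    fix z w
    have "(\<lambda>n. norm (\<Sum>k<n. complex_of_real (kc k) * (cnj z * w) ^ k)) \<longlonglongrightarrow> norm (kernel_e \<mu> z w)"
      using kernel_e_sums[of z w] by (auto simp: sums_def intro: tendsto_norm)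
    then show "norm (kernel_e \<mu> z w) \<le> C * exp ((1 + \<delta>) * (norm z * norm w))"
    proof (rule LIMSEQ_le_const2, intro exI allI impI)
      fix n :: nat
      show "norm (\<Sum>k<n. complex_of_real (kc k) * (cnj z * w) ^ k) \<le> C * exp ((1 + \<delta>) * (norm z * norm w))"
        by (rule order_trans[OF norm_kernel_partial C(2)]) simp
    qed
  qed
qed

lemma kernel_e_measurable [measurable (raw)]:
  assumes [measurable]: "f \<in> borel_measurable M" "g \<in> borel_measurable M"
  shows "(\<lambda>x. kernel_e \<mu> (f x) (g x)) \<in> borel_measurable M"
proof (rule borel_measurable_LIMSEQ_metric)
  show "(\<lambda>n. \<Sum>k<n. complex_of_real (kc k) * (cnj (f x) * g x) ^ k) \<longlonglongrightarrow> kernel_e \<mu> (f x) (g x)" for x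
    using kernel_e_sums by (simp add: sums_def)
qed measurable

lemma kernel_e_cnj: "cnj (kernel_e \<mu> z w) = kernel_e \<mu> w z"
proof -
  have "(\<lambda>k. cnj (complex_of_real (kc k) * (cnj z * w) ^ k)) sums cnj (kernel_e \<mu> z w)"
    using kernel_e_sums by (simp only: sums_cnj)
  then have "(\<lambda>k. complex_of_real (kc k) * (cnj w * z) ^ k) sums cnj (kernel_e \<mu> z w)"
    by (simp add: mult.commute)
  then show ?thesis using kernel_e_sums sums_unique2 by blast
qed

text \<open>For fixed w the kernel and all its partial sums are bounded by a multiple of exp (c
  |z|). This is therefore the class on which the kernel series can be integrated termwise; it
  contains L^p for p > 1 and everything of Gaussian growth with weight below 1.\<close>

definition exp_integrable :: "(complex \<Rightarrow> complex) \<Rightarrow> bool" where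
  "exp_integrable u \<longleftrightarrow> u \<in> borel_measurable borel \<and> (\<forall>c. integrable N (\<lambda>z. exp (c * norm z) * norm (u z)))"

lemma exp_integrable_power:
  assumes "exp_integrable u"
  shows "integrable N (\<lambda>z. norm z ^ k * norm (u z))"
proof (rule integrable_bound)
  have [measurable]: "u \<in> borel_measurable borel" using assms by (simp add: exp_integrable_def)
  have "integrable N (\<lambda>z. exp (1 * norm z) * norm (u z))"
    using assms unfolding exp_integrable_def by blast
  then show "integrable N (\<lambda>z. fact k * (exp (1 * norm z) * norm (u z)))"
    by (rule integrable_mult_right)
  show "(\<lambda>z. norm z ^ k * norm (u z)) \<in> borel_measurable N" by measurable
  show "AE z in N. norm (norm z ^ k * norm (u z)) \<le> norm (fact k * (exp (1 * norm z) * norm (u z)))"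
  proof (rule AE_I2)
    fix z
    show "norm (norm z ^ k * norm (u z)) \<le> norm (fact k * (exp (1 * norm z) * norm (u z)))"
      using mult_right_mono[OF power_le_fact_exp[of "norm z" k], of "norm (u z)"] by (simp add: abs_mult mult.assoc)
  qed
qed

lemma exp_integrable_cnj_power:
  assumes "exp_integrable u"
  shows "integrable N (\<lambda>z. cnj z ^ k * u z)"
proof (rule integrable_bound[OF exp_integrable_power[OF assms, of k]])
  have [measurable]: "u \<in> borel_measurable borel" using assms by (simp add: exp_integrable_def)
  show "(\<lambda>z. cnj z ^ k * u z) \<in> borel_measurable N" by measurable
qed (auto simp: norm_mult norm_power)

text \<open>Termwise integration with majorant C exp (2 |w| |z|) |u z|. The Taylor coefficients
  found here show that the image is entire, that it is even, and that even entire functions are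
  reproduced.\<close>

lemma K_e_sums:
  assumes "exp_integrable u"
  shows "(\<lambda>k. complex_of_real (kc k) * (LINT z|N. cnj z ^ k * u z) * w ^ k) sums K_e \<mu> u w"
proof -
  have [measurable]: "u \<in> borel_measurable borel" using assms by (simp add: exp_integrable_def)
  obtain C where C: "C > 0" "\<And>x n. x \<ge> 0 \<Longrightarrow> (\<Sum>k<n. kc k * x ^ k) \<le> C * exp ((1 + 1) * x)"
    by (rule kc_series_bound[OF zero_less_one]) blast
  have "(\<lambda>n. LINT z|N. (\<Sum>k<n. complex_of_real (kc k) * (cnj z * w) ^ k) * u z)
      \<longlonglongrightarrow> (LINT z|N. kernel_e \<mu> z w * u z)"
  proof (rule integral_dominated_convergence)
    show "integrable N (\<lambda>z. C * (exp (2 * norm w * norm z) * norm (u z)))"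
      using assms by (auto simp: exp_integrable_def)
    show "AE z in N. (\<lambda>n. (\<Sum>k<n. complex_of_real (kc k) * (cnj z * w) ^ k) * u z) \<longlonglongrightarrow> kernel_e \<mu> z w * u z"
      using kernel_e_sums by (intro AE_I2 tendsto_mult_right) (simp add: sums_def)
    fix n
    show "AE z in N. norm ((\<Sum>k<n. complex_of_real (kc k) * (cnj z * w) ^ k) * u z)
        \<le> C * (exp (2 * norm w * norm z) * norm (u z))"
    proof (rule AE_I2)
      fix z
      have "norm (\<Sum>k<n. complex_of_real (kc k) * (cnj z * w) ^ k) \<le> C * exp ((1 + 1) * (norm z * norm w))"
        by (rule order_trans[OF norm_kernel_partial C(2)]) simp
      then have "norm (\<Sum>k<n. complex_of_real (kc k) * (cnj z * w) ^ k) * norm (u z)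
        \<le> C * exp ((1 + 1) * (norm z * norm w)) * norm (u z)" by (rule mult_right_mono) simp
      then show "norm ((\<Sum>k<n. complex_of_real (kc k) * (cnj z * w) ^ k) * u z)
        \<le> C * (exp (2 * norm w * norm z) * norm (u z))"
        by (simp add: norm_mult mult_ac)
    qed
  qed measurable
  moreover have "(LINT z|N. (\<Sum>k<n. complex_of_real (kc k) * (cnj z * w) ^ k) * u z)
     = (\<Sum>k<n. complex_of_real (kc k) * (LINT z|N. cnj z ^ k * u z) * w ^ k)" for n
  proof -
    have "(LINT z|N. (\<Sum>k<n. complex_of_real (kc k) * (cnj z * w) ^ k) * u z)
      = (LINT z|N. (\<Sum>k<n. complex_of_real (kc k) * w ^ k * (cnj z ^ k * u z)))"
      by (intro integral_cong refl, subst sum_distrib_right, intro sum.cong refl)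
        (simp add: power_mult_distrib mult_ac)
    also have "\<dots> = (\<Sum>k<n. complex_of_real (kc k) * w ^ k * (LINT z|N. cnj z ^ k * u z))"
      by (subst integral_sum) (auto intro!: exp_integrable_cnj_power assms)
    finally show ?thesis by (simp add: mult_ac)
  qed
  ultimately show ?thesis by (simp add: sums_def K_e_def)
qed

lemma K_e_even_entire:
  assumes "exp_integrable u"
  shows "K_e \<mu> u \<in> even_entire"
proof -
  have "K_e \<mu> u holomorphic_on ball 0 (real n)" for n
    using K_e_sums[OF assms] by (intro power_series_holomorphic[where a = "\<lambda>k. complex_of_real (kc k) * (LINT z|N. cnj z ^ k * u z)"]) simp
  then have "K_e \<mu> u holomorphic_on (\<Union>n. ball 0 (real n))" by (intro holomorphic_on_UN_open) auto
  moreover have "(\<Union>n. ball (0::complex) (real n)) = UNIV"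
    by (auto simp: reals_Archimedean2)
  moreover have "K_e \<mu> u (- w) = K_e \<mu> u w" for w
  proof -
    have e: "complex_of_real (kc k) * (LINT z|N. cnj z ^ k * u z) * (- w) ^ k
        = complex_of_real (kc k) * (LINT z|N. cnj z ^ k * u z) * w ^ k" for k
      by (cases "even k") (auto simp: kc_def)
    show ?thesis
      by (rule sums_unique2[OF K_e_sums[OF assms, of "- w", unfolded e] K_e_sums[OF assms, of w]])
  qed
  ultimately show ?thesis by (simp add: even_entire_def)
qed

text \<open>At even k the factor 1 / \<open>gamma_mu \<mu> k\<close> cancels the squared norm of
  z^k; at odd k both coefficients are 0.\<close>

lemma K_e_reproducing:
  assumes "f \<in> even_entire" "exp_integrable f"
  shows "K_e \<mu> f = f"
proof
  fix w
  obtain c where c: "\<And>z. (\<lambda>k. c k * z ^ k) sums f z" "\<And>k. odd k \<Longrightarrow> c k = 0"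
    using even_entire_power_series[OF assms(1)] by blast
  have "complex_of_real (kc k) * (LINT z|N. cnj z ^ k * f z) * w ^ k = c k * w ^ k" for k
  proof (cases "even k")
    case True
    have "(LINT z|N. cnj z ^ k * f z) = c k * gamma_mu \<mu> k"
      using integral_cnj_power_mult[OF c(1) even_entire_measurable[OF assms(1)] exp_integrable_power[OF assms(2)], of k]
      by (simp add: moment_even True)
    then show ?thesis using True gamma_mu_pos[of k] by (simp add: kc_def)
  qed (simp add: c kc_def)
  note e = this
  have "(\<lambda>k. c k * w ^ k) sums K_e \<mu> f w" using K_e_sums[OF assms(2), of w] by (simp only: e)
  then show "K_e \<mu> f w = f w" using c(1) sums_unique2 by blast
qed

end

section \<open>Hoelder's inequality and weighted squares\<close>

lemma Holder_nonneg:
  fixes f g :: "'a \<Rightarrow> real"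
  assumes pq: "p > 1" "q > 1" "1 / p + 1 / q = 1"
    and [measurable]: "f \<in> borel_measurable M" "g \<in> borel_measurable M"
    and nn: "\<And>x. f x \<ge> 0" "\<And>x. g x \<ge> 0"
    and int: "integrable M (\<lambda>x. f x powr p)" "integrable M (\<lambda>x. g x powr q)"
  shows "integrable M (\<lambda>x. f x * g x)"
    and "(LINT x|M. f x * g x) \<le> (LINT x|M. f x powr p) powr (1 / p) * (LINT x|M. g x powr q) powr (1 / q)"
proof -
  show I: "integrable M (\<lambda>x. f x * g x)"
  proof (rule integrable_bound)
    show "integrable M (\<lambda>x. f x powr p / p + g x powr q / q)" using int by auto
    show "AE x in M. norm (f x * g x) \<le> norm (f x powr p / p + g x powr q / q)"
    proof (rule AE_I2)
      fix x
      have "norm (f x * g x) = f x * g x" using nn by simp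
      also have "\<dots> \<le> f x powr p / p + g x powr q / q" by (intro Youngs_inequality pq nn)
      also have "\<dots> \<le> norm (f x powr p / p + g x powr q / q)" by simp
      finally show "norm (f x * g x) \<le> norm (f x powr p / p + g x powr q / q)" .
    qed
  qed measurable
  define A where "A = (LINT x|M. f x powr p)"
  define B where "B = (LINT x|M. g x powr q)"
  have AB: "A \<ge> 0" "B \<ge> 0" by (auto simp: A_def B_def)
  show "(LINT x|M. f x * g x) \<le> A powr (1 / p) * B powr (1 / q)"
  proof (cases "A = 0 \<or> B = 0")
    case True
    then have "AE x in M. f x * g x = 0"
    proof
      assume "A = 0"
      then have "AE x in M. f x powr p = 0" unfolding A_def using int by (subst (asm) integral_nonneg_eq_0_iff_AE) auto
      then show ?thesis by eventually_elim auto
    next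
      assume "B = 0"
      then have "AE x in M. g x powr q = 0" unfolding B_def using int by (subst (asm) integral_nonneg_eq_0_iff_AE) auto
      then show ?thesis by eventually_elim auto
    qed
    then have "(LINT x|M. f x * g x) = 0" by (simp add: integral_eq_zero_AE)
    then show ?thesis by simp
  next
    case False
    then have pos: "A > 0" "B > 0" using AB by auto
    let ?a = "A powr (1 / p)" and ?b = "B powr (1 / q)"
    have ab: "?a > 0" "?b > 0" using pos by auto
    have "(LINT x|M. (f x / ?a) * (g x / ?b)) \<le> (LINT x|M. f x powr p / A / p + g x powr q / B / q)"
    proof (rule integral_mono)
      show "integrable M (\<lambda>x. f x / ?a * (g x / ?b))" using I by simp
      show "integrable M (\<lambda>x. f x powr p / A / p + g x powr q / B / q)" using int by auto
      fix x
      have "(f x / ?a) * (g x / ?b) \<le> (f x / ?a) powr p / p + (g x / ?b) powr q / q"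
        using nn ab by (intro Youngs_inequality pq) auto
      also have "(f x / ?a) powr p = f x powr p / A"
        using nn pos pq by (simp add: powr_divide powr_powr)
      also have "(g x / ?b) powr q = g x powr q / B"
        using nn pos pq by (simp add: powr_divide powr_powr)
      finally show "(f x / ?a) * (g x / ?b) \<le> f x powr p / A / p + g x powr q / B / q" .
    qed
    also have "\<dots> = 1 / p + 1 / q"
      using int pos by (simp add: A_def[symmetric] B_def[symmetric])
    also have "\<dots> = 1" by (rule pq)
    finally have "(LINT x|M. f x * g x) / (?a * ?b) \<le> 1" by simp
    then show ?thesis using ab by (simp add: field_simps)
  qed
qed

text \<open>Completing the square. It absorbs linear exponents c |z| into a Gaussian and splits |z|
  |w| unevenly between the two variables.\<close>

lemma mult_le_weighted_squares:
  fixes x y t :: real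
  assumes "t > 0"
  shows "x * y \<le> t * x\<^sup>2 + y\<^sup>2 / (4 * t)"
proof -
  have "0 \<le> (2 * t * x - y)\<^sup>2 / (4 * t)" using assms by simp
  also have "\<dots> = t * x\<^sup>2 + y\<^sup>2 / (4 * t) - x * y" using assms by (simp add: field_simps power2_eq_square)
  finally show ?thesis by simp
qed

section \<open>Functions of Gaussian growth, Bessel's inequality and the contraction
  property\<close>

context deformed_bargmann
begin

lemma integrable_exp_affine:
  assumes "b < 1"
  shows "integrable N (\<lambda>z. exp (c * norm z) * exp (b * nsq z))"
proof (rule integrable_bound)
  \<comment> \<open>Half of the room between b and 1 pays for the linear exponent.\<close>
  define t where "t = (1 - b) / 2"
  have t: "t > 0" "b + t < 1" using assms by (simp_all add: t_def field_simps)
  show "integrable N (\<lambda>z. exp (c\<^sup>2 / (4 * t)) * exp ((b + t) * nsq z))"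
    using integrable_exp[OF t(2)] by simp
  have "exp (c * norm z) * exp (b * nsq z) \<le> exp (c\<^sup>2 / (4 * t)) * exp ((b + t) * nsq z)" for z
    using mult_le_weighted_squares[OF t(1), of "norm z" c] by (simp add: algebra_simps flip: exp_add)
  then show "AE z in N. norm (exp (c * norm z) * exp (b * nsq z))
      \<le> norm (exp (c\<^sup>2 / (4 * t)) * exp ((b + t) * nsq z))" by (intro AE_I2) simp
qed measurable

lemma integrable_gauss:
  fixes g :: "complex \<Rightarrow> 'b::{banach, second_countable_topology}"
  assumes "g \<in> borel_measurable borel" "b < 1"
    and g: "\<And>z. norm (g z) \<le> D * (exp (c * norm z) * exp (b * nsq z))"
  shows "integrable N g"
proof (rule integrable_bound)
  show "integrable N (\<lambda>z. D * (exp (c * norm z) * exp (b * nsq z)))"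
    by (intro integrable_mult_right integrable_exp_affine assms)
  show "AE z in N. norm (g z) \<le> norm (D * (exp (c * norm z) * exp (b * nsq z)))"
    by (rule AE_I2) (use g in \<open>auto intro: order_trans[OF _ abs_ge_self]\<close>)
qed (use assms in simp)

lemma exp_integrable_gauss:
  assumes [measurable]: "u \<in> borel_measurable borel" and b: "b < 1"
    and u: "\<And>z. norm (u z) \<le> D * exp (b * nsq z)"
  shows "exp_integrable u"
  unfolding exp_integrable_def
proof (intro conjI allI)
  fix c
  show "integrable N (\<lambda>z. exp (c * norm z) * norm (u z))"
  proof (rule integrable_gauss[OF _ b, of _ D c])
    fix z
    show "norm (exp (c * norm z) * norm (u z)) \<le> D * (exp (c * norm z) * exp (b * nsq z))"
      using mult_left_mono[OF u[of z], of "exp (c * norm z)"] by (simp add: abs_mult mult_ac)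
  qed measurable
qed fact

lemma norm_poly_le_exp:
  fixes d :: "nat \<Rightarrow> complex"
  obtains D where "D \<ge> 0" "\<And>z. norm (\<Sum>k<n. d k * z ^ k) \<le> D * exp (norm z)"
proof (rule that)
  show "(\<Sum>k<n. norm (d k) * fact k) \<ge> 0" by (intro sum_nonneg) simp
  fix z
  have "norm (\<Sum>k<n. d k * z ^ k) \<le> (\<Sum>k<n. norm (d k) * norm z ^ k)"
    by (rule order_trans[OF norm_sum]) (simp add: norm_mult norm_power)
  also have "\<dots> \<le> (\<Sum>k<n. norm (d k) * (fact k * exp (norm z)))"
    by (intro sum_mono mult_left_mono power_le_fact_exp) simp_all
  finally show "norm (\<Sum>k<n. d k * z ^ k) \<le> (\<Sum>k<n. norm (d k) * fact k) * exp (norm z)"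
    by (simp only: sum_distrib_right mult.assoc)
qed

lemma poly_exp_integrable: "exp_integrable (\<lambda>z. \<Sum>k<n. d k * z ^ k)"
proof -
  obtain D where D: "D \<ge> 0" "\<And>z. norm (\<Sum>k<n. d k * z ^ k) \<le> D * exp (norm z)" using norm_poly_le_exp by blast
  show ?thesis
  proof (rule exp_integrable_gauss[of _ "1/2" "D * exp (1/2)"])
    fix z :: complex
    have "norm z \<le> 1/2 + 1/2 * nsq z" using sum_squares_bound[of "norm z" 1] by simp
    then have "exp (norm z) \<le> exp (1/2) * exp (1/2 * nsq z)" by (simp flip: exp_add)
    then show "norm (\<Sum>k<n. d k * z ^ k) \<le> D * exp (1/2) * exp (1/2 * nsq z)"
      using D(2)[of z] mult_left_mono[OF _ D(1)] by (fastforce simp: mult.assoc intro: order_trans)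
  qed auto
qed

lemma poly_norm_square:
  "integrable N (\<lambda>z. nsq (\<Sum>k<n. d k * z ^ k))"
  "(LINT z|N. nsq (\<Sum>k<n. d k * z ^ k)) = (\<Sum>k<n. nsq (d k) * moment k)"
proof -
  let ?P = "\<lambda>z. \<Sum>k<n. d k * z ^ k"
  have Pe: "exp_integrable ?P" by (rule poly_exp_integrable)
  have Pm: "?P \<in> borel_measurable borel" by measurable
  have Pc: "(\<lambda>k. (if k < n then d k else 0) * z ^ k) sums ?P z" for z
  proof -
    have "(\<lambda>k. (if k < n then d k else 0) * z ^ k) = (\<lambda>k. if k \<in> {..<n} then d k * z ^ k else 0)" by auto
    then show ?thesis using sums_If_finite_set[of "{..<n}" "\<lambda>k. d k * z ^ k"] by simp
  qed
  have n2: "of_real (nsq (?P z)) = (\<Sum>k<n. cnj (d k) * (cnj z ^ k * ?P z))" for z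
    unfolding complex_norm_square by (subst mult.commute) (simp add: sum_distrib_right mult.assoc)
  have "integrable N (\<lambda>z. \<Sum>k<n. cnj (d k) * (cnj z ^ k * ?P z))"
    using exp_integrable_cnj_power[OF Pe] by (intro integrable_sum integrable_mult_right)
  then have "integrable N (\<lambda>z. complex_of_real (nsq (?P z)))" unfolding n2 .
  then show "integrable N (\<lambda>z. nsq (?P z))" by (simp only: complex_of_real_integrable_eq)
  have "complex_of_real (LINT z|N. nsq (?P z)) = (LINT z|N. (\<Sum>k<n. cnj (d k) * (cnj z ^ k * ?P z)))"
    by (simp only: integral_complex_of_real[symmetric] n2)
  also have "\<dots> = (\<Sum>k<n. cnj (d k) * (LINT z|N. cnj z ^ k * ?P z))"
    using exp_integrable_cnj_power[OF Pe] by (subst integral_sum) auto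
  also have "\<dots> = (\<Sum>k<n. of_real (nsq (d k) * moment k))"
  proof (intro sum.cong refl)
    fix k assume "k \<in> {..<n}"
    then have "(LINT z|N. cnj z ^ k * ?P z) = d k * moment k"
      using integral_cnj_power_mult[OF Pc Pm exp_integrable_power[OF Pe], of k] by simp
    then show "cnj (d k) * (LINT z|N. cnj z ^ k * ?P z) = of_real (nsq (d k) * moment k)"
      unfolding of_real_mult complex_norm_square by (simp add: mult_ac)
  qed
  finally show "(LINT z|N. nsq (?P z)) = (\<Sum>k<n. nsq (d k) * moment k)"
    unfolding of_real_sum[symmetric] of_real_eq_iff .
qed

text \<open>Let P be the truncated image of u under the kernel and s the sum on the left. Then s is
  both the squared norm of P and the inner product of u with P, and 2 |P u| \<le> |P|^2 + |u|^2
  gives 2 s \<le> s plus the squared norm of u.\<close>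

lemma Bessel:
  assumes u: "exp_integrable u" and u2: "integrable N (\<lambda>z. nsq (u z))"
  shows "(\<Sum>k<n. kc k * nsq (LINT z|N. cnj z ^ k * u z)) \<le> (LINT z|N. nsq (u z))"
proof -
  define A where "A k = (LINT z|N. cnj z ^ k * u z)" for k
  define s where "s = (\<Sum>k<n. kc k * nsq (A k))"
  define d where "d k = complex_of_real (kc k) * A k" for k
  define P where "P z = (\<Sum>k<n. d k * z ^ k)" for z
  have P2: "integrable N (\<lambda>z. nsq (P z))" unfolding P_def by (rule poly_norm_square)
  have "nsq (d k) * moment k = kc k * nsq (A k)" for k
    using gamma_mu_pos[of k]
    by (cases "even k") (auto simp: d_def kc_def moment_even norm_divide power_divide power2_eq_square)
  then have nP: "(LINT z|N. nsq (P z)) = s" unfolding P_def poly_norm_square s_def by simp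
  have "complex_of_real s = (\<Sum>k<n. cnj (d k) * A k)"
    unfolding s_def d_def of_real_sum of_real_mult complex_norm_square by (intro sum.cong) simp_all
  also have "\<dots> = (LINT z|N. (\<Sum>k<n. cnj (d k) * (cnj z ^ k * u z)))"
    using exp_integrable_cnj_power[OF u] by (subst integral_sum) (auto simp: A_def)
  also have "\<dots> = (LINT z|N. cnj (P z) * u z)" by (simp add: P_def sum_distrib_right mult.assoc)
  finally have "s \<le> norm (LINT z|N. cnj (P z) * u z)" by (metis abs_ge_self norm_of_real)
  also have "\<dots> \<le> (LINT z|N. norm (cnj (P z) * u z))" by (rule integral_norm_bound)
  also have "\<dots> \<le> (LINT z|N. (nsq (P z) + nsq (u z)) / 2)"
  proof (rule integral_mono')
    show "integrable N (\<lambda>z. (nsq (P z) + nsq (u z)) / 2)" using P2 u2 by auto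
    fix z
    show "norm (cnj (P z) * u z) \<le> (nsq (P z) + nsq (u z)) / 2"
      using sum_squares_bound[of "norm (P z)" "norm (u z)"] by (simp add: norm_mult)
  qed simp
  also have "\<dots> = (s + (LINT z|N. nsq (u z))) / 2" using P2 u2 nP by simp
  finally have "s \<le> (LINT z|N. nsq (u z))" by simp
  then show ?thesis by (simp add: s_def A_def)
qed

text \<open>A partial sum of the kernel gives a sum of \<open>kc k\<close> times moments of u and of
  v; Cauchy-Schwarz and Bessel's inequality for u and cnj v bound it uniformly. The pointwise growth
  hypotheses make the passage to the full kernel a dominated limit.\<close>

lemma K_e_contraction:
  assumes [measurable]: "u \<in> borel_measurable borel" "v \<in> borel_measurable borel"
    and u: "\<And>z. norm (u z) \<le> D * exp (nsq z / 4)"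
    and v: "\<And>z. norm (v z) \<le> D * exp (nsq z / 4)"
  shows "norm (LINT w|N. K_e \<mu> u w * v w) \<le> sqrt (LINT z|N. nsq (u z)) * sqrt (LINT z|N. nsq (v z))"
proof -
  have D: "D \<ge> 0" using u[of 0] by simp (metis norm_ge_zero order_trans)
  have ei: "exp_integrable u" "exp_integrable v"
    using exp_integrable_gauss[of u "1/4" D] exp_integrable_gauss[of v "1/4" D] u v by simp_all
  have sq: "integrable N (\<lambda>z. nsq (h z))"
    if [measurable]: "h \<in> borel_measurable borel" and h: "\<And>z. norm (h z) \<le> D * exp (nsq z / 4)" for h :: "complex \<Rightarrow> complex"
  proof (rule integrable_gauss[of _ "1/2" "D\<^sup>2" 0])
    fix z
    have "nsq (h z) \<le> (D * exp (nsq z / 4))\<^sup>2" by (intro power_mono h) simp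
    then show "norm (nsq (h z)) \<le> D\<^sup>2 * (exp (0 * norm z) * exp (1 / 2 * nsq z))"
      by (simp add: power_mult_distrib flip: exp_double)
  qed auto
  define A where "A k = (LINT z|N. cnj z ^ k * u z)" for k
  define B where "B k = (LINT z|N. z ^ k * v z)" for k
  obtain C where C: "C > 0" "\<And>x n. x \<ge> 0 \<Longrightarrow> (\<Sum>k<n. kc k * x ^ k) \<le> C * exp ((1 + 1/4) * x)"
    by (rule kc_series_bound[of "1/4"]) auto
  \<comment> \<open>With \<delta> = 1/4 the kernel is at most C exp (5/8 |z|^2) exp (5/8 |w|^2), and
    u, v contribute 1/4 more: 5/8 + 1/4 = 7/8 < 1.\<close>
  define M where "M = (LINT z|N. exp (7 / 8 * nsq z))"
  have Mi: "integrable N (\<lambda>z. exp (7 / 8 * nsq z))" by (rule integrable_exp) simp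
  have M: "M \<ge> 0" by (simp add: M_def)
  have xy: "exp ((1 + 1/4) * (norm z * norm w)) \<le> exp (5/8 * nsq z) * exp (5/8 * nsq w)" for z w :: complex
    using sum_squares_bound[of "norm z" "norm w"] by (simp flip: exp_add)
  have part: "norm (\<Sum>k<n. complex_of_real (kc k) * A k * w ^ k) \<le> C * D * M * exp (5/8 * nsq w)" for n w
  proof -
    have i: "integrable N (\<lambda>z. complex_of_real (kc k) * w ^ k * (cnj z ^ k * u z))" for k
      using exp_integrable_cnj_power[OF ei(1)] by simp
    have "(\<Sum>k<n. complex_of_real (kc k) * A k * w ^ k) = (LINT z|N. (\<Sum>k<n. complex_of_real (kc k) * w ^ k * (cnj z ^ k * u z)))"
    proof (subst integral_sum[OF i], rule sum.cong[OF refl])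
      fix k
      show "complex_of_real (kc k) * A k * w ^ k = (LINT z|N. complex_of_real (kc k) * w ^ k * (cnj z ^ k * u z))"
        unfolding A_def by (subst integral_mult_right_zero) simp
    qed
    also have "norm \<dots> \<le> (LINT z|N. norm (\<Sum>k<n. complex_of_real (kc k) * w ^ k * (cnj z ^ k * u z)))"
      by (rule integral_norm_bound)
    also have "\<dots> \<le> (LINT z|N. C * D * exp (5/8 * nsq w) * exp (7 / 8 * nsq z))"
    proof (rule integral_mono')
      show "integrable N (\<lambda>z. C * D * exp (5/8 * nsq w) * exp (7 / 8 * nsq z))" using Mi by simp
      fix z
      have "norm (\<Sum>k<n. complex_of_real (kc k) * w ^ k * (cnj z ^ k * u z))
          \<le> (\<Sum>k<n. kc k * (norm z * norm w) ^ k * norm (u z))"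
        by (rule order_trans[OF norm_sum]) (simp add: norm_mult norm_power kc_nonneg power_mult_distrib mult_ac)
      also have "\<dots> = (\<Sum>k<n. kc k * (norm z * norm w) ^ k) * norm (u z)" by (simp add: sum_distrib_right)
      also have "\<dots> \<le> C * exp ((1 + 1/4) * (norm z * norm w)) * (D * exp (nsq z / 4))"
        using C D by (intro mult_mono u C) auto
      also have "\<dots> \<le> C * (exp (5/8 * nsq z) * exp (5/8 * nsq w)) * (D * exp (nsq z / 4))"
        using C D by (intro mult_right_mono mult_left_mono xy) auto
      also have "\<dots> = C * D * exp (5/8 * nsq w) * (exp (5/8 * nsq z) * exp (nsq z / 4))" by (simp add: mult_ac)
      also have "exp (5/8 * nsq z) * exp (nsq z / 4) = exp (7 / 8 * nsq z)"
        by (simp flip: exp_add)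
      finally show "norm (\<Sum>k<n. complex_of_real (kc k) * w ^ k * (cnj z ^ k * u z))
        \<le> C * D * exp (5/8 * nsq w) * exp (7 / 8 * nsq z)" .
    qed (use C D in auto)
    also have "\<dots> = C * D * M * exp (5/8 * nsq w)" using Mi by (simp add: M_def)
    finally show ?thesis .
  qed
  have bi: "integrable N (\<lambda>w. w ^ k * v w)" for k
  proof (rule integrable_bound[OF exp_integrable_power[OF ei(2), of k]])
  qed (auto simp: norm_mult norm_power)
  have "(\<lambda>n. LINT w|N. (\<Sum>k<n. complex_of_real (kc k) * A k * w ^ k) * v w) \<longlonglongrightarrow> (LINT w|N. K_e \<mu> u w * v w)"
  proof (rule integral_dominated_convergence)
    show "integrable N (\<lambda>w. C * D * M * D * exp (7/8 * nsq w))" using Mi by simp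
    show "(\<lambda>w. K_e \<mu> u w * v w) \<in> borel_measurable N"
      using even_entire_measurable[OF K_e_even_entire[OF ei(1)]] by simp
    show "AE w in N. (\<lambda>n. (\<Sum>k<n. complex_of_real (kc k) * A k * w ^ k) * v w) \<longlonglongrightarrow> K_e \<mu> u w * v w"
      using K_e_sums[OF ei(1)] by (intro AE_I2 tendsto_mult_right) (simp add: sums_def A_def)
    fix n
    show "AE w in N. norm ((\<Sum>k<n. complex_of_real (kc k) * A k * w ^ k) * v w) \<le> C * D * M * D * exp (7/8 * nsq w)"
    proof (rule AE_I2)
      fix w
      have "norm ((\<Sum>k<n. complex_of_real (kc k) * A k * w ^ k) * v w)
         \<le> (C * D * M * exp (5/8 * nsq w)) * (D * exp (nsq w / 4))"
        unfolding norm_mult using C D M by (intro mult_mono part v) auto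
      also have "\<dots> = C * D * M * D * (exp (5/8 * nsq w) * exp (nsq w / 4))" by (simp add: mult_ac)
      also have "exp (5/8 * nsq w) * exp (nsq w / 4) = exp (7 / 8 * nsq w)"
        by (simp flip: exp_add)
      finally show "norm ((\<Sum>k<n. complex_of_real (kc k) * A k * w ^ k) * v w) \<le> C * D * M * D * exp (7/8 * nsq w)" .
    qed
  qed measurable
  then have "(\<lambda>n. norm (LINT w|N. (\<Sum>k<n. complex_of_real (kc k) * A k * w ^ k) * v w)) \<longlonglongrightarrow> norm (LINT w|N. K_e \<mu> u w * v w)"
    by (rule tendsto_norm)
  then show ?thesis
  proof (rule LIMSEQ_le_const2, intro exI allI impI)
    fix n :: nat
    have "(LINT w|N. (\<Sum>k<n. complex_of_real (kc k) * A k * w ^ k) * v w)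
        = (LINT w|N. (\<Sum>k<n. complex_of_real (kc k) * A k * (w ^ k * v w)))"
      by (simp only: sum_distrib_right mult.assoc)
    also have "\<dots> = (\<Sum>k<n. complex_of_real (kc k) * A k * B k)"
      by (subst integral_sum) (auto simp: B_def intro: bi)
    also have "norm \<dots> \<le> (\<Sum>k<n. \<bar>sqrt (kc k) * norm (A k)\<bar> * \<bar>sqrt (kc k) * norm (B k)\<bar>)"
    proof (rule order_trans[OF norm_sum], intro sum_mono)
      fix k
      have "kc k = sqrt (kc k) * sqrt (kc k)" by (simp add: kc_nonneg)
      then show "norm (complex_of_real (kc k) * A k * B k) \<le> \<bar>sqrt (kc k) * norm (A k)\<bar> * \<bar>sqrt (kc k) * norm (B k)\<bar>"
        using kc_nonneg[of k] by (simp add: norm_mult abs_mult mult_ac)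
    qed
    also have "\<dots> \<le> L2_set (\<lambda>k. sqrt (kc k) * norm (A k)) {..<n} * L2_set (\<lambda>k. sqrt (kc k) * norm (B k)) {..<n}"
      by (rule L2_set_mult_ineq)
    also have "\<dots> \<le> sqrt (LINT z|N. nsq (u z)) * sqrt (LINT z|N. nsq (v z))"
    proof (intro mult_mono)
      show "L2_set (\<lambda>k. sqrt (kc k) * norm (A k)) {..<n} \<le> sqrt (LINT z|N. nsq (u z))"
        using Bessel[OF ei(1) sq[OF _ u], of n] by (simp add: L2_set_def power_mult_distrib kc_nonneg A_def)
      have ec: "exp_integrable (\<lambda>z. cnj (v z))" using ei(2) by (auto simp: exp_integrable_def)
      have "(LINT z|N. cnj z ^ k * cnj (v z)) = cnj (B k)" for k
        unfolding B_def using integral_cnj[of N "\<lambda>z. z ^ k * v z"] by simp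
      then show "L2_set (\<lambda>k. sqrt (kc k) * norm (B k)) {..<n} \<le> sqrt (LINT z|N. nsq (v z))"
        using Bessel[OF ec, of n] sq[OF _ v] by (simp add: L2_set_def power_mult_distrib kc_nonneg)
    qed (simp_all add: L2_set_nonneg)
    finally show "norm (LINT w|N. (\<Sum>k<n. complex_of_real (kc k) * A k * w ^ k) * v w)
       \<le> sqrt (LINT z|N. nsq (u z)) * sqrt (LINT z|N. nsq (v z))" .
  qed
qed

end

section \<open>The operator norm\<close>

lemma ereal_gt_one_cases:
  assumes "1 < (p::ereal)"
  obtains "p = \<infinity>" | r where "p = ereal r" "r > 1"
  using assms by (cases p) auto

lemma conj_exp_ge_1:
  assumes "1 < p" shows "conj_exp p \<ge> 1"
  by (rule ereal_gt_one_cases[OF assms]) (auto simp: conj_exp_def)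

text \<open>No membership in L^p is assumed: the essential supremum is at least that of the zero
  function, which is 0 because the total mass is not 0, and an infinite value is sent to 0 by
  \<open>real_of_ereal\<close>.\<close>

lemma Lp_norm_nonneg:
  assumes "prob_space M"
  shows "Lp_norm M p f \<ge> 0"
proof -
  interpret prob_space M by fact
  show ?thesis
  proof (cases "p = \<infinity>")
    case True
    have "esssup M (\<lambda>x. ereal (norm (f x))) \<ge> 0 \<or> \<not> (\<lambda>x. ereal (norm (f x))) \<in> borel_measurable M"
    proof -
      have "esssup M (\<lambda>x. 0::ereal) \<le> esssup M (\<lambda>x. ereal (norm (f x)))"
        by (rule esssup_mono) auto
      then show ?thesis using esssup_const[of M "0::ereal"] emeasure_space_1 by simp
    qed
    moreover have "real_of_ereal x \<ge> 0" if "x \<ge> 0" for x using that by (rule real_of_ereal_pos)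
    ultimately show ?thesis using True esssup_non_measurable[of "\<lambda>x. ereal (norm (f x))" M]
      by (auto simp: Lp_norm_def top_ereal_def)
  qed (simp add: Lp_norm_def)
qed

lemma Lp_infinity_AE:
  assumes "prob_space M" "f \<in> Lp_space M \<infinity>"
  shows "AE x in M. norm (f x) \<le> Lp_norm M \<infinity> f"
proof -
  interpret prob_space M by fact
  let ?s = "esssup M (\<lambda>x. ereal (norm (f x)))"
  have [measurable]: "f \<in> borel_measurable M" and fin: "?s < \<infinity>" using assms by (auto simp: Lp_space_def)
  have "esssup M (\<lambda>x. 0::ereal) \<le> ?s" by (rule esssup_mono) auto
  then have "0 \<le> ?s" using esssup_const[of M "0::ereal"] emeasure_space_1 by simp
  then have "?s = ereal (Lp_norm M \<infinity> f)" using fin by (cases ?s) (auto simp: Lp_norm_def)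
  then show ?thesis using esssup_AE[of "\<lambda>x. ereal (norm (f x))" M] by simp
qed

lemma Lp_norm_finite:
  "Lp_norm M (ereal r) f = (LINT x|M. norm (f x) powr r) powr (1 / r)"
  by (simp add: Lp_norm_def)

lemma Lp_space_finite:
  "f \<in> Lp_space M (ereal r) \<longleftrightarrow> f \<in> borel_measurable M \<and> integrable M (\<lambda>x. norm (f x) powr r)"
  by (simp add: Lp_space_def)

context deformed_bargmann
begin

text \<open>Hoelder's inequality in one form for all 1 < p \<le> \<infinity>; for p = \<infinity>
  the conjugate exponent is 1 and u is bounded almost everywhere.\<close>

lemma Lp_pairing:
  assumes p: "1 < p" and u: "u \<in> Lp_space N p"
    and [measurable]: "h \<in> borel_measurable borel" and h: "\<And>z. h z \<ge> (0::real)"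
    and int: "integrable N (\<lambda>z. h z powr conj_exp p)"
  shows "integrable N (\<lambda>z. h z * norm (u z))"
    and "(LINT z|N. h z * norm (u z)) \<le> (LINT z|N. h z powr conj_exp p) powr (1 / conj_exp p) * Lp_norm N p u"
proof -
  have um[measurable]: "u \<in> borel_measurable borel" using u by (simp add: Lp_space_def)
  have "integrable N (\<lambda>z. h z * norm (u z)) \<and>
    (LINT z|N. h z * norm (u z)) \<le> (LINT z|N. h z powr conj_exp p) powr (1 / conj_exp p) * Lp_norm N p u"
    using p
  proof (cases p rule: ereal_gt_one_cases)
    case 1
    have c: "conj_exp p = 1" by (simp add: 1 conj_exp_def)
    have hi: "integrable N h" using int h by (simp add: c)
    have ae: "AE z in N. norm (u z) \<le> Lp_norm N p u"
      using Lp_infinity_AE[OF N.prob_space_axioms, of u] u 1 by simp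
    have nn: "Lp_norm N p u \<ge> 0" by (rule Lp_norm_nonneg[OF N.prob_space_axioms])
    have b: "AE z in N. h z * norm (u z) \<le> h z * Lp_norm N p u"
      using ae by eventually_elim (rule mult_left_mono[OF _ h])
    have i: "integrable N (\<lambda>z. h z * norm (u z))"
    proof (rule integrable_bound)
      show "integrable N (\<lambda>z. h z * Lp_norm N p u)" using hi by simp
      show "AE z in N. norm (h z * norm (u z)) \<le> norm (h z * Lp_norm N p u)"
        using b by eventually_elim (use h nn in \<open>simp add: abs_mult\<close>)
    qed measurable
    have "(LINT z|N. h z * norm (u z)) \<le> (LINT z|N. h z * Lp_norm N p u)"
      using i hi b by (intro integral_mono_AE) auto
    then show ?thesis using i hi h by (simp add: c)
  next
    case (2 r)
    have c: "conj_exp (ereal r) = r / (r - 1)" by (simp add: conj_exp_def)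
    have q: "r / (r - 1) > 1" "1 / (r / (r - 1)) + 1 / r = 1" using 2 by (auto simp: field_simps)
    have ui: "integrable N (\<lambda>z. norm (u z) powr r)" using u 2 by (simp add: Lp_space_finite)
    show ?thesis
      using Holder_nonneg[OF q(1) 2(2) q(2), of h N "\<lambda>z. norm (u z)"] h int ui
      unfolding 2(1) by (simp add: c Lp_norm_finite)
  qed
  then show "integrable N (\<lambda>z. h z * norm (u z))"
    "(LINT z|N. h z * norm (u z)) \<le> (LINT z|N. h z powr conj_exp p) powr (1 / conj_exp p) * Lp_norm N p u" by auto
qed

lemma Lp_exp_integrable:
  assumes "1 < p" "u \<in> Lp_space N p"
  shows "exp_integrable u"
  unfolding exp_integrable_def
proof (intro conjI allI)
  show "u \<in> borel_measurable borel" using assms by (simp add: Lp_space_def)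
  fix c
  have "integrable N (\<lambda>z. exp (c * norm z) powr conj_exp p)"
    using integrable_exp_affine[of 0 "c * conj_exp p"] by (simp add: exp_powr_real mult_ac)
  then show "integrable N (\<lambda>z. exp (c * norm z) * norm (u z))"
    by (intro Lp_pairing[OF assms]) auto
qed

text \<open>Hoelder's inequality applied to the kernel bound. In the L^(p') norm of the kernel the
  exponent p' (1 + \<delta>) |z| |w| is split so that the part in z has weight 1 / r < 1 and stays
  integrable; the part in w has a weight that tends to p'/4 after the p'-th root as r tends to
  1.\<close>

lemma K_e_pointwise_bound:
  assumes p: "1 < p" and \<kappa>: "\<kappa> > conj_exp p / 4"
  obtains C where "C \<ge> 0"
    "\<And>u w. u \<in> Lp_space N p \<Longrightarrow> norm (K_e \<mu> u w) \<le> C * exp (\<kappa> * nsq w) * Lp_norm N p u"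
proof -
  define P where "P = conj_exp p"
  have P: "P \<ge> 1" using conj_exp_ge_1[OF p] by (simp add: P_def)
  \<comment> \<open>Chosen so that P^2 r^2 / 4 = P \<kappa>. One factor r comes from the weight 1 /
    r in z, the other from (1 + \<delta>)^2 = r in the kernel bound.\<close>
  define r where "r = sqrt (4 * \<kappa> / P)"
  have k4: "4 * \<kappa> / P > 1" using \<kappa> P by (simp add: P_def[symmetric] field_simps)
  then have r: "r > 1" "r\<^sup>2 = 4 * \<kappa> / P" by (auto simp: r_def)
  define \<delta> where "\<delta> = sqrt r - 1"
  have \<delta>: "\<delta> > 0" "(1 + \<delta>)\<^sup>2 = r" using r by (auto simp: \<delta>_def)
  obtain C0 where C0: "C0 > 0" "\<And>z w. norm (kernel_e \<mu> z w) \<le> C0 * exp ((1 + \<delta>) * (norm z * norm w))"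
    by (rule norm_kernel_bound[OF \<delta>(1)]) blast
  define M where "M = (LINT z|N. exp (1 / r * nsq z))"
  have Mi: "integrable N (\<lambda>z. exp (1 / r * nsq z))" using r by (intro integrable_exp) simp
  have M: "M \<ge> 0" by (simp add: M_def)
  define C where "C = C0 * M powr (1 / P)"
  show ?thesis
  proof (rule that)
    show "C \<ge> 0" using C0 by (simp add: C_def)
    fix u and w :: complex assume u: "u \<in> Lp_space N p"
    have um[measurable]: "u \<in> borel_measurable borel" using u by (simp add: Lp_space_def)
    define h where "h z = C0 * exp ((1 + \<delta>) * (norm z * norm w))" for z :: complex
    have [measurable]: "h \<in> borel_measurable borel" unfolding h_def[abs_def] by measurable
    have h: "h z \<ge> 0" for z using C0 by (simp add: h_def)
    have hb: "h z powr P \<le> C0 powr P * exp (P * \<kappa> * nsq w) * exp (1 / r * nsq z)" for z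
    proof -
      have "norm z * (P * (1 + \<delta>) * norm w) \<le> 1 / r * nsq z + (P * (1 + \<delta>) * norm w)\<^sup>2 / (4 * (1 / r))"
        using r by (intro mult_le_weighted_squares) auto
      also have "(P * (1 + \<delta>) * norm w)\<^sup>2 / (4 * (1 / r)) = P\<^sup>2 * r\<^sup>2 / 4 * nsq w"
        unfolding power_mult_distrib \<delta>(2) by (simp add: power2_eq_square)
      also have "P\<^sup>2 * r\<^sup>2 / 4 = P * \<kappa>" unfolding r(2) using P by (simp add: power2_eq_square)
      finally have "exp (norm z * (P * (1 + \<delta>) * norm w)) \<le> exp (P * \<kappa> * nsq w) * exp (1 / r * nsq z)"
        by (simp add: add.commute flip: exp_add)
      moreover have "h z powr P = C0 powr P * exp (norm z * (P * (1 + \<delta>) * norm w))"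
        using C0 by (simp add: h_def powr_mult exp_powr_real mult_ac)
      ultimately show ?thesis by (simp add: mult.assoc mult_left_mono)
    qed
    have hi: "integrable N (\<lambda>z. h z powr P)"
      by (rule integrable_gauss[of _ "1 / r" "C0 powr P * exp (P * \<kappa> * nsq w)" 0]) (use hb r in auto)
    have "(LINT z|N. h z powr P) \<le> (LINT z|N. C0 powr P * exp (P * \<kappa> * nsq w) * exp (1 / r * nsq z))"
      using hi Mi hb by (intro integral_mono) auto
    also have "\<dots> = C0 powr P * exp (P * \<kappa> * nsq w) * M" by (simp add: M_def)
    finally have "(LINT z|N. h z powr P) powr (1 / P) \<le> (C0 powr P * exp (P * \<kappa> * nsq w) * M) powr (1 / P)"
      using P by (intro powr_mono2) auto
    also have "\<dots> = C * exp (\<kappa> * nsq w)"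
      using P C0 M by (simp add: powr_mult powr_powr C_def exp_powr_real mult_ac)
    finally have hp: "(LINT z|N. h z powr P) powr (1 / P) \<le> C * exp (\<kappa> * nsq w)" .
    have "norm (K_e \<mu> u w) \<le> (LINT z|N. norm (kernel_e \<mu> z w * u z))" unfolding K_e_def by (rule integral_norm_bound)
    also have "\<dots> \<le> (LINT z|N. h z * norm (u z))"
    proof (rule integral_mono')
      show "integrable N (\<lambda>z. h z * norm (u z))" using Lp_pairing(1)[OF p u _ h] hi by (simp add: P_def)
      show "norm (kernel_e \<mu> z w * u z) \<le> h z * norm (u z)" for z
        unfolding norm_mult h_def by (intro mult_right_mono C0) simp
    qed (simp add: h)
    also have "\<dots> \<le> (LINT z|N. h z powr P) powr (1 / P) * Lp_norm N p u"
      using Lp_pairing(2)[OF p u _ h] hi by (simp add: P_def)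
    also have "\<dots> \<le> C * exp (\<kappa> * nsq w) * Lp_norm N p u"
      by (intro mult_right_mono hp Lp_norm_nonneg N.prob_space_axioms)
    finally show "norm (K_e \<mu> u w) \<le> C * exp (\<kappa> * nsq w) * Lp_norm N p u" .
  qed
qed

lemma sets_nu_ea [simp, measurable_cong]: "sets (nu_ea \<mu> a) = sets borel" by (simp add: nu_ea_def)

lemma integrable_nu_ea:
  fixes g :: "complex \<Rightarrow> real"
  assumes "g \<in> borel_measurable borel"
  shows "integrable (nu_ea \<mu> a) g \<longleftrightarrow> integrable N (\<lambda>z. exp (- a * nsq z) * g z)"
  unfolding nu_ea_def using assms by (subst integrable_density) auto

lemma integral_nu_ea:
  fixes g :: "complex \<Rightarrow> real"
  assumes "g \<in> borel_measurable borel"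
  shows "(LINT z|nu_ea \<mu> a. g z) = (LINT z|N. exp (- a * nsq z) * g z)"
  unfolding nu_ea_def using assms by (subst integral_density) auto

lemma one_exp_integrable: "exp_integrable (\<lambda>z. 1)"
  by (rule exp_integrable_gauss[of _ 0 1]) auto

lemma one_even_entire: "(\<lambda>z. 1) \<in> even_entire"
  by (simp add: even_entire_def)

lemma K_e_one: "K_e \<mu> (\<lambda>z. 1) = (\<lambda>z. 1)"
  by (rule K_e_reproducing[OF one_even_entire one_exp_integrable])

lemma one_Lp:
  assumes "1 < p" shows "(\<lambda>z. 1) \<in> Lp_space N p" "Lp_norm N p (\<lambda>z. 1) = 1"
  by (rule ereal_gt_one_cases[OF assms];
      auto simp: Lp_space_def Lp_norm_def esssup_const N.emeasure_space_1[simplified] N.prob_space[simplified])+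

end

section \<open>Boundedness of the operator and lower bounds for its norm\<close>

locale deformed_bargmann_pqa = deformed_bargmann +
  fixes p :: ereal and q a :: real
  assumes p: "1 < p" and q: "1 \<le> q" and a: "a > conj_exp p * q / 4 - 1"
begin

abbreviation "A \<equiv> A_e p q a \<mu>"
abbreviation "Na \<equiv> nu_ea \<mu> a"

lemma a_gt: "a > - 1"
proof -
  have "conj_exp p * q / 4 \<ge> 0" using conj_exp_ge_1[OF p] q by simp
  then show ?thesis using a by linarith
qed

text \<open>The interval from p'/4 to (1 + a) / q is nonempty by the hypothesis on a. Its midpoint
  \<kappa> admits the pointwise bound and satisfies \<kappa> q - a < 1, so the q-th power is
  integrable. The set whose infimum defines \<open>A_e\<close> is thereby nonempty.\<close>

lemma K_e_bounded:
  obtains C where "C \<ge> 0" "\<And>u. u \<in> Lp_space N p \<Longrightarrow> K_e \<mu> u \<in> B_ea \<mu> q a \<and>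
     Lp_norm Na (ereal q) (K_e \<mu> u) \<le> C * Lp_norm N p u"
proof -
  define \<kappa> where "\<kappa> = (conj_exp p / 4 + (1 + a) / q) / 2"
  have avg: "x < (x + y) / 2" "(x + y) / 2 < y" if "x < y" for x y :: real using that by simp_all
  have lt: "conj_exp p / 4 < (1 + a) / q" using a q by (simp add: field_simps)
  then have \<kappa>: "\<kappa> > conj_exp p / 4" "\<kappa> < (1 + a) / q" unfolding \<kappa>_def by (rule avg)+
  then have b: "\<kappa> * q - a < 1" using q by (simp add: field_simps)
  obtain C where C: "C \<ge> 0" "\<And>u w. u \<in> Lp_space N p \<Longrightarrow> norm (K_e \<mu> u w) \<le> C * exp (\<kappa> * nsq w) * Lp_norm N p u"
    using K_e_pointwise_bound[OF p \<kappa>(1)] by blast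
  define M where "M = (LINT w|N. exp ((\<kappa> * q - a) * nsq w))"
  have Mi: "integrable N (\<lambda>w. exp ((\<kappa> * q - a) * nsq w))" by (rule integrable_exp[OF b])
  have M: "M \<ge> 0" by (simp add: M_def)
  show ?thesis
  proof (rule that)
    show "C * M powr (1 / q) \<ge> 0" using C by simp
    fix u assume u: "u \<in> Lp_space N p"
    define B where "B = Lp_norm N p u"
    have B: "B \<ge> 0" unfolding B_def by (intro Lp_norm_nonneg N.prob_space_axioms)
    have ee: "K_e \<mu> u \<in> even_entire" by (rule K_e_even_entire[OF Lp_exp_integrable[OF p u]])
    have [measurable]: "K_e \<mu> u \<in> borel_measurable borel" by (rule even_entire_measurable[OF ee])
    have le: "exp (- a * nsq w) * norm (K_e \<mu> u w) powr q \<le> (C * B) powr q * exp ((\<kappa> * q - a) * nsq w)" for w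
    proof -
      have "norm (K_e \<mu> u w) powr q \<le> (C * B * exp (\<kappa> * nsq w)) powr q"
        using C(2)[OF u, of w] q by (intro powr_mono2) (auto simp: B_def mult_ac)
      also have "\<dots> = (C * B) powr q * exp (\<kappa> * q * nsq w)"
        using C B by (simp add: powr_mult exp_powr_real mult_ac)
      finally have "exp (- a * nsq w) * norm (K_e \<mu> u w) powr q
         \<le> exp (- a * nsq w) * ((C * B) powr q * exp (\<kappa> * q * nsq w))" by (intro mult_left_mono) auto
      also have "\<dots> = (C * B) powr q * (exp (- a * nsq w) * exp (\<kappa> * q * nsq w))" by (simp add: mult_ac)
      also have "exp (- a * nsq w) * exp (\<kappa> * q * nsq w) = exp ((\<kappa> * q - a) * nsq w)"
        by (simp add: algebra_simps flip: exp_add)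
      finally show ?thesis .
    qed
    have i: "integrable N (\<lambda>w. exp (- a * nsq w) * norm (K_e \<mu> u w) powr q)"
      by (rule integrable_gauss[OF _ b, of _ "(C * B) powr q" 0]) (use le in \<open>auto simp: abs_mult\<close>)
    have "Lp_norm Na (ereal q) (K_e \<mu> u) = (LINT w|N. exp (- a * nsq w) * norm (K_e \<mu> u w) powr q) powr (1 / q)"
      unfolding Lp_norm_finite by (subst integral_nu_ea) auto
    also have "\<dots> \<le> (LINT w|N. (C * B) powr q * exp ((\<kappa> * q - a) * nsq w)) powr (1 / q)"
    proof (rule powr_mono2)
      show "0 \<le> (LINT w|N. exp (- a * nsq w) * norm (K_e \<mu> u w) powr q)"
        by (intro integral_nonneg_AE AE_I2) simp
      show "(LINT w|N. exp (- a * nsq w) * norm (K_e \<mu> u w) powr q) \<le> (LINT w|N. (C * B) powr q * exp ((\<kappa> * q - a) * nsq w))"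
        by (rule integral_mono[OF i _ le]) (intro integrable_mult_right Mi)
    qed (use q in simp)
    also have "\<dots> = ((C * B) powr q * M) powr (1 / q)" by (simp add: M_def)
    also have "\<dots> = C * B * M powr (1 / q)" using C B M q by (simp add: powr_mult powr_powr)
    finally have "Lp_norm Na (ereal q) (K_e \<mu> u) \<le> C * M powr (1 / q) * Lp_norm N p u" by (simp add: B_def mult_ac)
    moreover have "K_e \<mu> u \<in> B_ea \<mu> q a" using ee i by (simp add: B_ea_def Lp_space_finite integrable_nu_ea)
    ultimately show "K_e \<mu> u \<in> B_ea \<mu> q a \<and> Lp_norm Na (ereal q) (K_e \<mu> u) \<le> C * M powr (1 / q) * Lp_norm N p u" by simp
  qed
qed

lemma K_e_mem_B_ea: "u \<in> Lp_space N p \<Longrightarrow> K_e \<mu> u \<in> B_ea \<mu> q a"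
  by (rule K_e_bounded) blast

lemma A_e_bound:
  assumes u: "u \<in> Lp_space N p"
  shows "Lp_norm Na (ereal q) (K_e \<mu> u) \<le> A * Lp_norm N p u"
proof -
  let ?S = "{C. C \<ge> 0 \<and> (\<forall>f \<in> Lp_space N p. K_e \<mu> f \<in> B_ea \<mu> q a \<and>
        Lp_norm Na (ereal q) (K_e \<mu> f) \<le> C * Lp_norm N p f)}"
  obtain C where C: "C \<ge> 0" "\<And>u. u \<in> Lp_space N p \<Longrightarrow> K_e \<mu> u \<in> B_ea \<mu> q a \<and>
     Lp_norm Na (ereal q) (K_e \<mu> u) \<le> C * Lp_norm N p u" by (rule K_e_bounded) blast
  have "C \<in> ?S" using C by simp
  then have ne: "?S \<noteq> {}" by (rule ex_in_conv[THEN iffD1, OF exI])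
  show ?thesis
  proof (cases "Lp_norm N p u = 0")
    case True
    \<comment> \<open>A zero norm cannot be divided by; here any admissible constant already bounds
      the left side by 0.\<close>
    then show ?thesis using C(2)[OF u] by simp
  next
    case False
    then have pos: "Lp_norm N p u > 0" using Lp_norm_nonneg[OF N.prob_space_axioms, of p u] by simp
    have "Lp_norm Na (ereal q) (K_e \<mu> u) / Lp_norm N p u \<le> Inf ?S"
      using ne u pos by (intro cInf_greatest) (auto simp: divide_le_eq)
    then show ?thesis using pos by (simp add: A_e_def divide_le_eq)
  qed
qed

lemma Lp_norm_one: "Lp_norm Na (ereal q) (\<lambda>z. 1) = (LINT z|N. exp (- a * nsq z)) powr (1 / q)"
  unfolding Lp_norm_finite by (subst integral_nu_ea) auto

lemma A_e_ge: "A \<ge> (LINT z|N. exp (- a * nsq z)) powr (1 / q)"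
  using A_e_bound[OF one_Lp(1)[OF p]] by (simp add: K_e_one Lp_norm_one one_Lp(2)[OF p])

text \<open>Jensen's inequality by integrating the tangent of exp at the mean of - a |z|^2, for
  either sign of a. The number \<open>moment 1\<close> is the energy of the constant function
  1.\<close>

lemma integral_exp_ge: "(LINT z|N. exp (- a * nsq z)) \<ge> exp (- a * moment 1)"
proof -
  have i: "integrable N (\<lambda>z. nsq z)" "(LINT z|N. nsq z) = moment 1"
    using moment_integral[of 1] by simp_all
  let ?m = "moment 1"
  have "exp (- a * ?m) = (LINT z|N. exp (- a * ?m) * (1 + (- a * nsq z + a * ?m)))"
    using i by (simp add: N.prob_space[simplified])
  also have "\<dots> \<le> (LINT z|N. exp (- a * nsq z))"
  proof (rule integral_mono)
    show "integrable N (\<lambda>z. exp (- a * ?m) * (1 + (- a * nsq z + a * ?m)))" using i by simp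
    show "integrable N (\<lambda>z. exp (- a * nsq z))" using a_gt by (intro integrable_exp) simp
    fix z
    have "1 + (- a * nsq z + a * ?m) \<le> exp (- a * nsq z + a * ?m)" by (rule exp_ge_add_one_self)
    then have "exp (- a * ?m) * (1 + (- a * nsq z + a * ?m)) \<le> exp (- a * ?m) * exp (- a * nsq z + a * ?m)"
      by (rule mult_left_mono) simp
    also have "\<dots> = exp (- a * nsq z)" by (simp flip: exp_add)
    finally show "exp (- a * ?m) * (1 + (- a * nsq z + a * ?m)) \<le> exp (- a * nsq z)" .
  qed
  finally show ?thesis .
qed

lemma A_e_ge_exp: "A \<ge> exp (- a / q * moment 1)"
proof -
  have "exp (- a / q * moment 1) = exp (- a * moment 1) powr (1 / q)" by (simp add: exp_powr_real)
  also have "\<dots> \<le> (LINT z|N. exp (- a * nsq z)) powr (1 / q)"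
    using q by (intro powr_mono2 integral_exp_ge) simp_all
  finally show ?thesis using A_e_ge by simp
qed

lemma A_e_pos: "A > 0"
  using A_e_ge_exp exp_gt_zero by (rule less_le_trans[rotated])

lemma ln_A_e_ge: "ln A \<ge> - a / q * moment 1"
  using A_e_ge_exp A_e_pos by (simp add: ln_ge_iff)

end

section \<open>Analytic interpolation\<close>

text \<open>The factor exp (\<epsilon> (z^2 - 1)) has modulus at most 1 on the strip and decays like
  exp (- \<epsilon> (Im z)^2), so the maximum modulus principle applies on a tall rectangle; then
  \<epsilon> tends to 0.\<close>

lemma three_lines_normalized:
  fixes F :: "complex \<Rightarrow> complex"
  assumes hol: "F holomorphic_on {z. 0 < Re z \<and> Re z < 1}"
    and cont: "continuous_on {z. 0 \<le> Re z \<and> Re z \<le> 1} F"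
    and bd: "\<And>z. 0 \<le> Re z \<Longrightarrow> Re z \<le> 1 \<Longrightarrow> norm (F z) \<le> B"
    and b0: "\<And>z. Re z = 0 \<Longrightarrow> norm (F z) \<le> 1"
    and b1: "\<And>z. Re z = 1 \<Longrightarrow> norm (F z) \<le> 1"
    and z: "0 \<le> Re z" "Re z \<le> 1"
  shows "norm (F z) \<le> 1"
proof -
  have key: "norm (F z) * exp (\<epsilon> * (Re (z\<^sup>2) - 1)) \<le> 1" if \<epsilon>: "\<epsilon> > 0" for \<epsilon>
  proof -
    define G where "G \<xi> = F \<xi> * exp (of_real \<epsilon> * (\<xi>\<^sup>2 - 1))" for \<xi>
    have nG: "norm (G \<xi>) = norm (F \<xi>) * exp (\<epsilon> * ((Re \<xi>)\<^sup>2 - (Im \<xi>)\<^sup>2 - 1))" for \<xi>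
      by (simp add: G_def norm_mult power2_eq_square)
    \<comment> \<open>On the horizontal edges the factor is at most exp (- |B|), which outweighs |F|
      \<le> B \<le> exp |B|; the remaining summands put z inside the rectangle.\<close>
    define Y where "Y = 1 + \<bar>Im z\<bar> + \<bar>B\<bar> / \<epsilon>"
    have Y: "Y \<ge> 1" "\<bar>Im z\<bar> < Y" "\<epsilon> * Y\<^sup>2 \<ge> \<bar>B\<bar>"
    proof -
      have "\<bar>B\<bar> / \<epsilon> \<ge> 0" using \<epsilon> by simp
      then show "Y \<ge> 1" "\<bar>Im z\<bar> < Y" by (auto simp: Y_def)
      have "\<bar>B\<bar> = \<epsilon> * (\<bar>B\<bar> / \<epsilon>)" using \<epsilon> by simp
      also have "\<dots> \<le> \<epsilon> * Y" using \<epsilon> by (intro mult_left_mono) (auto simp: Y_def)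
      also have "\<dots> \<le> \<epsilon> * Y\<^sup>2" using \<epsilon> \<open>Y \<ge> 1\<close> by (intro mult_left_mono) (auto simp: power2_eq_square)
      finally show "\<epsilon> * Y\<^sup>2 \<ge> \<bar>B\<bar>" .
    qed
    let ?S = "cbox (Complex 0 (- Y)) (Complex 1 Y)"
    have mem: "\<xi> \<in> ?S \<longleftrightarrow> 0 \<le> Re \<xi> \<and> Re \<xi> \<le> 1 \<and> - Y \<le> Im \<xi> \<and> Im \<xi> \<le> Y" for \<xi>
      by (auto simp: in_cbox_complex_iff)
    have memb: "\<xi> \<in> box (Complex 0 (- Y)) (Complex 1 Y) \<longleftrightarrow> 0 < Re \<xi> \<and> Re \<xi> < 1 \<and> - Y < Im \<xi> \<and> Im \<xi> < Y" for \<xi>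
      by (auto simp: in_box_complex_iff)
    have "norm (G z) \<le> 1"
    proof (rule maximum_modulus_frontier[of G ?S])
      have "F holomorphic_on interior ?S"
        by (rule holomorphic_on_subset[OF hol]) (auto simp: interior_cbox memb)
      then show "G holomorphic_on interior ?S" unfolding G_def[abs_def] by (intro holomorphic_intros)
      have "continuous_on ?S F" by (rule continuous_on_subset[OF cont]) (auto simp: mem)
      then show "continuous_on (closure ?S) G" unfolding G_def[abs_def] by (auto intro!: continuous_intros)
      show "z \<in> ?S" using z Y(2) by (simp add: mem abs_less_iff less_imp_le)
      fix \<xi> assume "\<xi> \<in> frontier ?S"
      then have \<xi>: "\<xi> \<in> ?S" "\<xi> \<notin> box (Complex 0 (- Y)) (Complex 1 Y)" by (auto simp: frontier_cbox)
      have re1: "(Re \<xi>)\<^sup>2 \<le> 1" using \<xi>(1) by (auto simp: mem power_le_one)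
      then have le: "\<epsilon> * ((Re \<xi>)\<^sup>2 - (Im \<xi>)\<^sup>2 - 1) \<le> \<epsilon> * (- (Im \<xi>)\<^sup>2)" using \<epsilon> by (intro mult_left_mono) auto
      also have "\<dots> \<le> 0" using \<epsilon> by (simp add: mult_nonneg_nonpos)
      finally have e1: "exp (\<epsilon> * ((Re \<xi>)\<^sup>2 - (Im \<xi>)\<^sup>2 - 1)) \<le> 1" by simp
      consider "Re \<xi> = 0 \<or> Re \<xi> = 1" | "\<bar>Im \<xi>\<bar> = Y" using \<xi> unfolding mem memb by linarith
      then show "norm (G \<xi>) \<le> 1"
      proof cases
        case 1
        then have "norm (F \<xi>) \<le> 1" using b0 b1 by auto
        then show ?thesis unfolding nG using e1 by (simp add: mult_le_one)
      next
        case 2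
        then have "(Im \<xi>)\<^sup>2 = Y\<^sup>2" by (metis power2_abs)
        then have "exp (\<epsilon> * ((Re \<xi>)\<^sup>2 - (Im \<xi>)\<^sup>2 - 1)) \<le> exp (- \<bar>B\<bar>)" using le Y(3) by simp
        moreover have "norm (F \<xi>) \<le> exp \<bar>B\<bar>"
        proof -
          have "norm (F \<xi>) \<le> B" using bd[of \<xi>] \<xi>(1) by (auto simp: mem)
          moreover have "\<bar>B\<bar> \<le> exp \<bar>B\<bar>" using exp_ge_add_one_self[of "\<bar>B\<bar>"] by linarith
          ultimately show ?thesis by linarith
        qed
        ultimately have "norm (G \<xi>) \<le> exp \<bar>B\<bar> * exp (- \<bar>B\<bar>)" unfolding nG by (intro mult_mono) auto
        then show ?thesis by (simp flip: exp_add)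
      qed
    qed (rule bounded_cbox)
    then show ?thesis by (simp add: nG power2_eq_square)
  qed
  have "((\<lambda>\<epsilon>. norm (F z) * exp (\<epsilon> * (Re (z\<^sup>2) - 1))) \<longlongrightarrow> norm (F z) * exp (0 * (Re (z\<^sup>2) - 1))) (at_right 0)"
    by (intro tendsto_intros)
  then have "((\<lambda>\<epsilon>. norm (F z) * exp (\<epsilon> * (Re (z\<^sup>2) - 1))) \<longlongrightarrow> norm (F z)) (at_right 0)" by simp
  then show ?thesis
    by (rule tendsto_upperbound) (use key in \<open>auto simp: eventually_at_right_less eventually_at_filter\<close>)
qed

text \<open>Division by M0 exp (c z) normalises both edges. The bound is M0^(1 - x) M1^x with x = Re
  z, in the form that makes its slope M0 ln (M1 / M0) at x = 0 visible.\<close>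

lemma three_lines:
  fixes F :: "complex \<Rightarrow> complex"
  assumes hol: "F holomorphic_on {z. 0 < Re z \<and> Re z < 1}"
    and cont: "continuous_on {z. 0 \<le> Re z \<and> Re z \<le> 1} F"
    and bd: "\<And>z. 0 \<le> Re z \<Longrightarrow> Re z \<le> 1 \<Longrightarrow> norm (F z) \<le> B"
    and b0: "\<And>z. Re z = 0 \<Longrightarrow> norm (F z) \<le> M0"
    and b1: "\<And>z. Re z = 1 \<Longrightarrow> norm (F z) \<le> M1"
    and M: "M0 > 0" "M1 > 0"
    and z: "0 \<le> Re z" "Re z \<le> 1"
  shows "norm (F z) \<le> M0 * exp (Re z * ln (M1 / M0))"
proof -
  define c where "c = ln (M1 / M0)"
  define G where "G \<xi> = F \<xi> * exp (- (\<xi> * of_real c)) / of_real M0" for \<xi>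
  have nG: "norm (G \<xi>) = norm (F \<xi>) * exp (- (Re \<xi> * c)) / M0" for \<xi>
    using M by (simp add: G_def norm_mult norm_divide)
  have "norm (G z) \<le> 1"
  proof (rule three_lines_normalized[of G "\<bar>B\<bar> * exp \<bar>c\<bar> / M0"])
    show "G holomorphic_on {z. 0 < Re z \<and> Re z < 1}" unfolding G_def[abs_def] using M
      by (intro holomorphic_intros hol) auto
    show "continuous_on {z. 0 \<le> Re z \<and> Re z \<le> 1} G" unfolding G_def[abs_def] using M
      by (intro continuous_intros cont) auto
  next
    fix \<xi> :: complex assume \<xi>: "0 \<le> Re \<xi>" "Re \<xi> \<le> 1"
    have "- (Re \<xi> * c) \<le> \<bar>Re \<xi> * c\<bar>" by simp
    also have "\<dots> \<le> \<bar>c\<bar>" using \<xi> by (simp add: abs_mult mult_left_le_one_le)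
    finally have "norm (F \<xi>) * exp (- (Re \<xi> * c)) \<le> \<bar>B\<bar> * exp \<bar>c\<bar>"
      using bd[OF \<xi>] by (intro mult_mono) auto
    then show "norm (G \<xi>) \<le> \<bar>B\<bar> * exp \<bar>c\<bar> / M0" unfolding nG using M by (intro divide_right_mono) auto
  next
    fix \<xi> :: complex assume "Re \<xi> = 0"
    then show "norm (G \<xi>) \<le> 1" unfolding nG using b0[of \<xi>] M by simp
  next
    fix \<xi> :: complex assume \<xi>: "Re \<xi> = 1"
    have "exp (- c) = M0 / M1" using M by (simp add: c_def exp_minus)
    then show "norm (G \<xi>) \<le> 1" unfolding nG using b1[OF \<xi>] M \<xi> by simp
  qed (fact z)+
  then have "norm (F z) * exp (- (Re z * c)) \<le> M0" unfolding nG using M by simp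
  then show ?thesis unfolding c_def[symmetric] by (simp add: exp_minus field_simps)
qed

lemma norm_exp_diff_le:
  fixes a b :: complex
  assumes "Re a \<le> m" "Re b \<le> m"
  shows "norm (exp a - exp b) \<le> exp m * norm (a - b)"
proof (rule field_differentiable_bound[of "{z. Re z \<le> m}" exp exp])
  show "convex {z. Re z \<le> m}" by (rule convex_halfspace_Re_le)
  show "\<And>z. z \<in> {z. Re z \<le> m} \<Longrightarrow> (exp has_field_derivative exp z) (at z within {z. Re z \<le> m})"
    by (auto intro!: derivative_eq_intros)
qed (use assms in auto)

text \<open>Differentiating exp (s L) brings down a factor L; as long as s stays at distance d from
  0 and 1, that factor costs only 1 / d. This dominates difference quotients inside the
  strip.\<close>

lemma abs_mult_exp_le:
  fixes L s d :: real
  assumes "d > 0" "d \<le> s" "s \<le> 1 - d"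
  shows "\<bar>L\<bar> * exp (s * L) \<le> (1 + exp L) / d"
proof -
  have "d * \<bar>L\<bar> \<le> exp (d * \<bar>L\<bar>)" using exp_ge_add_one_self[of "d * \<bar>L\<bar>"] by linarith
  then have "d * \<bar>L\<bar> * exp (s * L) \<le> exp (d * \<bar>L\<bar>) * exp (s * L)" by (rule mult_right_mono) simp
  also have "\<dots> \<le> 1 + exp L"
  proof (cases "L \<ge> 0")
    case True
    then have "d * \<bar>L\<bar> + s * L \<le> L" using assms mult_right_mono[of "s + d" 1 L] by (simp add: algebra_simps)
    then have "exp (d * \<bar>L\<bar> + s * L) \<le> exp L" by simp
    then show ?thesis by (simp add: exp_add)
  next
    case False
    then have "d * \<bar>L\<bar> + s * L = (s - d) * L" by (simp add: algebra_simps)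
    also have "\<dots> \<le> 0" using assms False by (intro mult_nonneg_nonpos) auto
    finally have "exp (d * \<bar>L\<bar> + s * L) \<le> 1" by simp
    then show ?thesis by (simp add: exp_add add_increasing2)
  qed
  finally show ?thesis using assms by (simp add: field_simps)
qed

text \<open>Analytic interpolation between the lines \<open>Re \<zeta> = 0\<close> and \<open>Re \<zeta> = 1\<close> when the bound is attained
  at \<open>\<zeta> = 0\<close>: the derivative there is controlled by the slope of the three lines bound.\<close>

lemma interpolation_derivative_bound:
  fixes H :: "'a \<Rightarrow> complex" and L :: "'a \<Rightarrow> real"
  assumes [measurable]: "H \<in> borel_measurable M" "L \<in> borel_measurable M"
    and i0: "integrable M H" and i1: "integrable M (\<lambda>x. norm (H x) * exp (L x))"
    and iL: "integrable M (\<lambda>x. norm (H x) * \<bar>L x\<bar>)"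
    and b0: "\<And>t::real. norm (LINT x|M. H x * exp (\<i> * t * L x)) \<le> M0"
    and b1: "\<And>t::real. norm (LINT x|M. H x * exp ((1 + \<i> * t) * L x)) \<le> M1"
    and F0: "(LINT x|M. H x) = of_real M0" and M: "M0 > 0" "M1 > 0"
  shows "Re (LINT x|M. H x * of_real (L x)) \<le> M0 * ln (M1 / M0)"
proof -
  define F where "F \<zeta> = (LINT x|M. H x * exp (\<zeta> * of_real (L x)))" for \<zeta>
  \<comment> \<open>A majorant for all \<zeta> of the closed strip at once: exp (s L) is at most 1
    or at most exp L, according to the sign of L.\<close>
  define w where "w x = norm (H x) * (1 + exp (L x))" for x
  have wi: "integrable M w" unfolding w_def distrib_left using i0 i1 by (auto intro: integrable_norm)
  have wb: "norm (H x * exp (\<zeta> * of_real (L x))) \<le> w x" if "0 \<le> Re \<zeta>" "Re \<zeta> \<le> 1" for \<zeta> x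
  proof -
    have "exp (Re \<zeta> * L x) \<le> 1 + exp (L x)"
    proof (cases "L x \<ge> 0")
      case True
      then have "Re \<zeta> * L x \<le> L x" using that mult_right_mono[of "Re \<zeta>" 1 "L x"] by simp
      then have "exp (Re \<zeta> * L x) \<le> exp (L x)" by simp
      then show ?thesis by (simp add: add_increasing)
    next
      case False
      then have "Re \<zeta> * L x \<le> 0" using that by (intro mult_nonneg_nonpos) auto
      then have "exp (Re \<zeta> * L x) \<le> 1" by simp
      then show ?thesis by (simp add: add_increasing2)
    qed
    then show ?thesis unfolding w_def by (simp add: norm_mult mult_left_mono)
  qed
  have Hi: "integrable M (\<lambda>x. H x * exp (\<zeta> * of_real (L x)))" if "0 \<le> Re \<zeta>" "Re \<zeta> \<le> 1" for \<zeta>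
    by (rule integrable_bound[OF wi]) (use wb[OF that] in \<open>auto intro!: AE_I2 order_trans[OF _ abs_ge_self]\<close>)
  have cont: "continuous_on {z. 0 \<le> Re z \<and> Re z \<le> 1} F"
    unfolding continuous_on_sequentially
  proof (intro allI ballI impI, elim conjE)
    fix X \<zeta> assume \<zeta>: "\<zeta> \<in> {z. 0 \<le> Re z \<and> Re z \<le> 1}" and X: "\<forall>n. X n \<in> {z. 0 \<le> Re z \<and> Re z \<le> 1}" "X \<longlonglongrightarrow> \<zeta>"
    show "(F \<circ> X) \<longlonglongrightarrow> F \<zeta>"
      unfolding F_def comp_def
    proof (rule integral_dominated_convergence[OF _ _ wi])
      show "AE x in M. (\<lambda>n. H x * exp (X n * of_real (L x))) \<longlonglongrightarrow> H x * exp (\<zeta> * of_real (L x))"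
        by (intro AE_I2 tendsto_intros X)
      show "\<And>n. AE x in M. norm (H x * exp (X n * of_real (L x))) \<le> w x" using X wb by (intro AE_I2) auto
    qed measurable
  qed
  have hol: "F holomorphic_on {z. 0 < Re z \<and> Re z < 1}"
    unfolding holomorphic_on_def
  proof (rule ballI, rule field_differentiable_at_within, unfold field_differentiable_def, rule exI)
    fix \<zeta> assume "\<zeta> \<in> {z. 0 < Re z \<and> Re z < 1}"
    then have \<zeta>: "0 < Re \<zeta>" "Re \<zeta> < 1" by auto
    define d where "d = min (Re \<zeta>) (1 - Re \<zeta>) / 2"
    have d: "d > 0" "2 * d \<le> Re \<zeta>" "Re \<zeta> \<le> 1 - 2 * d" using \<zeta> by (auto simp: d_def)
    show "(F has_field_derivative (LINT x|M. H x * (of_real (L x) * exp (\<zeta> * of_real (L x))))) (at \<zeta>)"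
      unfolding has_field_derivative_iff tendsto_at_iff_sequentially
    proof (intro allI impI, unfold comp_def)
      fix X assume X: "\<forall>n. X n \<in> UNIV - {\<zeta>}" "X \<longlonglongrightarrow> \<zeta>"
      obtain n0 where n0: "\<And>n. n \<ge> n0 \<Longrightarrow> norm (X n - \<zeta>) < d"
        using X(2) d(1) by (metis LIMSEQ_iff)
      define Y where "Y n = X (n + n0)" for n
      have Y: "Y n \<noteq> \<zeta>" "norm (Y n - \<zeta>) < d" for n using X(1) n0 by (auto simp: Y_def)
      have Yl: "Y \<longlonglongrightarrow> \<zeta>" unfolding Y_def by (rule LIMSEQ_ignore_initial_segment[OF X(2)])
      have Yr: "d \<le> Re (Y n)" "Re (Y n) \<le> 1 - d" for n
        using abs_Re_le_cmod[of "Y n - \<zeta>"] Y(2)[of n] d by (auto simp: abs_le_iff)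
      have lim: "(\<lambda>n. LINT x|M. H x * ((exp (Y n * of_real (L x)) - exp (\<zeta> * of_real (L x))) / (Y n - \<zeta>)))
        \<longlonglongrightarrow> (LINT x|M. H x * (of_real (L x) * exp (\<zeta> * of_real (L x))))"
      proof (rule integral_dominated_convergence)
        show "integrable M (\<lambda>x. w x * (1 / d))" using wi by simp
        show "AE x in M. (\<lambda>n. H x * ((exp (Y n * of_real (L x)) - exp (\<zeta> * of_real (L x))) / (Y n - \<zeta>)))
            \<longlonglongrightarrow> H x * (of_real (L x) * exp (\<zeta> * of_real (L x)))"
        proof (intro AE_I2 tendsto_mult_left)
          fix x
          have "((\<lambda>\<xi>. exp (\<xi> * of_real (L x))) has_field_derivative of_real (L x) * exp (\<zeta> * of_real (L x))) (at \<zeta>)"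
            by (auto intro!: derivative_eq_intros)
          then have "((\<lambda>y. (exp (y * of_real (L x)) - exp (\<zeta> * of_real (L x))) / (y - \<zeta>)) \<longlongrightarrow> of_real (L x) * exp (\<zeta> * of_real (L x))) (at \<zeta>)"
            by (simp add: has_field_derivative_iff)
          then show "(\<lambda>n. (exp (Y n * of_real (L x)) - exp (\<zeta> * of_real (L x))) / (Y n - \<zeta>))
            \<longlonglongrightarrow> of_real (L x) * exp (\<zeta> * of_real (L x))"
            unfolding tendsto_at_iff_sequentially comp_def using Y(1) Yl by auto
        qed
        fix n
        show "AE x in M. norm (H x * ((exp (Y n * of_real (L x)) - exp (\<zeta> * of_real (L x))) / (Y n - \<zeta>))) \<le> w x * (1 / d)"
        proof (rule AE_I2)
          fix x
          \<comment> \<open>The sign of L decides which of the two real parts gives the larger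
            exponential; s is that one.\<close>
          obtain s where s: "d \<le> s" "s \<le> 1 - d" "Re (Y n) * L x \<le> s * L x" "Re \<zeta> * L x \<le> s * L x"
          proof (cases "L x \<ge> 0")
            case True
            then show ?thesis using Yr[of n] d
              by (intro that[of "max (Re (Y n)) (Re \<zeta>)"]) (auto intro!: mult_right_mono)
          next
            case False
            then show ?thesis using Yr[of n] d
              by (intro that[of "min (Re (Y n)) (Re \<zeta>)"]) (auto intro!: mult_right_mono_neg)
          qed
          have "norm (exp (Y n * of_real (L x)) - exp (\<zeta> * of_real (L x)))
             \<le> exp (s * L x) * norm (Y n * of_real (L x) - \<zeta> * of_real (L x))"
            using s by (intro norm_exp_diff_le) auto
          also have "Y n * of_real (L x) - \<zeta> * of_real (L x) = (Y n - \<zeta>) * of_real (L x)" by (simp add: left_diff_distrib)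
          also have "norm \<dots> = norm (Y n - \<zeta>) * \<bar>L x\<bar>" by (simp add: norm_mult)
          finally have "norm ((exp (Y n * of_real (L x)) - exp (\<zeta> * of_real (L x))) / (Y n - \<zeta>)) \<le> \<bar>L x\<bar> * exp (s * L x)"
            using Y(1)[of n] by (simp add: norm_divide divide_le_eq mult_ac)
          also have "\<dots> \<le> (1 + exp (L x)) / d" by (rule abs_mult_exp_le[OF d(1) s(1,2)])
          finally have "norm (H x) * norm ((exp (Y n * of_real (L x)) - exp (\<zeta> * of_real (L x))) / (Y n - \<zeta>))
            \<le> norm (H x) * ((1 + exp (L x)) / d)" by (rule mult_left_mono) simp
          then show "norm (H x * ((exp (Y n * of_real (L x)) - exp (\<zeta> * of_real (L x))) / (Y n - \<zeta>))) \<le> w x * (1 / d)"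
            unfolding norm_mult w_def by simp
        qed
      qed measurable
      have quot: "(LINT x|M. H x * ((exp (Y n * of_real (L x)) - exp (\<zeta> * of_real (L x))) / (Y n - \<zeta>)))
          = (F (Y n) - F \<zeta>) / (Y n - \<zeta>)" for n
      proof -
        have i: "integrable M (\<lambda>x. H x * exp (Y n * of_real (L x)))" "integrable M (\<lambda>x. H x * exp (\<zeta> * of_real (L x)))"
          using Yr[of n] d \<zeta> by (auto intro!: Hi)
        have "(LINT x|M. H x * ((exp (Y n * of_real (L x)) - exp (\<zeta> * of_real (L x))) / (Y n - \<zeta>)))
           = (LINT x|M. (H x * exp (Y n * of_real (L x)) - H x * exp (\<zeta> * of_real (L x))) / (Y n - \<zeta>))"
          by (simp add: right_diff_distrib)
        also have "\<dots> = (F (Y n) - F \<zeta>) / (Y n - \<zeta>)"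
          unfolding F_def by (subst integral_diff[symmetric]) (use i in auto)
        finally show ?thesis .
      qed
      have "(\<lambda>n. (F (X (n + n0)) - F \<zeta>) / (X (n + n0) - \<zeta>))
         \<longlonglongrightarrow> (LINT x|M. H x * (of_real (L x) * exp (\<zeta> * of_real (L x))))"
        using lim unfolding quot unfolding Y_def .
      then show "(\<lambda>n. (F (X n) - F \<zeta>) / (X n - \<zeta>)) \<longlonglongrightarrow> (LINT x|M. H x * (of_real (L x) * exp (\<zeta> * of_real (L x))))"
        by (rule LIMSEQ_offset)
    qed
  qed
  define c where "c = ln (M1 / M0)"
  have FB: "norm (F z) \<le> M0 * exp (Re z * c)" if z: "0 \<le> Re z" "Re z \<le> 1" for z
    unfolding c_def
  proof (rule three_lines[OF hol cont _ _ _ M z])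
    show "norm (F \<xi>) \<le> (LINT x|M. w x)" if "0 \<le> Re \<xi>" "Re \<xi> \<le> 1" for \<xi>
    proof -
      have "norm (F \<xi>) \<le> (LINT x|M. norm (H x * exp (\<xi> * of_real (L x))))" unfolding F_def by (rule integral_norm_bound)
      also have "\<dots> \<le> (LINT x|M. w x)" using wb[OF that] by (intro integral_mono integrable_norm Hi that wi)
      finally show ?thesis .
    qed
    show "norm (F \<xi>) \<le> M0" if "Re \<xi> = 0" for \<xi>
    proof -
      have "\<xi> = \<i> * of_real (Im \<xi>)" using that by (simp add: complex_eq_iff)
      then show ?thesis using b0[of "Im \<xi>"] by (simp add: F_def)
    qed
    show "norm (F \<xi>) \<le> M1" if "Re \<xi> = 1" for \<xi>
    proof -
      have "\<xi> = 1 + \<i> * of_real (Im \<xi>)" using that by (simp add: complex_eq_iff)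
      then show ?thesis using b1[of "Im \<xi>"] by (simp add: F_def)
    qed
  qed
  \<comment> \<open>The point 0 lies on the boundary of the strip, so only one-sided difference
    quotients along a real sequence are available there; \<open>iL\<close> and \<open>i1\<close>
    supply their majorant.\<close>
  define \<sigma> :: "nat \<Rightarrow> real" where "\<sigma> n = inverse (real (Suc n))" for n
  have \<sigma>: "\<sigma> n > 0" "\<sigma> n \<le> 1" for n by (auto simp: \<sigma>_def inverse_le_1_iff)
  have \<sigma>l: "\<sigma> \<longlonglongrightarrow> 0" unfolding \<sigma>_def by (rule LIMSEQ_inverse_real_of_nat)
  have expl: "(\<lambda>n. (exp (\<sigma> n * l) - 1) / \<sigma> n) \<longlonglongrightarrow> l" for l
  proof -
    have "((\<lambda>y. exp (y * l)) has_field_derivative l) (at 0)" by (auto intro!: derivative_eq_intros)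
    then have "((\<lambda>y. (exp (y * l) - 1) / y) \<longlongrightarrow> l) (at 0)" by (simp add: has_field_derivative_iff)
    then show ?thesis
      unfolding tendsto_at_iff_sequentially comp_def using \<sigma>(1) \<sigma>l by (auto simp: less_imp_neq[THEN not_sym])
  qed
  have l1: "(\<lambda>n. LINT x|M. H x * of_real ((exp (\<sigma> n * L x) - 1) / \<sigma> n)) \<longlonglongrightarrow> (LINT x|M. H x * of_real (L x))"
  proof (rule integral_dominated_convergence)
    show "integrable M (\<lambda>x. norm (H x) * \<bar>L x\<bar> + norm (H x) * exp (L x))" using i1 iL by simp
    show "AE x in M. (\<lambda>n. H x * of_real ((exp (\<sigma> n * L x) - 1) / \<sigma> n)) \<longlonglongrightarrow> H x * of_real (L x)"
      by (intro AE_I2 tendsto_mult_left tendsto_of_real expl)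
    fix n
    show "AE x in M. norm (H x * of_real ((exp (\<sigma> n * L x) - 1) / \<sigma> n)) \<le> norm (H x) * \<bar>L x\<bar> + norm (H x) * exp (L x)"
    proof (rule AE_I2)
      fix x
      have "\<bar>exp (\<sigma> n * L x) - 1\<bar> \<le> \<sigma> n * (\<bar>L x\<bar> + exp (L x))"
      proof (cases "L x \<ge> 0")
        case True
        \<comment> \<open>The weighted inequality of means, that is, convexity of the exponential:
          its quotient at \<sigma> is at most the one at 1.\<close>
        have "1 powr (1 - \<sigma> n) * exp (L x) powr \<sigma> n \<le> (1 - \<sigma> n) * 1 + \<sigma> n * exp (L x)"
          using \<sigma>[of n] by (intro Youngs_inequality_0) auto
        then have "exp (\<sigma> n * L x) - 1 \<le> \<sigma> n * exp (L x)" using \<sigma>(1)[of n]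
          by (simp add: exp_powr_real mult.commute)
        moreover have "\<sigma> n * exp (L x) \<le> \<sigma> n * (\<bar>L x\<bar> + exp (L x))" using \<sigma>(1)[of n] by (intro mult_left_mono) auto
        moreover have "exp (\<sigma> n * L x) \<ge> 1" using True \<sigma>(1)[of n] by simp
        ultimately show ?thesis by linarith
      next
        case False
        have "1 + \<sigma> n * L x \<le> exp (\<sigma> n * L x)" by (rule exp_ge_add_one_self)
        moreover have "exp (\<sigma> n * L x) \<le> 1" using False \<sigma>(1)[of n] by (simp add: mult_nonneg_nonpos)
        moreover have "- (\<sigma> n * L x) \<le> \<sigma> n * (\<bar>L x\<bar> + exp (L x))"
          using False \<sigma>(1)[of n] by (simp add: algebra_simps)
        ultimately show ?thesis by linarith
      qed
      then have "\<bar>(exp (\<sigma> n * L x) - 1) / \<sigma> n\<bar> \<le> \<bar>L x\<bar> + exp (L x)"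
        using \<sigma>(1)[of n] by (simp add: abs_divide divide_le_eq mult.commute)
      then show "norm (H x * of_real ((exp (\<sigma> n * L x) - 1) / \<sigma> n)) \<le> norm (H x) * \<bar>L x\<bar> + norm (H x) * exp (L x)"
        unfolding norm_mult norm_of_real distrib_left[symmetric] by (rule mult_left_mono) simp
    qed
  qed measurable
  have q: "(LINT x|M. H x * of_real ((exp (\<sigma> n * L x) - 1) / \<sigma> n)) = (F (of_real (\<sigma> n)) - of_real M0) / of_real (\<sigma> n)" for n
  proof -
    have i: "integrable M (\<lambda>x. H x * exp (of_real (\<sigma> n) * of_real (L x)))" using \<sigma>[of n] by (intro Hi) auto
    have "(LINT x|M. H x * of_real ((exp (\<sigma> n * L x) - 1) / \<sigma> n))
      = (LINT x|M. (H x * exp (of_real (\<sigma> n) * of_real (L x)) - H x) / of_real (\<sigma> n))"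
      by (simp add: right_diff_distrib exp_of_real[symmetric])
    also have "\<dots> = (F (of_real (\<sigma> n)) - of_real M0) / of_real (\<sigma> n)"
      unfolding F_def F0[symmetric] by (subst integral_diff[symmetric]) (use i i0 in auto)
    finally show ?thesis .
  qed
  have le: "Re ((F (of_real (\<sigma> n)) - of_real M0) / of_real (\<sigma> n)) \<le> M0 * ((exp (\<sigma> n * c) - 1) / \<sigma> n)" for n
  proof -
    have "Re (F (of_real (\<sigma> n))) \<le> M0 * exp (\<sigma> n * c)"
      using FB[of "of_real (\<sigma> n)"] \<sigma>[of n] complex_Re_le_cmod order_trans by fastforce
    then have "(Re (F (of_real (\<sigma> n))) - M0) / \<sigma> n \<le> (M0 * exp (\<sigma> n * c) - M0) / \<sigma> n"
      using \<sigma>(1)[of n] by (intro divide_right_mono) auto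
    then show ?thesis by (simp add: right_diff_distrib)
  qed
  have "(\<lambda>n. Re ((F (of_real (\<sigma> n)) - of_real M0) / of_real (\<sigma> n))) \<longlonglongrightarrow> Re (LINT x|M. H x * of_real (L x))"
    using tendsto_Re[OF l1] unfolding q .
  moreover have "(\<lambda>n. M0 * ((exp (\<sigma> n * c) - 1) / \<sigma> n)) \<longlonglongrightarrow> M0 * c" by (intro tendsto_mult_left expl)
  ultimately show ?thesis unfolding c_def[symmetric] by (rule LIMSEQ_le) (use le in auto)
qed

section \<open>Powers and logarithms bounded by 1 + x^2\<close>

lemma le_one_plus_square: "x \<le> 1 + x\<^sup>2" for x :: real
  using sum_squares_bound[of x 1] zero_le_power2[of x] by (simp add: power2_eq_square) (smt (verit) zero_le_square)

lemma mult_abs_ln_le: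
  fixes x :: real
  assumes "x \<ge> 0" shows "x * \<bar>ln x\<bar> \<le> 1 + x\<^sup>2"
proof (cases "x \<le> 1")
  case True
  show ?thesis
  proof (cases "x = 0")
    case False
    then have x: "x > 0" using assms by simp
    have "ln (1 / x) \<le> 1 / x - 1" using x by (intro ln_le_minus_one) simp
    then have "x * (- ln x) \<le> x * (1 / x - 1)" using x by (intro mult_left_mono) (auto simp: ln_div)
    also have "\<dots> = 1 - x" using x by (simp add: field_simps)
    finally show ?thesis using x True by (simp add: abs_if) (smt (verit) zero_le_power2)
  qed simp
next
  case False
  then have "ln x \<le> x" using ln_le_minus_one[of x] by simp
  then have "x * \<bar>ln x\<bar> \<le> x * x" using False by (intro mult_left_mono) auto
  then show ?thesis by (simp add: power2_eq_square)
qed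

lemma powr_le_one_plus_square:
  fixes x s :: real
  assumes "x \<ge> 0" "0 \<le> s" "s \<le> 2" shows "x powr s \<le> 1 + x\<^sup>2"
proof (cases "x \<le> 1")
  case True
  then have "x powr s \<le> 1" using assms by (intro powr_le1) auto
  then show ?thesis by (simp add: add_increasing2)
next
  case False
  then have "x powr s \<le> x powr 2" using assms by (intro powr_mono) auto
  also have "\<dots> = x\<^sup>2" using False by simp
  finally show ?thesis by simp
qed

text \<open>At a zero of \<open>f\<close> both sides vanish, whatever the junk value \<open>ln 0 = 0\<close> contributes.\<close>

lemma norm_mult_exp_ln:
  fixes x :: real
  assumes "x \<ge> 0" shows "x * exp (c * ln x) = (if x = 0 then 0 else x powr (c + 1))"
  using assms by (auto simp: powr_def exp_add algebra_simps)

section \<open>Growth below every Gaussian and integrability on the product space\<close>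

context deformed_bargmann
begin

text \<open>The product majorises |f|, |f|^2, |z|^2 |f|^2 and |f| |ln |f||, hence all factors of the
  interpolation. Every \<eta> > 0 is demanded because the room left by the kernel depends on a and q
  and can be arbitrarily small.\<close>

definition slow_growth :: "(complex \<Rightarrow> complex) \<Rightarrow> bool" where
  "slow_growth f \<longleftrightarrow> f \<in> even_entire \<and>
     (\<forall>\<eta>>0. \<exists>D. \<forall>z. (1 + nsq z) * (1 + nsq (f z)) \<le> D * exp (\<eta> * nsq z))"

lemma slow_growth_integrable:
  assumes f: "slow_growth f" and gm: "g \<in> borel_measurable borel"
    and g: "\<And>z. \<bar>g z\<bar> \<le> B * ((1 + nsq z) * (1 + nsq (f z)))\<^sup>2"
  shows "integrable N (g :: complex \<Rightarrow> real)"
proof -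
  obtain D where D: "\<And>z. (1 + nsq z) * (1 + nsq (f z)) \<le> D * exp (1/4 * nsq z)"
  proof -
    have "(1/4 :: real) > 0" by simp
    then show thesis using f that unfolding slow_growth_def by blast
  qed
  show ?thesis
  proof (rule integrable_gauss[OF gm, of "1/2" "\<bar>B\<bar> * D\<^sup>2" 0])
    fix z
    have "\<bar>g z\<bar> \<le> \<bar>B\<bar> * ((1 + nsq z) * (1 + nsq (f z)))\<^sup>2"
      using g[of z] by (rule order_trans) (intro mult_right_mono, auto)
    also have "\<dots> \<le> \<bar>B\<bar> * (D * exp (1/4 * nsq z))\<^sup>2" by (intro mult_left_mono power_mono D) auto
    finally show "norm (g z) \<le> \<bar>B\<bar> * D\<^sup>2 * (exp (0 * norm z) * exp (1/2 * nsq z))"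
      by (simp add: power_mult_distrib mult.assoc flip: exp_double)
  qed simp
qed

lemma slow_growth_xlnx_integrable:
  assumes "slow_growth f"
  shows "integrable N (\<lambda>z. nsq (f z) * ln (nsq (f z)))"
proof (rule slow_growth_integrable[OF assms, of _ 1])
  have [measurable]: "f \<in> borel_measurable borel" using assms by (auto simp: slow_growth_def intro: even_entire_measurable)
  show "(\<lambda>z. nsq (f z) * ln (nsq (f z))) \<in> borel_measurable borel" by measurable
  fix z
  let ?x = "nsq (f z)"
  have "\<bar>?x * ln ?x\<bar> \<le> 1 + ?x\<^sup>2" using mult_abs_ln_le[of ?x] by (simp add: abs_mult)
  also have "\<dots> \<le> (1 * (1 + ?x))\<^sup>2" by (simp add: power2_eq_square algebra_simps)
  also have "\<dots> \<le> ((1 + nsq z) * (1 + ?x))\<^sup>2" by (intro power_mono mult_right_mono) auto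
  finally show "\<bar>?x * ln ?x\<bar> \<le> 1 * ((1 + nsq z) * (1 + ?x))\<^sup>2" by simp
qed

lemma pair_integrable_gauss:
  fixes h :: "complex \<times> complex \<Rightarrow> 'b::{banach, second_countable_topology}"
  assumes [measurable]: "h \<in> borel_measurable (N \<Otimes>\<^sub>M N)" and "\<alpha> < 1" "\<beta> < 1"
    and h: "\<And>w z. norm (h (w, z)) \<le> B * (exp (\<alpha> * nsq w) * exp (\<beta> * nsq z))"
  shows "integrable (N \<Otimes>\<^sub>M N) h"
proof (rule integrable_bound)
  interpret P: pair_sigma_finite N N ..
  have i: "integrable N (\<lambda>z. exp (\<alpha> * nsq z))" "integrable N (\<lambda>z. exp (\<beta> * nsq z))"
    using assms by (auto intro: integrable_exp)
  have "integrable (N \<Otimes>\<^sub>M N) (\<lambda>x. exp (\<alpha> * nsq (fst x)) * exp (\<beta> * nsq (snd x)))"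
    by (rule P.Fubini_integrable) (use i in \<open>auto simp: norm_mult\<close>)
  then show "integrable (N \<Otimes>\<^sub>M N) (\<lambda>x. B * (exp (\<alpha> * nsq (fst x)) * exp (\<beta> * nsq (snd x))))"
    by (rule integrable_mult_right)
  show "AE x in N \<Otimes>\<^sub>M N. norm (h x) \<le> norm (B * (exp (\<alpha> * nsq (fst x)) * exp (\<beta> * nsq (snd x))))"
    using h by (intro AE_I2) (auto intro: order_trans[OF _ abs_ge_self])
qed fact

text \<open>A deliberately uneven split: z takes nearly all the weight that integrability allows,
  which leaves little more than 1/4 for w, where the factor exp (- a |w|^2 / q) grows if a <
  0.\<close>

lemma kernel_gauss:
  assumes "r > 1"
  obtains C where "C > 0"
    "\<And>z w. norm (kernel_e \<mu> z w) \<le> C * (exp (r\<^sup>2 / 4 * nsq w) * exp (1 / r * nsq z))"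
proof -
  define \<delta> where "\<delta> = sqrt r - 1"
  have \<delta>: "\<delta> > 0" "(1 + \<delta>)\<^sup>2 = r" using assms by (auto simp: \<delta>_def)
  obtain C where C: "C > 0" "\<And>z w. norm (kernel_e \<mu> z w) \<le> C * exp ((1 + \<delta>) * (norm z * norm w))"
    by (rule norm_kernel_bound[OF \<delta>(1)]) blast
  show ?thesis
  proof (rule that[OF C(1)])
    fix z w :: complex
    have "norm z * ((1 + \<delta>) * norm w) \<le> 1 / r * nsq z + ((1 + \<delta>) * norm w)\<^sup>2 / (4 * (1 / r))"
      using assms by (intro mult_le_weighted_squares) auto
    also have "((1 + \<delta>) * norm w)\<^sup>2 / (4 * (1 / r)) = r\<^sup>2 / 4 * nsq w"
      unfolding power_mult_distrib \<delta>(2) by (simp add: power2_eq_square)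
    finally have "exp ((1 + \<delta>) * (norm z * norm w)) \<le> exp (r\<^sup>2 / 4 * nsq w) * exp (1 / r * nsq z)"
      by (simp add: add.commute mult_ac flip: exp_add)
    then show "norm (kernel_e \<mu> z w) \<le> C * (exp (r\<^sup>2 / 4 * nsq w) * exp (1 / r * nsq z))"
      using C(2)[of z w] C(1) by (meson mult_left_mono less_imp_le order_trans)
  qed
qed

lemma kernel_pair_integrable:
  fixes h :: "complex \<times> complex \<Rightarrow> 'b::{banach, second_countable_topology}"
  assumes [measurable]: "h \<in> borel_measurable (N \<Otimes>\<^sub>M N)" and r: "r > 1" and "1 / r + \<eta> < 1" "r\<^sup>2 / 4 + \<eta> + \<beta> < 1"
    and G: "\<And>z. 0 \<le> G z" "\<And>z. G z \<le> D * exp (\<eta> * nsq z)"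
    and B: "B \<ge> 0" and h: "\<And>w z. norm (h (w, z)) \<le> B * (norm (kernel_e \<mu> z w) * G z * (G w * exp (\<beta> * nsq w)))"
  shows "integrable (N \<Otimes>\<^sub>M N) h"
proof -
  obtain C where C: "C > 0"
    "\<And>z w. norm (kernel_e \<mu> z w) \<le> C * (exp (r\<^sup>2 / 4 * nsq w) * exp (1 / r * nsq z))"
    by (rule kernel_gauss[OF r]) blast
  have D: "D \<ge> 0" using G[of 0] by simp
  show ?thesis
  proof (rule pair_integrable_gauss[of h "r\<^sup>2 / 4 + \<eta> + \<beta>" "1 / r + \<eta>" "B * C * D * D"])
    fix w z
    have "norm (h (w, z)) \<le> B * (norm (kernel_e \<mu> z w) * G z * (G w * exp (\<beta> * nsq w)))" by (rule h)
    also have "\<dots> \<le> B * (C * (exp (r\<^sup>2 / 4 * nsq w) * exp (1 / r * nsq z)) * (D * exp (\<eta> * nsq z))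
        * (D * exp (\<eta> * nsq w) * exp (\<beta> * nsq w)))"
      using C(1) D B by (intro mult_left_mono mult_mono C(2) G) (auto simp: G(1))
    also have "\<dots> = B * C * D * D * (exp ((r\<^sup>2 / 4 + \<eta> + \<beta>) * nsq w) * exp ((1 / r + \<eta>) * nsq z))"
    proof -
      have e: "exp ((r\<^sup>2 / 4 + \<eta> + \<beta>) * x) = exp (r\<^sup>2 / 4 * x) * exp (\<eta> * x) * exp (\<beta> * x)"
        "exp ((1 / r + \<eta>) * x) = exp (1 / r * x) * exp (\<eta> * x)" for x :: real
        by (simp_all only: distrib_right exp_add)
      show ?thesis unfolding e by (simp only: mult_ac)
    qed
    finally show "norm (h (w, z)) \<le> B * C * D * D * (exp ((r\<^sup>2 / 4 + \<eta> + \<beta>) * nsq w) * exp ((1 / r + \<eta>) * nsq z))" .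
  qed (use assms in auto)
qed

end

context deformed_bargmann_pqa
begin

lemma recip_exp_bounds: "0 \<le> recip_exp p" "recip_exp p \<le> 1"
  by (rule ereal_gt_one_cases[OF p]; simp add: recip_exp_def)+

text \<open>The exponents in w, 1/4 from the kernel and - a / q from the weight, leave room below 1.
  It follows from p' \<ge> 1 and q \<ge> 1: q/4 - a < 1 \<le> q.\<close>

lemma a_over_q: "1 / 4 - a / q < 1"
proof -
  have "q * (1/4) \<le> conj_exp p * q / 4" using conj_exp_ge_1[OF p] q by simp
  then have "q * (1/4) < 1 + a" using a by linarith
  also have "\<dots> \<le> q + a" using q by simp
  finally show ?thesis using q by (simp add: field_simps)
qed

text \<open>On Re \<zeta> = 1 the first function has modulus |f|^(2/p) and L^p norm n2^(1/p), with
  n2 the squared norm of f. The second is |f|^(2 - 2/q) times exp (- a |w|^2 / q); its power of |f|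
  has L^(q') norm n2^(1 - 1/q), and its Gaussian turns the L^q norm of the image into that of the
  weighted space. Hoelder's inequality thus gives A n2^(1/p) n2^(1 - 1/q), whose quotient by n2 has
  the logarithm on the right.\<close>

lemma energy_entropy_slow_growth:
  assumes f: "slow_growth f" and N2: "(LINT z|N. nsq (f z)) > 0"
  shows "(recip_exp p - 1 / q) * (LINT z|N. nsq (f z) * ln (nsq (f z)))
       - a / q * (LINT z|N. nsq z * nsq (f z))
     \<le> (LINT z|N. nsq (f z)) * (ln A + (recip_exp p - 1 / q) * ln (LINT z|N. nsq (f z)))"
proof -
  interpret P: pair_sigma_finite N N ..
  define \<rho> where "\<rho> = recip_exp p"
  have \<rho>: "0 \<le> \<rho>" "\<rho> \<le> 1" using recip_exp_bounds by (simp_all add: \<rho>_def)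
  define n2 where "n2 = (LINT z|N. nsq (f z))"
  have n2: "n2 > 0" using N2 by (simp add: n2_def)
  define G where "G z = (1 + nsq z) * (1 + nsq (f z))" for z
  have fe: "f \<in> even_entire" and G\<eta>: "\<And>\<eta>. \<eta> > 0 \<Longrightarrow> \<exists>D. \<forall>z. G z \<le> D * exp (\<eta> * nsq z)"
    using f by (auto simp: slow_growth_def G_def)
  have fm[measurable]: "f \<in> borel_measurable borel" by (rule even_entire_measurable[OF fe])
  obtain D where D: "\<And>z. G z \<le> D * exp (1/4 * nsq z)" using G\<eta>[of "1/4"] by auto
  have G1: "1 + nsq (f z) \<le> G z" for z
    unfolding G_def using mult_right_mono[of 1 "1 + nsq z" "1 + nsq (f z)"] by simp
  have G0: "G z \<ge> 0" for z using G1[of z] zero_le_power2[of "norm (f z)"] by linarith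
  have G2: "nsq z * (1 + nsq (f z)) \<le> G z" for z
    unfolding G_def by (intro mult_right_mono) auto
  have fG: "norm (f z) \<le> G z" for z using le_one_plus_square[of "norm (f z)"] G1[of z] by linarith
  have f2G: "nsq (f z) \<le> G z" for z using G1[of z] by linarith
  have fg: "norm (f z) \<le> D * exp (nsq z / 4)" for z using fG[of z] D[of z] by simp
  have GG: "G z \<le> (G z)\<^sup>2" for z
  proof -
    have "1 \<le> G z" using G1[of z] zero_le_power2[of "norm (f z)"] by linarith
    then show ?thesis using mult_right_mono[of 1 "G z" "G z"] by (simp add: power2_eq_square)
  qed
  have Gi: "integrable N g" if "g \<in> borel_measurable borel" "\<And>z. \<bar>g z\<bar> \<le> G z" for g :: "complex \<Rightarrow> real"
    by (rule slow_growth_integrable[OF f that(1), of 1]) (use that(2) GG in \<open>auto simp: G_def intro: order_trans\<close>)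
  have f2i: "integrable N (\<lambda>z. nsq (f z))" using f2G by (intro Gi) auto
  have ei: "exp_integrable f" using fg by (intro exp_integrable_gauss[of f "1/4" D]) auto
  have repr: "K_e \<mu> f = f" by (rule K_e_reproducing[OF fe ei])
  \<comment> \<open>The logarithms of the factors acquired from \<zeta> = 0 to \<zeta> = 1, so that
    the integrand on the product space is H exp (\<zeta> (L1 + L2)) as the interpolation lemma
    requires.\<close>
  define L1 where "L1 z = (2 * \<rho> - 1) * ln (norm (f z))" for z
  define L2 where "L2 w = (1 - 2 / q) * ln (norm (f w)) - a / q * nsq w" for w
  define H where "H x = kernel_e \<mu> (snd x) (fst x) * f (snd x) * cnj (f (fst x))" for x
  have [measurable]: "L1 \<in> borel_measurable borel" "L2 \<in> borel_measurable borel"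
    "H \<in> borel_measurable (N \<Otimes>\<^sub>M N)" unfolding L1_def[abs_def] L2_def[abs_def] H_def[abs_def] by measurable
  have q': "\<bar>1 - 2 / q\<bar> \<le> 1" using q by (auto simp: abs_le_iff field_simps)
  have lnb: "norm (f z) * \<bar>c * ln (norm (f z))\<bar> \<le> 1 + nsq (f z)" if "\<bar>c\<bar> \<le> 1" for c z
  proof -
    have "norm (f z) * \<bar>c * ln (norm (f z))\<bar> = \<bar>c\<bar> * (norm (f z) * \<bar>ln (norm (f z))\<bar>)" by (simp add: abs_mult)
    also have "\<dots> \<le> 1 * (1 + nsq (f z))" using that by (intro mult_mono mult_abs_ln_le) auto
    finally show ?thesis by simp
  qed
  have fL1: "norm (f z) * \<bar>L1 z\<bar> \<le> G z" for z
  proof -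
    have "norm (f z) * \<bar>L1 z\<bar> \<le> 1 + nsq (f z)" unfolding L1_def using \<rho> by (intro lnb) auto
    then show ?thesis using G1[of z] by linarith
  qed
  have fL2: "norm (f z) * \<bar>L2 z\<bar> \<le> (1 + \<bar>a / q\<bar>) * G z" for z
  proof -
    have "\<bar>L2 z\<bar> \<le> \<bar>(1 - 2 / q) * ln (norm (f z))\<bar> + \<bar>a / q\<bar> * nsq z"
      unfolding L2_def by (rule order_trans[OF abs_triangle_ineq4]) (simp add: abs_mult)
    then have "norm (f z) * \<bar>L2 z\<bar> \<le> norm (f z) * (\<bar>(1 - 2 / q) * ln (norm (f z))\<bar> + \<bar>a / q\<bar> * nsq z)"
      by (rule mult_left_mono) simp
    also have "\<dots> = norm (f z) * \<bar>(1 - 2 / q) * ln (norm (f z))\<bar> + \<bar>a / q\<bar> * (nsq z * norm (f z))"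
      by (simp only: distrib_left mult_ac)
    also have "\<dots> \<le> G z + \<bar>a / q\<bar> * G z"
    proof (intro add_mono mult_left_mono)
      show "norm (f z) * \<bar>(1 - 2 / q) * ln (norm (f z))\<bar> \<le> G z" using lnb[OF q', of z] G1[of z] by linarith
      have "nsq z * norm (f z) \<le> nsq z * (1 + nsq (f z))" by (intro mult_left_mono le_one_plus_square) simp
      then show "nsq z * norm (f z) \<le> G z" using G2[of z] by linarith
    qed simp
    finally show ?thesis by (simp add: algebra_simps)
  qed
  have fE1: "norm (f z) * exp (L1 z) \<le> G z" for z
  proof -
    have "norm (f z) * exp (L1 z) = (if f z = 0 then 0 else norm (f z) powr (2 * \<rho>))"
      unfolding L1_def using norm_mult_exp_ln[of "norm (f z)" "2 * \<rho> - 1"] by simp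
    also have "\<dots> \<le> 1 + nsq (f z)" using powr_le_one_plus_square[of "norm (f z)" "2 * \<rho>"] \<rho> by auto
    finally show ?thesis using G1[of z] by linarith
  qed
  define y where "y w = norm (f w) * exp ((1 - 2 / q) * ln (norm (f w)))" for w
  have y: "y w = (if f w = 0 then 0 else norm (f w) powr (2 - 2 / q))" for w
    unfolding y_def using norm_mult_exp_ln[of "norm (f w)" "1 - 2 / q"] by simp
  have [measurable]: "y \<in> borel_measurable borel" unfolding y_def[abs_def] by measurable
  have y0: "y w \<ge> 0" for w by (simp add: y_def)
  have yE: "norm (f w) * exp (L2 w) = y w * exp (- (a / q) * nsq w)" for w
    unfolding L2_def y_def by (simp only: diff_conv_add_uminus exp_add minus_mult_left mult.assoc)
  have yG: "y w \<le> G w" for w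
  proof -
    have "y w \<le> 1 + nsq (f w)"
      using powr_le_one_plus_square[of "norm (f w)" "2 - 2 / q"] q by (auto simp: y field_simps)
    then show ?thesis using G1[of w] by linarith
  qed
  \<comment> \<open>With r = 3/2 and \<eta> = 1/4 the weights are 2/3 + 1/4 = 11/12 in z and 9/16 +
    1/4 = 13/16 in w.\<close>
  have PI: "integrable (N \<Otimes>\<^sub>M N) h" if "h \<in> borel_measurable (N \<Otimes>\<^sub>M N)" "B \<ge> 0"
    "\<And>w z. norm (h (w, z)) \<le> B * (norm (kernel_e \<mu> z w) * G z * G w)" for h :: "complex \<times> complex \<Rightarrow> complex" and B
    by (rule kernel_pair_integrable[of h "3/2" "1/4" 0 G D B]) (use that G0 D in \<open>simp_all add: power2_eq_square\<close>)
  have nH: "norm (H (w, z)) = norm (kernel_e \<mu> z w) * norm (f z) * norm (f w)" for w z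
    by (simp add: H_def norm_mult)
  have i0: "integrable (N \<Otimes>\<^sub>M N) H"
    using fG G0 by (intro PI[of H 1]) (auto simp: nH intro!: mult_mono)
  have iL1: "integrable (N \<Otimes>\<^sub>M N) (\<lambda>x. H x * of_real (L1 (snd x)))"
  proof (rule PI[of _ 1])
    fix w z
    have "norm (kernel_e \<mu> z w) * (norm (f z) * \<bar>L1 z\<bar>) * norm (f w) \<le> norm (kernel_e \<mu> z w) * G z * G w"
      using fL1 fG G0 by (intro mult_mono) auto
    then show "norm (H (w, z) * of_real (L1 (snd (w, z)))) \<le> 1 * (norm (kernel_e \<mu> z w) * G z * G w)"
      by (simp add: norm_mult nH mult_ac)
  qed auto
  have iL2: "integrable (N \<Otimes>\<^sub>M N) (\<lambda>x. H x * of_real (L2 (fst x)))"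
  proof (rule PI[of _ "1 + \<bar>a / q\<bar>"])
    fix w z
    have "norm (kernel_e \<mu> z w) * norm (f z) * (norm (f w) * \<bar>L2 w\<bar>) \<le> norm (kernel_e \<mu> z w) * G z * ((1 + \<bar>a / q\<bar>) * G w)"
      by (rule mult_mono[OF mult_left_mono[OF fG] fL2]) (use G0 in auto)
    then show "norm (H (w, z) * of_real (L2 (fst (w, z)))) \<le> (1 + \<bar>a / q\<bar>) * (norm (kernel_e \<mu> z w) * G z * G w)"
      by (simp add: norm_mult nH mult_ac)
  qed auto
  have i1: "integrable (N \<Otimes>\<^sub>M N) (\<lambda>x. norm (H x) * exp (L1 (snd x) + L2 (fst x)))"
  proof -
    \<comment> \<open>The room from \<open>a_over_q\<close>. Taking r^2 = 1 + 2 g spends half of it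
      on the kernel, and \<eta> \<le> g / 4 at most another quarter.\<close>
    define g where "g = 1 - (1/4 - a / q)"
    have g: "g > 0" using a_over_q by (simp add: g_def)
    define r where "r = sqrt (1 + 2 * g)"
    have r: "r > 1" "r\<^sup>2 = 1 + 2 * g" using g by (auto simp: r_def)
    define \<eta> where "\<eta> = min (1 - 1 / r) (g / 2) / 2"
    have pos: "1 - 1 / r > 0" using r by simp
    have \<eta>le: "\<eta> \<le> g / 4" "\<eta> \<le> (1 - 1 / r) / 2" "\<eta> > 0"
    proof -
      have "min x y / 2 \<le> y / 2" "min x y / 2 \<le> x / 2" "x > 0 \<Longrightarrow> y > 0 \<Longrightarrow> min x y / 2 > 0" for x y :: real
        by auto
      from this[of "1 - 1 / r" "g / 2"] show "\<eta> \<le> g / 4" "\<eta> \<le> (1 - 1 / r) / 2" "\<eta> > 0"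
        unfolding \<eta>_def using pos g by simp_all
    qed
    have aq: "a / q = g - 3 / 4" by (simp add: g_def)
    have "x + e < 1" if "e \<le> (1 - x) / 2" "0 < 1 - x" for x e :: real using that by (simp add: field_simps)
    from this[OF \<eta>le(2) pos] have r2: "1 / r + \<eta> < 1" .
    have "r\<^sup>2 / 4 + \<eta> + (- (a / q)) < 1" unfolding aq r(2) using \<eta>le(1) g by (simp add: field_simps)
    with \<eta>le(3) r2 have \<eta>: "\<eta> > 0" "1 / r + \<eta> < 1" "r\<^sup>2 / 4 + \<eta> + (- (a / q)) < 1" by auto
    obtain D' where D': "\<And>z. G z \<le> D' * exp (\<eta> * nsq z)" using G\<eta>[OF \<eta>(1)] by auto
    show ?thesis
    proof (rule kernel_pair_integrable[OF _ r(1) \<eta>(2,3) G0 D', of _ 1])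
      fix w z
      have "norm (H (w, z)) * exp (L1 z + L2 w) = norm (kernel_e \<mu> z w) * (norm (f z) * exp (L1 z)) * (norm (f w) * exp (L2 w))"
        by (simp add: nH exp_add mult_ac)
      also have "\<dots> \<le> norm (kernel_e \<mu> z w) * G z * (G w * exp (- (a / q) * nsq w))"
        unfolding yE using fE1 yG y0 G0 by (intro mult_mono) auto
      finally show "norm (norm (H (w, z)) * exp (L1 (snd (w, z)) + L2 (fst (w, z))))
        \<le> 1 * (norm (kernel_e \<mu> z w) * G z * (G w * exp (- (a / q) * nsq w)))" by (simp add: abs_mult)
    qed auto
  qed
  define u where "u \<zeta> z = f z * exp (\<zeta> * of_real (L1 z))" for \<zeta> z
  define v where "v \<zeta> w = cnj (f w) * exp (\<zeta> * of_real (L2 w))" for \<zeta> w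
  have um[measurable]: "u \<zeta> \<in> borel_measurable borel" "v \<zeta> \<in> borel_measurable borel" for \<zeta>
    unfolding u_def[abs_def] v_def[abs_def] by measurable
  have iter: "(LINT x|(N \<Otimes>\<^sub>M N). H x * exp (\<zeta> * of_real (L1 (snd x) + L2 (fst x)))) = (LINT w|N. K_e \<mu> (u \<zeta>) w * v \<zeta> w)"
    if "integrable (N \<Otimes>\<^sub>M N) (\<lambda>x. norm (H x) * exp (Re \<zeta> * (L1 (snd x) + L2 (fst x))))" for \<zeta>
  proof -
    have i: "integrable (N \<Otimes>\<^sub>M N) (\<lambda>x. H x * exp (\<zeta> * of_real (L1 (snd x) + L2 (fst x))))"
      by (rule integrable_bound[OF that]) (auto simp: norm_mult)
    have "(LINT x|(N \<Otimes>\<^sub>M N). H x * exp (\<zeta> * of_real (L1 (snd x) + L2 (fst x))))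
      = (LINT w|N. LINT z|N. H (w, z) * exp (\<zeta> * of_real (L1 z + L2 w)))"
      using P.integral_fst'[OF i] by simp
    also have "\<dots> = (LINT w|N. K_e \<mu> (u \<zeta>) w * v \<zeta> w)"
    proof (intro integral_cong refl)
      fix w
      have "(LINT z|N. H (w, z) * exp (\<zeta> * of_real (L1 z + L2 w))) = (LINT z|N. kernel_e \<mu> z w * u \<zeta> z * v \<zeta> w)"
        by (simp add: H_def u_def v_def distrib_left exp_add mult_ac)
      then show "(LINT z|N. H (w, z) * exp (\<zeta> * of_real (L1 z + L2 w))) = K_e \<mu> (u \<zeta>) w * v \<zeta> w"
        by (simp add: K_e_def)
    qed
    finally show ?thesis .
  qed
  define M1 where "M1 = A * n2 powr \<rho> * n2 powr (1 - 1 / q)"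
  have M1: "M1 > 0" using A_e_pos n2 by (simp add: M1_def)
  have b0: "norm (LINT x|(N \<Otimes>\<^sub>M N). H x * exp (\<i> * t * (L1 (snd x) + L2 (fst x)))) \<le> n2" for t :: real
  proof -
    let ?\<zeta> = "\<i> * complex_of_real t"
    \<comment> \<open>On the imaginary axis the exponential factors are unimodular, so the
      contraction bound only sees the norm of f.\<close>
    have "norm (u ?\<zeta> z) = norm (f z)" "norm (v ?\<zeta> z) = norm (f z)" for z
      by (simp_all add: u_def v_def norm_mult)
    then have "norm (LINT w|N. K_e \<mu> (u ?\<zeta>) w * v ?\<zeta> w) \<le> sqrt n2 * sqrt n2"
      using K_e_contraction[of "u ?\<zeta>" "v ?\<zeta>" D] fg by (simp add: n2_def)
    then show ?thesis using iter[of ?\<zeta>] i0 n2 by (simp add: integrable_norm)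
  qed
  have b1: "norm (LINT x|(N \<Otimes>\<^sub>M N). H x * exp ((1 + \<i> * t) * (L1 (snd x) + L2 (fst x)))) \<le> M1" for t :: real
  proof -
    let ?\<zeta> = "1 + \<i> * complex_of_real t"
    let ?u = "u ?\<zeta>" and ?v = "v ?\<zeta>"
    have nu: "norm (?u z) = (if f z = 0 then 0 else norm (f z) powr (2 * \<rho>))" for z
      using norm_mult_exp_ln[of "norm (f z)" "2 * \<rho> - 1"] by (simp add: u_def norm_mult L1_def)
    have nv: "norm (?v w) = y w * exp (- (a / q) * nsq w)" for w
      unfolding yE[symmetric] by (simp add: v_def norm_mult)
    have u: "?u \<in> Lp_space N p \<and> Lp_norm N p ?u \<le> n2 powr \<rho>"
      using p
    proof (cases p rule: ereal_gt_one_cases)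
      case 1
      have \<rho>0: "\<rho> = 0" by (simp add: 1 \<rho>_def recip_exp_def)
      have "esssup N (\<lambda>z. ereal (norm (?u z))) \<le> 1"
        by (rule esssup_I) (auto simp: nu \<rho>0)
      moreover have "real_of_ereal e \<le> 1" if "e \<le> 1" for e using that by (cases e) auto
      ultimately show ?thesis using n2
        by (auto simp: Lp_space_def Lp_norm_def 1 \<rho>0 intro: le_less_trans)
    next
      case (2 r)
      have \<rho>r: "\<rho> = 1 / r" by (simp add: 2 \<rho>_def recip_exp_def)
      have "norm (?u z) powr r = nsq (f z)" for z
        using 2(2) by (auto simp: nu \<rho>r powr_powr)
      then show ?thesis unfolding 2(1) Lp_space_finite Lp_norm_finite using f2i by (simp add: n2_def \<rho>r)
    qed
    let ?U = "K_e \<mu> ?u"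
    have UB: "?U \<in> B_ea \<mu> q a" using K_e_mem_B_ea u by blast
    then have [measurable]: "?U \<in> borel_measurable borel" by (auto simp: B_ea_def intro: even_entire_measurable)
    have Ui: "integrable N (\<lambda>w. exp (- a * nsq w) * norm (?U w) powr q)"
      using UB by (auto simp: B_ea_def Lp_space_finite integrable_nu_ea)
    have UN: "(LINT w|N. exp (- a * nsq w) * norm (?U w) powr q) powr (1 / q) \<le> A * n2 powr \<rho>"
    proof -
      have "(LINT w|N. exp (- a * nsq w) * norm (?U w) powr q) powr (1 / q) = Lp_norm Na (ereal q) ?U"
        unfolding Lp_norm_finite by (subst integral_nu_ea) auto
      also have "\<dots> \<le> A * Lp_norm N p ?u" using u by (intro A_e_bound) auto
      also have "\<dots> \<le> A * n2 powr \<rho>" using u A_e_pos by (intro mult_left_mono) auto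
      finally show ?thesis .
    qed
    have Xq: "(norm (?U w) * exp (- (a / q) * nsq w)) powr q = exp (- a * nsq w) * norm (?U w) powr q" for w
      using q by (simp add: powr_mult exp_powr_real mult.commute)
    have "integrable N (\<lambda>w. (norm (?U w) * exp (- (a / q) * nsq w)) * y w) \<and>
       (LINT w|N. (norm (?U w) * exp (- (a / q) * nsq w)) * y w) \<le> A * n2 powr \<rho> * n2 powr (1 - 1 / q)"
    proof (cases "q = 1")
      case True
      \<comment> \<open>For q = 1 the conjugate exponent is infinite and 2 - 2/q = 0: y is the
        indicator of the points where f does not vanish, and its bound 1 replaces Hoelder's
        inequality.\<close>
      have y1: "y w \<le> 1" for w by (simp add: y True)
      have Xi: "integrable N (\<lambda>w. norm (?U w) * exp (- (a / q) * nsq w))"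
        using Ui True by (simp add: mult.commute)
      have le: "norm (?U w) * exp (- (a / q) * nsq w) * y w \<le> norm (?U w) * exp (- (a / q) * nsq w)" for w
        using mult_left_mono[OF y1[of w], of "norm (?U w) * exp (- (a / q) * nsq w)"] by simp
      have i: "integrable N (\<lambda>w. norm (?U w) * exp (- (a / q) * nsq w) * y w)"
        by (rule integrable_bound[OF Xi]) (use le y0 in \<open>auto simp: abs_mult\<close>)
      have "(LINT w|N. norm (?U w) * exp (- (a / q) * nsq w) * y w) \<le> (LINT w|N. norm (?U w) * exp (- (a / q) * nsq w))"
        by (rule integral_mono[OF i Xi le])
      also have "\<dots> \<le> A * n2 powr \<rho>"
      proof -
        have "(LINT w|N. norm (?U w) * exp (- (a / q) * nsq w)) \<ge> 0" by (intro integral_nonneg_AE AE_I2) simp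
        then show ?thesis using UN True by (simp add: mult.commute)
      qed
      finally show ?thesis using i n2 True by simp
    next
      case False
      then have q1: "q > 1" using q by simp
      have yq: "y w powr (q / (q - 1)) = nsq (f w)" for w
      proof -
        have "(2 - 2 / q) * (q / (q - 1)) = 2" using q1 by (simp add: field_simps)
        then show ?thesis by (auto simp: y powr_powr)
      qed
      have cq: "q / (q - 1) > 1" "1 / q + 1 / (q / (q - 1)) = 1" "1 / (q / (q - 1)) = 1 - 1 / q" using q1 by (auto simp: field_simps)
      note Ho = Holder_nonneg[OF q1 cq(1,2), of "\<lambda>w. norm (?U w) * exp (- (a / q) * nsq w)" N y]
      have "integrable N (\<lambda>w. (norm (?U w) * exp (- (a / q) * nsq w)) * y w)"
        by (rule Ho(1)) (use Ui f2i y0 in \<open>simp_all only: Xq yq, auto\<close>)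
      moreover have "(LINT w|N. (norm (?U w) * exp (- (a / q) * nsq w)) * y w)
         \<le> (LINT w|N. exp (- a * nsq w) * norm (?U w) powr q) powr (1 / q) * n2 powr (1 - 1 / q)"
        unfolding n2_def cq(3)[symmetric] Xq[symmetric] yq[symmetric]
        by (rule Ho(2)) (use Ui f2i y0 in \<open>simp_all only: Xq yq, auto\<close>)
      moreover have "\<dots> \<le> A * n2 powr \<rho> * n2 powr (1 - 1 / q)" by (intro mult_right_mono UN) simp
      ultimately show ?thesis by (blast intro: order_trans)
    qed
    then have Xy: "integrable N (\<lambda>w. norm (?U w) * exp (- (a / q) * nsq w) * y w)"
       "(LINT w|N. norm (?U w) * exp (- (a / q) * nsq w) * y w) \<le> M1" by (auto simp: M1_def)
    have "norm (LINT w|N. ?U w * ?v w) \<le> (LINT w|N. norm (?U w * ?v w))" by (rule integral_norm_bound)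
    also have "\<dots> = (LINT w|N. norm (?U w) * exp (- (a / q) * nsq w) * y w)"
      by (intro integral_cong refl) (simp add: norm_mult nv mult_ac)
    also have "\<dots> \<le> M1" by (rule Xy)
    finally show ?thesis using iter[of ?\<zeta>] i1 by simp
  qed
  have n2c: "(LINT w|N. f w * cnj (f w)) = of_real n2"
    unfolding n2_def complex_norm_square[symmetric] by (rule integral_complex_of_real)
  have F0: "(LINT x|(N \<Otimes>\<^sub>M N). H x) = of_real n2"
  proof -
    have "u 0 = f" "v 0 = (\<lambda>w. cnj (f w))" by (simp_all add: u_def v_def fun_eq_iff)
    then show ?thesis using iter[of 0] i0 by (simp add: repr n2c integrable_norm)
  qed
  have iLL: "integrable (N \<Otimes>\<^sub>M N) (\<lambda>x. norm (H x) * \<bar>L1 (snd x) + L2 (fst x)\<bar>)"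
  proof -
    have "integrable (N \<Otimes>\<^sub>M N) (\<lambda>x. norm (H x * of_real (L1 (snd x)) + H x * of_real (L2 (fst x))))"
      using iL1 iL2 by (intro integrable_norm integrable_add)
    then show ?thesis by (simp add: norm_mult flip: distrib_left of_real_add)
  qed
  have main: "Re (LINT x|(N \<Otimes>\<^sub>M N). H x * of_real (L1 (snd x) + L2 (fst x))) \<le> n2 * ln (M1 / n2)"
    by (rule interpolation_derivative_bound[OF _ _ i0 i1 iLL b0 b1 F0 n2 M1]) measurable
  have I1: "(LINT x|(N \<Otimes>\<^sub>M N). H x * of_real (L1 (snd x))) = of_real (LINT z|N. nsq (f z) * L1 z)"
  proof -
    have "(LINT x|(N \<Otimes>\<^sub>M N). H x * of_real (L1 (snd x))) = (LINT z|N. LINT w|N. H (w, z) * of_real (L1 z))"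
      using P.integral_snd[of "\<lambda>w z. H (w, z) * of_real (L1 z)"] iL1 by (simp add: case_prod_unfold)
    also have "\<dots> = (LINT z|N. of_real (nsq (f z) * L1 z))"
    proof (intro integral_cong refl)
      fix z
      \<comment> \<open>Here w, the second kernel variable, is integrated; Hermitian symmetry turns
        this into the conjugate of the reproducing integral at z.\<close>
      have "(LINT w|N. H (w, z) * of_real (L1 z)) = (LINT w|N. cnj (kernel_e \<mu> w z * f w) * (f z * of_real (L1 z)))"
        by (simp add: H_def kernel_e_cnj mult_ac)
      also have "\<dots> = cnj (K_e \<mu> f z) * (f z * of_real (L1 z))"
        unfolding K_e_def by (simp del: complex_cnj_mult)
      also have "\<dots> = f z * cnj (f z) * of_real (L1 z)" by (simp add: repr)
      finally show "(LINT w|N. H (w, z) * of_real (L1 z)) = of_real (nsq (f z) * L1 z)"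
        by (simp only: of_real_mult complex_norm_square)
    qed
    finally show ?thesis by (simp only: integral_complex_of_real)
  qed
  have I2: "(LINT x|(N \<Otimes>\<^sub>M N). H x * of_real (L2 (fst x))) = of_real (LINT z|N. nsq (f z) * L2 z)"
  proof -
    have "(LINT x|(N \<Otimes>\<^sub>M N). H x * of_real (L2 (fst x))) = (LINT w|N. LINT z|N. H (w, z) * of_real (L2 w))"
      using P.integral_fst'[OF iL2] by simp
    also have "\<dots> = (LINT z|N. of_real (nsq (f z) * L2 z))"
    proof (intro integral_cong refl)
      fix w
      have "(LINT z|N. H (w, z) * of_real (L2 w)) = (LINT z|N. kernel_e \<mu> z w * f z * (cnj (f w) * of_real (L2 w)))"
        by (simp add: H_def mult_ac)
      also have "\<dots> = K_e \<mu> f w * (cnj (f w) * of_real (L2 w))" unfolding K_e_def by simp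
      also have "\<dots> = f w * cnj (f w) * of_real (L2 w)" by (simp add: repr)
      finally show "(LINT z|N. H (w, z) * of_real (L2 w)) = of_real (nsq (f w) * L2 w)"
        by (simp only: of_real_mult complex_norm_square)
    qed
    finally show ?thesis by (simp only: integral_complex_of_real)
  qed
  have li: "integrable N (\<lambda>z. nsq (f z) * ln (nsq (f z)))" (is "integrable N ?l")
    by (rule slow_growth_xlnx_integrable[OF f])
  have zi: "integrable N (\<lambda>z. nsq z * nsq (f z))"
  proof (rule Gi)
    fix z
    have "nsq z * nsq (f z) \<le> nsq z * (1 + nsq (f z))" by (intro mult_left_mono) auto
    then show "\<bar>nsq z * nsq (f z)\<bar> \<le> G z" using G2[of z] by (simp add: abs_mult)
  qed measurable
  \<comment> \<open>Because of this factor 2, the coefficients 2/p - 1 and 1 - 2/q enter halved and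
    add up to 1/p - 1/q. The convention ln 0 = 0 keeps the identity valid at zeros.\<close>
  have lnsq: "ln (nsq (f z)) = 2 * ln (norm (f z))" for z
    by (cases "f z = 0") (auto simp: ln_realpow)
  have e1: "(LINT z|N. nsq (f z) * L1 z) = (\<rho> - 1/2) * (LINT z|N. ?l z)"
  proof -
    have "(LINT z|N. nsq (f z) * L1 z) = (LINT z|N. (\<rho> - 1/2) * ?l z)"
      by (intro integral_cong refl) (simp add: L1_def lnsq algebra_simps)
    then show ?thesis by simp
  qed
  have e2: "(LINT z|N. nsq (f z) * L2 z) = (1/2 - 1 / q) * (LINT z|N. ?l z) - a / q * (LINT z|N. nsq z * nsq (f z))"
  proof -
    have "(LINT z|N. nsq (f z) * L2 z) = (LINT z|N. (1/2 - 1 / q) * ?l z - a / q * (nsq z * nsq (f z)))"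
      by (intro integral_cong refl) (simp add: L2_def lnsq algebra_simps)
    then show ?thesis using li zi by (simp add: integral_diff)
  qed
  have "Re (LINT x|(N \<Otimes>\<^sub>M N). H x * of_real (L1 (snd x) + L2 (fst x)))
     = (\<rho> - 1 / q) * (LINT z|N. ?l z) - a / q * (LINT z|N. nsq z * nsq (f z))"
  proof -
    have "(LINT x|(N \<Otimes>\<^sub>M N). H x * of_real (L1 (snd x) + L2 (fst x)))
      = (LINT x|(N \<Otimes>\<^sub>M N). H x * of_real (L1 (snd x))) + (LINT x|(N \<Otimes>\<^sub>M N). H x * of_real (L2 (fst x)))"
      by (simp only: of_real_add distrib_left integral_add[OF iL1 iL2])
    then have "Re (LINT x|(N \<Otimes>\<^sub>M N). H x * of_real (L1 (snd x) + L2 (fst x)))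
      = (LINT z|N. nsq (f z) * L1 z) + (LINT z|N. nsq (f z) * L2 z)"
      unfolding I1 I2 by (simp only: plus_complex.sel Re_complex_of_real)
    then show ?thesis unfolding e1 e2 by (simp add: algebra_simps)
  qed
  moreover have "ln (M1 / n2) = ln A + (\<rho> - 1 / q) * ln n2"
  proof -
    have "ln (M1 / n2) = ln A + \<rho> * ln n2 + (1 - 1 / q) * ln n2 - ln n2"
      using A_e_pos n2 by (simp add: M1_def ln_div ln_mult ln_powr)
    then show ?thesis by (simp add: algebra_simps)
  qed
  ultimately show ?thesis using main by (simp add: \<rho>_def n2_def)
qed

end

section \<open>Fejer means\<close>

lemma cesaro_tendsto_zero:
  fixes X :: "nat \<Rightarrow> 'a::real_normed_vector"
  assumes "X \<longlonglongrightarrow> 0"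
  shows "(\<lambda>n. (\<Sum>l<n. X l) /\<^sub>R real n) \<longlonglongrightarrow> 0"
proof (rule LIMSEQ_I)
  fix r :: real assume r: "0 < r"
  obtain n0 where n0: "\<And>l. l \<ge> n0 \<Longrightarrow> norm (X l) < r / 2"
    using LIMSEQ_D[OF assms, of "r / 2"] r by auto
  define S where "S = (\<Sum>l<n0. norm (X l))"
  have S: "S \<ge> 0" unfolding S_def by (intro sum_nonneg) simp
  obtain n1 :: nat where n1: "real n1 > 2 * S / r" using reals_Archimedean2 by blast
  show "\<exists>no. \<forall>n\<ge>no. norm ((\<Sum>l<n. X l) /\<^sub>R real n - 0) < r"
  proof (intro exI allI impI)
    fix n assume n: "n \<ge> max (Suc n0) n1"
    have npos: "real n > 0" using n by simp
    have "{..<n} = {..<n0} \<union> {n0..<n}" using n by auto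
    then have "(\<Sum>l<n. norm (X l)) = S + (\<Sum>l\<in>{n0..<n}. norm (X l))"
      by (simp add: S_def sum.union_disjoint ivl_disj_int)
    also have "(\<Sum>l\<in>{n0..<n}. norm (X l)) \<le> (\<Sum>l\<in>{n0..<n}. r / 2)" using n0 by (intro sum_mono) (auto intro: less_imp_le)
    also have "\<dots> \<le> real n * (r / 2)" using r n by (simp add: mult_right_mono)
    finally have "norm (\<Sum>l<n. X l) \<le> S + real n * (r / 2)" using norm_sum order_trans by fastforce
    also have "S < real n * (r / 2)"
    proof -
      have "2 * S / r < real n" using n1 n by linarith
      then show ?thesis using r by (simp add: field_simps)
    qed
    finally have "norm (\<Sum>l<n. X l) < real n * r" by (simp add: mult.commute)
    then show "norm ((\<Sum>l<n. X l) /\<^sub>R real n - 0) < r" using npos by (simp add: field_simps)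
  qed
qed

definition fejer_mean :: "(nat \<Rightarrow> complex) \<Rightarrow> nat \<Rightarrow> complex \<Rightarrow> complex" where
  "fejer_mean c n z = (\<Sum>l<n. \<Sum>k\<le>l. c k * z ^ k) / of_nat n"

lemma fejer_mean_tendsto:
  assumes "(\<lambda>k. c k * z ^ k) sums s"
  shows "(\<lambda>n. fejer_mean c n z) \<longlonglongrightarrow> s"
proof -
  let ?X = "\<lambda>l. (\<Sum>k\<le>l. c k * z ^ k) - s"
  have "?X \<longlonglongrightarrow> 0" using assms by (simp add: sums_def_le LIM_zero_iff)
  then have "(\<lambda>n. (\<Sum>l<n. ?X l) /\<^sub>R real n) \<longlonglongrightarrow> 0" by (rule cesaro_tendsto_zero)
  moreover have "\<forall>\<^sub>F n in sequentially. (\<Sum>l<n. ?X l) /\<^sub>R real n = fejer_mean c n z - s"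
    using eventually_gt_at_top[of 0]
    by eventually_elim (simp add: fejer_mean_def sum_subtractf scaleR_conv_of_real field_simps)
  ultimately have "(\<lambda>n. fejer_mean c n z - s) \<longlonglongrightarrow> 0" by (simp add: tendsto_cong)
  then show ?thesis by (simp add: LIM_zero_iff)
qed

text \<open>Expanding the square gives the sum over |j| < n of (1 - |j| / n) exp (2 \<pi> i j t).
  The squared form shows positivity, on which the convexity argument rests.\<close>

definition fejer_kernel :: "nat \<Rightarrow> real \<Rightarrow> real" where
  "fejer_kernel n t = nsq (\<Sum>k<n. rot t ^ k) / real n"

lemma fejer_kernel_nonneg: "fejer_kernel n t \<ge> 0"
  by (simp add: fejer_kernel_def)

lemma fejer_kernel_measurable [measurable]: "fejer_kernel n \<in> borel_measurable borel"
  unfolding fejer_kernel_def[abs_def] by measurable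

lemma fejer_kernel_le: "fejer_kernel n t \<le> real n"
proof -
  have "norm (\<Sum>k<n. rot t ^ k) \<le> real n"
    by (rule order_trans[OF norm_sum]) (simp add: norm_power)
  then have "nsq (\<Sum>k<n. rot t ^ k) \<le> (real n)\<^sup>2" by (intro power_mono) auto
  then show ?thesis by (cases "n = 0") (auto simp: fejer_kernel_def divide_le_eq power2_eq_square)
qed

lemma even_entire_circle_bounded:
  assumes "f \<in> even_entire"
  obtains B where "\<And>t. norm (f (rot t * z)) \<le> B"
proof -
  have "continuous_on (cball 0 (norm z)) f"
    using assms by (auto simp: even_entire_def intro: holomorphic_on_imp_continuous_on holomorphic_on_subset)
  then have "bounded (f ` cball 0 (norm z))" by (intro compact_imp_bounded compact_continuous_image) auto
  then obtain B where B: "\<forall>x\<in>cball 0 (norm z). norm (f x) \<le> B" unfolding bounded_iff by blast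
  show ?thesis by (rule that[of B], rule B[rule_format]) (simp add: norm_mult)
qed

text \<open>The squared modulus is a double sum over l and j; the term (l, j) extracts the Taylor
  term of order l - j, or nothing if j > l. Summing over j for fixed l gives the partial sum of
  degree l.\<close>

lemma integral_fejer_kernel:
  assumes f: "\<And>z. (\<lambda>k. c k * z ^ k) sums f z" and fe: "f \<in> even_entire"
  shows "(LINT t|circ. of_real (fejer_kernel n t) * f (rot t * z)) = fejer_mean c n z"
proof -
  obtain B where B: "\<And>t. norm (f (rot t * z)) \<le> B" using even_entire_circle_bounded[OF fe] by blast
  have [measurable]: "f \<in> borel_measurable borel" by (rule even_entire_measurable[OF fe])
  have shift: "(LINT t|circ. cnj (rot t) ^ l * (rot t ^ j * f (rot t * z))) = (if j \<le> l then c (l - j) * z ^ (l - j) else 0)" for j l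
  proof -
    \<comment> \<open>Multiplication by \<xi>^j shifts the coefficients by j, so Cauchy's formula
      applies in the variable \<xi> at the point 1.\<close>
    define c' where "c' k = (if j \<le> k then c (k - j) * z ^ (k - j) else 0)" for k
    have "(\<lambda>k. c' k * \<xi> ^ k) sums (\<xi> ^ j * f (\<xi> * z))" for \<xi>
    proof -
      have "(\<lambda>k. \<xi> ^ j * (c k * (\<xi> * z) ^ k)) sums (\<xi> ^ j * f (\<xi> * z))" by (intro sums_mult f)
      then have "(\<lambda>k. c' (k + j) * \<xi> ^ (k + j)) sums (\<xi> ^ j * f (\<xi> * z))"
        by (simp add: c'_def power_mult_distrib power_add mult_ac)
      moreover have "(\<Sum>k<j. c' k * \<xi> ^ k) = 0" by (intro sum.neutral) (simp add: c'_def)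
      ultimately show ?thesis using sums_iff_shift[of "\<lambda>k. c' k * \<xi> ^ k" j "\<xi> ^ j * f (\<xi> * z)"] by simp
    qed
    from integral_circ_power_series[of c' "\<lambda>\<xi>. \<xi> ^ j * f (\<xi> * z)", OF this, of l 1]
    show ?thesis by (simp add: c'_def)
  qed
  have i: "integrable circ (\<lambda>t. cnj (rot t) ^ l * (rot t ^ j * f (rot t * z)) / of_nat n)" for j l
    by (intro integrable_divide, rule circ.integrable_const_bound[of _ B]) (auto simp: norm_mult norm_power B)
  have e: "of_real (fejer_kernel n t) * f (rot t * z) = (\<Sum>l<n. \<Sum>j<n. cnj (rot t) ^ l * (rot t ^ j * f (rot t * z)) / of_nat n)" for t
  proof -
    have "of_real (fejer_kernel n t) = cnj (\<Sum>k<n. rot t ^ k) * (\<Sum>k<n. rot t ^ k) / complex_of_real (real n)"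
      unfolding fejer_kernel_def of_real_divide complex_norm_square by (simp add: mult.commute)
    also have "cnj (\<Sum>k<n. rot t ^ k) * (\<Sum>k<n. rot t ^ k) = (\<Sum>l<n. \<Sum>j<n. cnj (rot t) ^ l * rot t ^ j)"
      by (simp add: sum_product)
    finally show ?thesis by (simp add: sum_distrib_right sum_divide_distrib mult.assoc)
  qed
  have "(LINT t|circ. of_real (fejer_kernel n t) * f (rot t * z))
     = (\<Sum>l<n. \<Sum>j<n. (if j \<le> l then c (l - j) * z ^ (l - j) else 0) / of_nat n)"
  proof -
    have ij: "(LINT t|circ. cnj (rot t) ^ l * (rot t ^ j * f (rot t * z)) / of_nat n)
        = (if j \<le> l then c (l - j) * z ^ (l - j) else 0) / of_nat n" for j l
      using shift[of l j] by (simp only: integral_divide_zero)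
    show ?thesis
      unfolding e
      by (subst integral_sum, intro integrable_sum i,
          intro sum.cong refl, subst integral_sum, rule i) (simp only: ij)
  qed
  also have "\<dots> = (\<Sum>l<n. \<Sum>k\<le>l. c k * z ^ k) / of_nat n"
    unfolding sum_divide_distrib
  proof (rule sum.cong[OF refl])
    fix l assume l: "l \<in> {..<n}"
    have "(\<Sum>j<n. (if j \<le> l then c (l - j) * z ^ (l - j) else 0) / of_nat n)
       = (\<Sum>j<Suc l. c (Suc l - Suc j) * z ^ (Suc l - Suc j) / of_nat n)"
      using l by (intro sum.mono_neutral_cong_right) auto
    also have "\<dots> = (\<Sum>k<Suc l. c k * z ^ k / of_nat n)"
      by (rule sum.nat_diff_reindex)
    finally show "(\<Sum>j<n. (if j \<le> l then c (l - j) * z ^ (l - j) else 0) / of_nat n) = (\<Sum>k\<le>l. c k * z ^ k / of_nat n)"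
      by (simp add: lessThan_Suc_atMost)
  qed
  finally show ?thesis by (simp add: fejer_mean_def)
qed

text \<open>Its total mass is the Fejer mean of the constant function 1, all of whose partial sums
  are 1.\<close>

lemma fejer_kernel_prob:
  assumes "n > 0"
  shows "integrable circ (fejer_kernel n)" "(LINT t|circ. fejer_kernel n t) = 1"
proof -
  show "integrable circ (fejer_kernel n)"
    by (rule circ.integrable_const_bound[of _ "real n"]) (auto simp: fejer_kernel_nonneg fejer_kernel_le)
  define c where "c k = (if k = 0 then 1 else 0 :: complex)" for k :: nat
  have s: "(\<lambda>k. c k * z ^ k) sums 1" for z
  proof -
    have "c k * z ^ k = (if k = 0 then 1 else 0)" for k by (simp add: c_def)
    then show ?thesis using sums_single[of 0 "\<lambda>k. 1::complex"] by simp
  qed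
  have "complex_of_real (LINT t|circ. fejer_kernel n t) = (LINT t|circ. of_real (fejer_kernel n t) * 1)"
    by simp
  also have "\<dots> = fejer_mean c n 1"
    using integral_fejer_kernel[of c "\<lambda>z. 1" n 1] s by (simp add: even_entire_def)
  also have "\<dots> = 1"
  proof -
    have "(\<Sum>k\<le>l. c k * 1 ^ k) = 1" for l by (simp add: c_def sum.delta)
    then show ?thesis using assms by (simp add: fejer_mean_def)
  qed
  finally show "(LINT t|circ. fejer_kernel n t) = 1" by (simp only: of_real_eq_1_iff)
qed

lemma ennreal_integral_le_nn_integral:
  assumes "integrable M (g :: _ \<Rightarrow> real)"
  shows "ennreal (integral\<^sup>L M g) \<le> (\<integral>\<^sup>+x. ennreal (g x) \<partial>M)"
proof -
  have "ennreal (integral\<^sup>L M g) \<le> ennreal (LINT x|M. max 0 (g x))"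
    using assms by (intro ennreal_leI integral_mono) auto
  also have "\<dots> = (\<integral>\<^sup>+x. ennreal (max 0 (g x)) \<partial>M)"
    using assms by (intro nn_integral_eq_integral[symmetric]) auto
  also have "\<dots> = (\<integral>\<^sup>+x. ennreal (g x) \<partial>M)"
    by (intro nn_integral_cong) (metis ennreal_neg max.commute max.orderE max_def nle_le)
  finally show ?thesis .
qed

text \<open>Fejer means are averages of rotations with a positive kernel, so increasing convex functions
  (given by their supporting lines) of \<open>\<bar>f\<bar>\<^sup>2\<close> decrease in mean.\<close>

lemma fejer_mean_convex:
  assumes f: "\<And>z. (\<lambda>k. c k * z ^ k) sums f z" and fe: "f \<in> even_entire" and n: "n > 0"
    and [measurable]: "\<Psi> \<in> borel_measurable borel"
    and \<Psi>: "\<And>x. x \<ge> 0 \<Longrightarrow> \<exists>\<alpha>\<ge>0. \<exists>\<beta>. \<Psi> x = \<alpha> * x + \<beta> \<and> (\<forall>y\<ge>0. \<alpha> * y + \<beta> \<le> \<Psi> y)"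
  shows "ennreal (\<Psi> (nsq (fejer_mean c n z)))
     \<le> (\<integral>\<^sup>+t. ennreal (fejer_kernel n t) * ennreal (\<Psi> (nsq (f (rot t * z)))) \<partial>circ)"
proof -
  let ?s = "fejer_mean c n z" and ?F = "fejer_kernel n"
  obtain B where B: "\<And>t. norm (f (rot t * z)) \<le> B" using even_entire_circle_bounded[OF fe] by blast
  have B0: "B \<ge> 0" using B norm_ge_zero order_trans by blast
  have fm[measurable]: "f \<in> borel_measurable borel" by (rule even_entire_measurable[OF fe])
  have i2: "integrable circ (\<lambda>t. ?F t * nsq (f (rot t * z)))"
  proof (rule circ.integrable_const_bound[of _ "real n * B\<^sup>2"])
    show "AE t in circ. norm (?F t * nsq (f (rot t * z))) \<le> real n * B\<^sup>2"
      using B B0 fejer_kernel_le fejer_kernel_nonneg by (intro AE_I2) (auto simp: abs_mult intro!: mult_mono power_mono)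
  qed measurable
  have i1: "integrable circ (\<lambda>t. of_real (?F t) * f (rot t * z))"
  proof (rule circ.integrable_const_bound[of _ "real n * B"])
    show "AE t in circ. norm (of_real (?F t) * f (rot t * z)) \<le> real n * B"
      using B B0 fejer_kernel_le fejer_kernel_nonneg by (intro AE_I2) (auto simp: norm_mult intro!: mult_mono)
  qed measurable
  have j1: "integrable circ (\<lambda>t. 2 * Re (cnj ?s * (of_real (?F t) * f (rot t * z))))"
    by (rule integrable_mult_right[OF integrable_Re[OF integrable_mult_right[OF i1]]])
  have j0: "integrable circ (\<lambda>t. ?F t * nsq ?s)"
    by (rule integrable_mult_left[OF fejer_kernel_prob(1)[OF n]])
  have sq: "nsq ?s \<le> (LINT t|circ. ?F t * nsq (f (rot t * z)))"
  proof -
    \<comment> \<open>A variance: s is the mean of f over the rotations with respect to the kernel,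
      so expanding the square shows that |s|^2 is at most the mean of |f|^2.\<close>
    have "0 \<le> (LINT t|circ. ?F t * nsq (f (rot t * z) - ?s))"
      by (intro integral_nonneg_AE AE_I2) (simp add: fejer_kernel_nonneg)
    also have "\<dots> = (LINT t|circ. ?F t * nsq (f (rot t * z)) - 2 * Re (cnj ?s * (of_real (?F t) * f (rot t * z))) + ?F t * nsq ?s)"
    proof (intro integral_cong refl)
      fix t
      have "nsq (x - y) = nsq x - 2 * Re (cnj y * x) + nsq y" for x y :: complex
        unfolding cmod_power2 by (simp add: power2_eq_square algebra_simps)
      then have "?F t * nsq (f (rot t * z) - ?s) = ?F t * (nsq (f (rot t * z)) - 2 * Re (cnj ?s * f (rot t * z)) + nsq ?s)" by simp
      also have "Re (cnj ?s * (of_real (?F t) * f (rot t * z))) = ?F t * Re (cnj ?s * f (rot t * z))"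
      proof -
        have "Re (of_real r * x) = r * Re x" for r x by simp
        then show ?thesis by (subst mult.left_commute)
      qed
      then have "?F t * (nsq (f (rot t * z)) - 2 * Re (cnj ?s * f (rot t * z)) + nsq ?s)
         = ?F t * nsq (f (rot t * z)) - 2 * Re (cnj ?s * (of_real (?F t) * f (rot t * z))) + ?F t * nsq ?s"
        by (simp add: algebra_simps)
      finally show "?F t * nsq (f (rot t * z) - ?s)
         = ?F t * nsq (f (rot t * z)) - 2 * Re (cnj ?s * (of_real (?F t) * f (rot t * z))) + ?F t * nsq ?s" .
    qed
    also have "\<dots> = (LINT t|circ. ?F t * nsq (f (rot t * z)))
        - (LINT t|circ. 2 * Re (cnj ?s * (of_real (?F t) * f (rot t * z)))) + (LINT t|circ. ?F t * nsq ?s)"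
      by (simp only: integral_add[OF integrable_diff[OF i2 j1] j0]
          integral_diff[OF i2 j1])
    also have "(LINT t|circ. 2 * Re (cnj ?s * (of_real (?F t) * f (rot t * z)))) = 2 * Re (cnj ?s * ?s)"
    proof -
      have "(LINT t|circ. Re (cnj ?s * (of_real (?F t) * f (rot t * z)))) = Re (LINT t|circ. cnj ?s * (of_real (?F t) * f (rot t * z)))"
        using integral_Re[OF integrable_mult_right[OF i1, of "cnj ?s"]] .
      also have "(LINT t|circ. cnj ?s * (of_real (?F t) * f (rot t * z))) = cnj ?s * ?s"
        using integral_fejer_kernel[OF f fe, of n z] by simp
      finally show ?thesis by (simp only: integral_mult_right_zero)
    qed
    also have "(LINT t|circ. ?F t * nsq ?s) = nsq ?s" using fejer_kernel_prob(2)[OF n] by simp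
    also have "Re (cnj ?s * ?s) = nsq ?s" unfolding cmod_power2 by (simp add: power2_eq_square)
    finally show ?thesis by simp
  qed
  \<comment> \<open>The supporting line at |s|^2; its slope being nonnegative, |s|^2 may be replaced
    by the larger mean of |f|^2.\<close>
  obtain \<alpha> \<beta> where ab: "\<alpha> \<ge> 0" "\<Psi> (nsq ?s) = \<alpha> * nsq ?s + \<beta>" "\<And>y. y \<ge> 0 \<Longrightarrow> \<alpha> * y + \<beta> \<le> \<Psi> y"
    using \<Psi>[of "nsq ?s"] by auto
  have "\<Psi> (nsq ?s) \<le> \<alpha> * (LINT t|circ. ?F t * nsq (f (rot t * z))) + \<beta>"
    unfolding ab(2) using ab(1) sq by (intro add_mono mult_left_mono) auto
  also have "\<dots> = (LINT t|circ. \<alpha> * (?F t * nsq (f (rot t * z))) + \<beta> * ?F t)"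
    using i2 fejer_kernel_prob[OF n] by simp
  finally have "ennreal (\<Psi> (nsq ?s)) \<le> ennreal (LINT t|circ. \<alpha> * (?F t * nsq (f (rot t * z))) + \<beta> * ?F t)"
    by (rule ennreal_leI)
  also have "\<dots> \<le> (\<integral>\<^sup>+t. ennreal (\<alpha> * (?F t * nsq (f (rot t * z))) + \<beta> * ?F t) \<partial>circ)"
    using i2 fejer_kernel_prob(1)[OF n] by (intro ennreal_integral_le_nn_integral) auto
  also have "\<dots> \<le> (\<integral>\<^sup>+t. ennreal (?F t) * ennreal (\<Psi> (nsq (f (rot t * z)))) \<partial>circ)"
  proof (intro nn_integral_mono)
    fix t
    have "\<alpha> * (?F t * nsq (f (rot t * z))) + \<beta> * ?F t = ?F t * (\<alpha> * nsq (f (rot t * z)) + \<beta>)"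
      by (simp add: algebra_simps)
    also have "\<dots> \<le> ?F t * \<Psi> (nsq (f (rot t * z)))" by (intro mult_left_mono ab(3) fejer_kernel_nonneg) simp
    finally show "ennreal (\<alpha> * (?F t * nsq (f (rot t * z))) + \<beta> * ?F t) \<le> ennreal (?F t) * ennreal (\<Psi> (nsq (f (rot t * z))))"
      by (subst ennreal_mult'[symmetric]) (auto simp: fejer_kernel_nonneg intro: ennreal_leI)
  qed
  finally show ?thesis .
qed

text \<open>Fatou's lemma gives the lower bound and the hypothesis the upper one; the limit may be
  infinite.\<close>

lemma nn_integral_tendsto_dominated_mean:
  fixes u :: "nat \<Rightarrow> 'a \<Rightarrow> ennreal"
  assumes [measurable]: "\<And>n. u n \<in> borel_measurable M"
    and lim: "\<And>x. (\<lambda>n. u n x) \<longlonglongrightarrow> v x"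
    and le: "\<And>n. (\<integral>\<^sup>+x. u n x \<partial>M) \<le> (\<integral>\<^sup>+x. v x \<partial>M)"
  shows "(\<lambda>n. \<integral>\<^sup>+x. u n x \<partial>M) \<longlonglongrightarrow> (\<integral>\<^sup>+x. v x \<partial>M)"
proof (rule order_tendstoI)
  have "(\<integral>\<^sup>+x. v x \<partial>M) = (\<integral>\<^sup>+x. liminf (\<lambda>n. u n x) \<partial>M)"
    using lim by (intro nn_integral_cong) (metis lim_imp_Liminf trivial_limit_sequentially)
  also have "\<dots> \<le> liminf (\<lambda>n. \<integral>\<^sup>+x. u n x \<partial>M)" by (rule nn_integral_liminf) measurable
  finally have *: "(\<integral>\<^sup>+x. v x \<partial>M) \<le> liminf (\<lambda>n. \<integral>\<^sup>+x. u n x \<partial>M)" .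
  fix y assume "y < (\<integral>\<^sup>+x. v x \<partial>M)"
  with * have "y < liminf (\<lambda>n. \<integral>\<^sup>+x. u n x \<partial>M)" by simp
  then show "\<forall>\<^sub>F n in sequentially. y < (\<integral>\<^sup>+x. u n x \<partial>M)" by (rule less_LiminfD)
next
  fix y assume "(\<integral>\<^sup>+x. v x \<partial>M) < y"
  then show "\<forall>\<^sub>F n in sequentially. (\<integral>\<^sup>+x. u n x \<partial>M) < y" using le by (auto intro: always_eventually le_less_trans)
qed

context deformed_bargmann
begin

text \<open>After Tonelli the inner integral over the plane does not depend on the angle, as the
  weight is radial, and the kernel integrates to 1. The weight is 1 for norm and entropy and |z|^2
  for the energy.\<close>

lemma nn_integral_fejer_mean_le:
  assumes f: "\<And>z. (\<lambda>k. c k * z ^ k) sums f z" and fe: "f \<in> even_entire" and n: "n > 0"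
    and \<Psi>m[measurable]: "\<Psi> \<in> borel_measurable borel" and [measurable]: "w \<in> borel_measurable borel"
    and \<Psi>: "\<And>x. x \<ge> 0 \<Longrightarrow> \<exists>\<alpha>\<ge>0. \<exists>\<beta>. \<Psi> x = \<alpha> * x + \<beta> \<and> (\<forall>y\<ge>0. \<alpha> * y + \<beta> \<le> \<Psi> y)"
  shows "(\<integral>\<^sup>+z. ennreal (w (norm z)) * ennreal (\<Psi> (nsq (fejer_mean c n z))) \<partial>N)
     \<le> (\<integral>\<^sup>+z. ennreal (w (norm z)) * ennreal (\<Psi> (nsq (f z))) \<partial>N)"
proof -
  interpret P: pair_sigma_finite circ N ..
  have fm[measurable]: "f \<in> borel_measurable borel" by (rule even_entire_measurable[OF fe])
  let ?J = "\<integral>\<^sup>+z. ennreal (w (norm z)) * ennreal (\<Psi> (nsq (f z))) \<partial>N"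
  have "(\<integral>\<^sup>+z. ennreal (w (norm z)) * ennreal (\<Psi> (nsq (fejer_mean c n z))) \<partial>N)
     \<le> (\<integral>\<^sup>+z. ennreal (w (norm z)) * (\<integral>\<^sup>+t. ennreal (fejer_kernel n t) * ennreal (\<Psi> (nsq (f (rot t * z)))) \<partial>circ) \<partial>N)"
    by (intro nn_integral_mono mult_left_mono fejer_mean_convex[OF f fe n \<Psi>m \<Psi>]) auto
  also have "\<dots> = (\<integral>\<^sup>+z. \<integral>\<^sup>+t. ennreal (w (norm z)) * (ennreal (fejer_kernel n t) * ennreal (\<Psi> (nsq (f (rot t * z))))) \<partial>circ \<partial>N)"
    by (intro nn_integral_cong nn_integral_cmult[symmetric]) measurable
  also have "\<dots> = (\<integral>\<^sup>+t. \<integral>\<^sup>+z. ennreal (w (norm z)) * (ennreal (fejer_kernel n t) * ennreal (\<Psi> (nsq (f (rot t * z))))) \<partial>N \<partial>circ)"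
    by (rule P.Fubini') measurable
  also have "\<dots> = (\<integral>\<^sup>+t. ennreal (fejer_kernel n t) * ?J \<partial>circ)"
  proof (intro nn_integral_cong)
    fix t
    have "(\<integral>\<^sup>+z. ennreal (w (norm z)) * (ennreal (fejer_kernel n t) * ennreal (\<Psi> (nsq (f (rot t * z))))) \<partial>N)
       = (\<integral>\<^sup>+z. ennreal (fejer_kernel n t) * (ennreal (w (norm (rot t * z))) * ennreal (\<Psi> (nsq (f (rot t * z))))) \<partial>N)"
      by (simp add: norm_mult mult_ac)
    also have "\<dots> = ennreal (fejer_kernel n t) * (\<integral>\<^sup>+z. ennreal (w (norm (rot t * z))) * ennreal (\<Psi> (nsq (f (rot t * z)))) \<partial>N)"
      by (rule nn_integral_cmult) measurable
    also have "(\<integral>\<^sup>+z. ennreal (w (norm (rot t * z))) * ennreal (\<Psi> (nsq (f (rot t * z)))) \<partial>N) = ?J"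
      using nn_integral_rotate_N[of "\<lambda>z. ennreal (w (norm z)) * ennreal (\<Psi> (nsq (f z)))" "rot t"] by simp
    finally show "(\<integral>\<^sup>+z. ennreal (w (norm z)) * (ennreal (fejer_kernel n t) * ennreal (\<Psi> (nsq (f (rot t * z))))) \<partial>N)
       = ennreal (fejer_kernel n t) * ?J" .
  qed
  also have "\<dots> = (\<integral>\<^sup>+t. ennreal (fejer_kernel n t) \<partial>circ) * ?J" by (rule nn_integral_multc) measurable
  also have "(\<integral>\<^sup>+t. ennreal (fejer_kernel n t) \<partial>circ) = 1"
    using fejer_kernel_prob[OF n] by (subst nn_integral_eq_integral) (auto simp: fejer_kernel_nonneg)
  finally show ?thesis by simp
qed

lemma fejer_mean_measurable [measurable]: "fejer_mean c n \<in> borel_measurable borel"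
  unfolding fejer_mean_def[abs_def] by measurable

text \<open>The index is \<open>Suc n\<close> because the kernel of index 0 is 0 and has no
  mass.\<close>

lemma nn_integral_fejer_mean_tendsto:
  assumes f: "\<And>z. (\<lambda>k. c k * z ^ k) sums f z" and fe: "f \<in> even_entire"
    and \<Psi>m[measurable]: "\<Psi> \<in> borel_measurable borel" and w[measurable]: "w \<in> borel_measurable borel"
    and \<Psi>: "\<And>x. x \<ge> 0 \<Longrightarrow> \<exists>\<alpha>\<ge>0. \<exists>\<beta>. \<Psi> x = \<alpha> * x + \<beta> \<and> (\<forall>y\<ge>0. \<alpha> * y + \<beta> \<le> \<Psi> y)"
    and \<Psi>c: "continuous_on {0..} \<Psi>"
  shows "(\<lambda>n. \<integral>\<^sup>+z. ennreal (w (norm z)) * ennreal (\<Psi> (nsq (fejer_mean c (Suc n) z))) \<partial>N)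
     \<longlonglongrightarrow> (\<integral>\<^sup>+z. ennreal (w (norm z)) * ennreal (\<Psi> (nsq (f z))) \<partial>N)"
proof (rule nn_integral_tendsto_dominated_mean)
  fix z
  have "(\<lambda>n. nsq (fejer_mean c (Suc n) z)) \<longlonglongrightarrow> nsq (f z)"
    by (intro tendsto_intros LIMSEQ_Suc[OF fejer_mean_tendsto[OF f]])
  then have "(\<lambda>n. \<Psi> (nsq (fejer_mean c (Suc n) z))) \<longlonglongrightarrow> \<Psi> (nsq (f z))"
    by (rule continuous_on_tendsto_compose[OF \<Psi>c]) auto
  then show "(\<lambda>n. ennreal (w (norm z)) * ennreal (\<Psi> (nsq (fejer_mean c (Suc n) z)))) \<longlonglongrightarrow> ennreal (w (norm z)) * ennreal (\<Psi> (nsq (f z)))"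
    by (intro ennreal_tendsto_cmult tendsto_ennrealI) auto
next
  show "(\<integral>\<^sup>+z. ennreal (w (norm z)) * ennreal (\<Psi> (nsq (fejer_mean c (Suc n) z))) \<partial>N)
     \<le> (\<integral>\<^sup>+z. ennreal (w (norm z)) * ennreal (\<Psi> (nsq (f z))) \<partial>N)" for n
    by (rule nn_integral_fejer_mean_le[OF f fe _ \<Psi>m w \<Psi>]) auto
qed measurable

lemma fejer_mean_poly:
  obtains d where "\<And>z. fejer_mean c n z = (\<Sum>k<n. d k * z ^ k)" "\<And>k. c k = 0 \<Longrightarrow> d k = 0"
proof -
  \<comment> \<open>The cardinality is n - k for k < n, so this is the usual weight 1 - k / n in the
    form in which the exchange of sums delivers it.\<close>
  define d where "d k = (of_nat (card {l. l < n \<and> k \<le> l})) * c k / of_nat n" for k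
  have "fejer_mean c n z = (\<Sum>k<n. d k * z ^ k)" for z
  proof -
    have "(\<Sum>l<n. \<Sum>k\<le>l. c k * z ^ k) = (\<Sum>l<n. \<Sum>k<n. if k \<le> l then c k * z ^ k else 0)"
      by (intro sum.cong refl sum.mono_neutral_cong_left) auto
    also have "\<dots> = (\<Sum>k<n. \<Sum>l<n. if k \<le> l then c k * z ^ k else 0)" by (rule sum.swap)
    also have "\<dots> = (\<Sum>k<n. of_nat (card {l. l < n \<and> k \<le> l}) * (c k * z ^ k))"
    proof (intro sum.cong refl)
      fix k
      have "(\<Sum>l<n. if k \<le> l then c k * z ^ k else 0) = (\<Sum>l\<in>{l. l < n \<and> k \<le> l}. c k * z ^ k)"
        by (intro sum.mono_neutral_cong_right) auto
      then show "(\<Sum>l<n. if k \<le> l then c k * z ^ k else 0) = of_nat (card {l. l < n \<and> k \<le> l}) * (c k * z ^ k)" by simp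
    qed
    finally show ?thesis by (simp add: fejer_mean_def d_def sum_divide_distrib mult_ac)
  qed
  then show ?thesis by (rule that[of d]) (simp add: d_def)
qed

lemma fejer_mean_slow_growth:
  assumes odd: "\<And>k. odd k \<Longrightarrow> c k = 0"
  shows "slow_growth (fejer_mean c n)"
proof -
  obtain d where d: "\<And>z. fejer_mean c n z = (\<Sum>k<n. d k * z ^ k)" "\<And>k. c k = 0 \<Longrightarrow> d k = 0"
    using fejer_mean_poly by blast
  obtain D where D: "D \<ge> 0" "\<And>z. norm (\<Sum>k<n. d k * z ^ k) \<le> D * exp (norm z)" using norm_poly_le_exp by blast
  have eq: "fejer_mean c n = (\<lambda>z. \<Sum>k<n. d k * z ^ k)" using d(1) by blast
  have "fejer_mean c n \<in> even_entire"
    unfolding even_entire_def mem_Collect_eq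
  proof (intro conjI allI)
    show "fejer_mean c n holomorphic_on UNIV" unfolding eq by (intro holomorphic_intros)
    fix z
    have e: "d k * (- z) ^ k = d k * z ^ k" for k by (cases "even k") (auto simp: d(2) odd)
    show "fejer_mean c n (- z) = fejer_mean c n z" by (simp only: eq e)
  qed
  moreover have "\<exists>D'. \<forall>z. (1 + nsq z) * (1 + nsq (fejer_mean c n z)) \<le> D' * exp (\<eta> * nsq z)" if \<eta>: "\<eta> > 0" for \<eta>
  proof (intro exI allI)
    fix z :: complex
    have one: "1 \<le> exp (norm z)" "1 \<le> exp (2 * norm z)" by simp_all
    have "nsq z \<le> 2 * exp (norm z)" using power_le_fact_exp[of "norm z" 2] by simp
    with one(1) have a: "1 + nsq z \<le> 3 * exp (norm z)" by linarith
    have "nsq (fejer_mean c n z) \<le> (D * exp (norm z))\<^sup>2" unfolding d(1) by (intro power_mono D) simp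
    then have b: "1 + nsq (fejer_mean c n z) \<le> (1 + D\<^sup>2) * exp (2 * norm z)"
    proof -
      have "(exp (norm z))\<^sup>2 = exp (2 * norm z)" by (simp add: exp_double)
      with \<open>nsq (fejer_mean c n z) \<le> (D * exp (norm z))\<^sup>2\<close>
      have "nsq (fejer_mean c n z) \<le> D\<^sup>2 * exp (2 * norm z)" by (simp only: power_mult_distrib)
      with one(2) have "1 + nsq (fejer_mean c n z) \<le> exp (2 * norm z) + D\<^sup>2 * exp (2 * norm z)"
        by (rule add_mono)
      then show ?thesis by (simp only: distrib_right mult_1)
    qed
    have "(1 + nsq z) * (1 + nsq (fejer_mean c n z)) \<le> 3 * exp (norm z) * ((1 + D\<^sup>2) * exp (2 * norm z))"
      by (intro mult_mono a b) auto
    also have "\<dots> = 3 * (1 + D\<^sup>2) * exp (norm z * 3)" by (simp add: mult_ac flip: exp_add)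
    also have "\<dots> \<le> 3 * (1 + D\<^sup>2) * (exp (3\<^sup>2 / (4 * \<eta>)) * exp (\<eta> * nsq z))"
      using mult_le_weighted_squares[OF \<eta>, of "norm z" 3] by (intro mult_left_mono) (auto simp: add.commute simp flip: exp_add)
    finally show "(1 + nsq z) * (1 + nsq (fejer_mean c n z)) \<le> (3 * (1 + D\<^sup>2) * exp (3\<^sup>2 / (4 * \<eta>))) * exp (\<eta> * nsq z)"
      by (simp only: mult.assoc)
  qed
  ultimately show ?thesis by (simp add: slow_growth_def)
qed

text \<open>Chebyshev's correlation inequality: with x = |z|^2 and m its mean, (x - m) (x^k - m^k)
  \<ge> 0, while (x - m) m^k integrates to 0.\<close>

lemma moment_Suc_ge: "moment (Suc k) \<ge> moment 1 * moment k"
proof -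
  let ?m = "moment 1"
  let ?x = "\<lambda>z::complex. nsq z"
  have pw: "norm z ^ (2 * j) = ?x z ^ j" for z :: complex and j by (simp add: power_mult)
  have ints: "integrable N (\<lambda>z. ?x z ^ j)" "(LINT z|N. ?x z ^ j) = moment j" for j
    using moment_integral[of j] unfolding pw by auto
  have int1: "integrable N ?x" "(LINT z|N. ?x z) = ?m" using ints[of 1] by simp_all
  have "0 = (LINT z|N. (?x z - ?m) * ?m ^ k)"
    using int1 by (simp add: N.prob_space[simplified])
  also have "\<dots> \<le> (LINT z|N. (?x z - ?m) * ?x z ^ k)"
  proof (rule integral_mono)
    show "integrable N (\<lambda>z. (?x z - ?m) * ?m ^ k)" using int1 by simp
    have "(?x z - ?m) * ?x z ^ k = ?x z ^ Suc k - ?m * ?x z ^ k" for z by (simp add: algebra_simps)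
    then show "integrable N (\<lambda>z. (?x z - ?m) * ?x z ^ k)" using ints[of "Suc k"] ints[of k] by simp
    fix z
    show "(?x z - ?m) * ?m ^ k \<le> (?x z - ?m) * ?x z ^ k"
    proof (cases "?x z \<ge> ?m")
      case True
      then show ?thesis using moment_nonneg[of 1] by (intro mult_left_mono power_mono) auto
    next
      case False
      then show ?thesis using power_mono[of "?x z" ?m k] by (intro mult_left_mono_neg) auto
    qed
  qed
  also have "\<dots> = (LINT z|N. ?x z ^ Suc k - ?m * ?x z ^ k)" by (intro integral_cong refl) (simp add: algebra_simps)
  also have "\<dots> = moment (Suc k) - ?m * moment k"
    using ints[of "Suc k"] ints[of k] by (subst integral_diff) (auto simp del: power_Suc)
  finally show ?thesis by simp
qed

text \<open>Multiplication by z shifts the coefficients, so the energy is the sum of |d k|^2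
  \<open>moment (Suc k)\<close>, to which the correlation inequality applies term by term.\<close>

lemma poly_energy:
  "integrable N (\<lambda>z. nsq z * nsq (\<Sum>k<n. d k * z ^ k))"
  "(LINT z|N. nsq z * nsq (\<Sum>k<n. d k * z ^ k)) \<ge> moment 1 * (LINT z|N. nsq (\<Sum>k<n. d k * z ^ k))"
proof -
  define d' where "d' k = (case k of 0 \<Rightarrow> 0 | Suc j \<Rightarrow> d j)" for k
  have e: "nsq z * nsq (\<Sum>k<n. d k * z ^ k) = nsq (\<Sum>k<Suc n. d' k * z ^ k)" for z
  proof -
    have "(\<Sum>k<Suc n. d' k * z ^ k) = z * (\<Sum>k<n. d k * z ^ k)"
      by (subst sum.lessThan_Suc_shift) (simp add: d'_def sum_distrib_left mult_ac)
    then show ?thesis by (simp add: norm_mult power_mult_distrib)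
  qed
  show "integrable N (\<lambda>z. nsq z * nsq (\<Sum>k<n. d k * z ^ k))" unfolding e by (rule poly_norm_square)
  have "(LINT z|N. nsq z * nsq (\<Sum>k<n. d k * z ^ k)) = (\<Sum>k<n. nsq (d k) * moment (Suc k))"
    unfolding e poly_norm_square by (subst sum.lessThan_Suc_shift) (simp add: d'_def)
  also have "\<dots> \<ge> (\<Sum>k<n. nsq (d k) * (moment 1 * moment k))"
    by (intro sum_mono mult_left_mono moment_Suc_ge) simp
  also have "(\<Sum>k<n. nsq (d k) * (moment 1 * moment k)) = moment 1 * (LINT z|N. nsq (\<Sum>k<n. d k * z ^ k))"
    by (simp add: poly_norm_square sum_distrib_left mult_ac)
  finally show "(LINT z|N. nsq z * nsq (\<Sum>k<n. d k * z ^ k)) \<ge> moment 1 * (LINT z|N. nsq (\<Sum>k<n. d k * z ^ k))" .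
qed

end

section \<open>Entropy and energy\<close>

text \<open>\<open>x ln x = xlnx_hull x - xlnx_gap x\<close> splits \<open>x ln x\<close> into a convex increasing function with values
  in \<open>[0, \<infinity>)\<close> and a bounded continuous remainder.\<close>

definition xlnx_hull :: "real \<Rightarrow> real" where
  "xlnx_hull x = max x (exp (- 1)) * ln (max x (exp (- 1))) + exp (- 1)"

definition xlnx_gap :: "real \<Rightarrow> real" where
  "xlnx_gap x = xlnx_hull x - x * ln x"

text \<open>The tangent of the convex function t ln t at x lies below it. It yields the supporting
  lines of the hull and, integrated, the nonnegativity of the entropy.\<close>

lemma xlnx_tangent:
  fixes x y :: real
  assumes "x > 0" "y \<ge> 0"
  shows "(ln x + 1) * y - x \<le> y * ln y"
proof (cases "y = 0")
  case False
  then have y: "y > 0" using assms by simp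
  have "ln (x / y) \<le> x / y - 1" using assms y by (intro ln_le_minus_one) simp
  then have "y * (ln x - ln y) \<le> y * (x / y - 1)" using assms y by (intro mult_left_mono) (auto simp: ln_div)
  then show ?thesis using y by (simp add: algebra_simps)
qed (use assms in simp)

lemma xlnx_hull_support:
  assumes "x \<ge> 0"
  shows "\<exists>\<alpha>\<ge>0. \<exists>\<beta>. xlnx_hull x = \<alpha> * x + \<beta> \<and> (\<forall>y\<ge>0. \<alpha> * y + \<beta> \<le> xlnx_hull y)"
proof -
  \<comment> \<open>The point of tangency; t ln t is minimal at exp (- 1), left of which the hull is
    constant and the slope ln m + 1 is 0.\<close>
  define m where "m = max x (exp (- 1))"
  have m: "m > 0" "m \<ge> exp (- 1)" "m \<ge> x" by (auto simp: m_def less_max_iff_disj)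
  then have "ln m \<ge> ln (exp (- 1))" by (subst ln_le_cancel_iff) auto
  then have lm: "ln m + 1 \<ge> 0" by simp
  have eq: "xlnx_hull x = (ln m + 1) * x + (exp (- 1) - m)"
  proof (cases "x \<ge> exp (- 1)")
    case True
    then have "m = x" by (simp add: m_def)
    then show ?thesis by (simp add: xlnx_hull_def m_def[symmetric] algebra_simps)
  next
    case False
    then have "m = exp (- 1)" by (simp add: m_def)
    then show ?thesis by (simp add: xlnx_hull_def m_def[symmetric])
  qed
  have "(ln m + 1) * y + (exp (- 1) - m) \<le> xlnx_hull y" if "y \<ge> 0" for y
  proof -
    have "(ln m + 1) * y \<le> (ln m + 1) * max y (exp (- 1))" using lm by (intro mult_left_mono) auto
    also have "\<dots> - m \<le> max y (exp (- 1)) * ln (max y (exp (- 1)))" using m by (intro xlnx_tangent) (auto simp: le_max_iff_disj)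
    finally show ?thesis by (simp add: xlnx_hull_def)
  qed
  with eq lm show ?thesis by blast
qed

lemma xlnx_hull_nonneg: "xlnx_hull x \<ge> 0"
proof -
  have "(ln (exp (- 1)) + 1) * max x (exp (- 1)) - exp (- 1) \<le> max x (exp (- 1)) * ln (max x (exp (- 1)))"
    by (intro xlnx_tangent) (auto simp: le_max_iff_disj)
  then show ?thesis by (simp add: xlnx_hull_def)
qed

lemma continuous_on_xlnx_hull: "continuous_on A xlnx_hull"
  unfolding xlnx_hull_def[abs_def]
proof (intro continuous_intros ballI)
  fix x :: real
  have "max x (exp (- 1)) > 0" by (simp add: less_max_iff_disj)
  then show "max x (exp (- 1)) \<noteq> 0" by linarith
qed

lemma xlnx_hull_measurable [measurable]: "xlnx_hull \<in> borel_measurable borel"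
  by (intro borel_measurable_continuous_onI continuous_on_xlnx_hull)

lemma xlnx_gap_measurable [measurable]: "xlnx_gap \<in> borel_measurable borel"
  unfolding xlnx_gap_def[abs_def] by measurable

lemma continuous_on_xlnx: "continuous_on {0..} (\<lambda>x::real. x * ln x)"
  unfolding continuous_on_eq_continuous_within
proof
  fix x :: real assume x: "x \<in> {0..}"
  show "continuous (at x within {0..}) (\<lambda>x. x * ln x)"
  proof (cases "x = 0")
    case True
    have "((\<lambda>x::real. x * ln x) \<longlongrightarrow> 0) (at_right 0)" by real_asymp
    then show ?thesis using True by (simp add: continuous_within at_within_Ici_at_right)
  next
    case False
    then have "isCont (\<lambda>x. x * ln x) x" using x by (intro continuous_intros) auto
    then show ?thesis by (rule continuous_at_imp_continuous_within)
  qed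
qed

lemma continuous_on_xlnx_gap: "continuous_on {0..} xlnx_gap"
  unfolding xlnx_gap_def[abs_def] by (intro continuous_intros continuous_on_xlnx_hull continuous_on_xlnx)

lemma xlnx_gap_bounds:
  assumes "x \<ge> 0" shows "0 \<le> xlnx_gap x" "xlnx_gap x \<le> 1"
proof -
  have e1: "exp (- 1 :: real) \<le> 1" by simp
  show "0 \<le> xlnx_gap x"
  proof (cases "x \<ge> exp (- 1)")
    case False
    have "x * ln x \<le> 0"
    proof (cases "x = 0")
      case False
      have "x \<le> 1" using \<open>\<not> exp (- 1) \<le> x\<close> e1 by linarith
      then show ?thesis using assms False by (intro mult_nonneg_nonpos) (auto simp: ln_le_zero_iff)
    qed simp
    then show ?thesis using xlnx_hull_nonneg[of x] by (simp add: xlnx_gap_def)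
  qed (simp add: xlnx_gap_def xlnx_hull_def max_def)
  show "xlnx_gap x \<le> 1"
  proof (cases "x \<ge> exp (- 1)")
    case True
    then show ?thesis using e1 by (simp add: xlnx_gap_def xlnx_hull_def max_absorb1)
  next
    case False
    then have h: "xlnx_hull x = 0" by (simp add: xlnx_hull_def max_def)
    have "(ln 1 + 1) * x - 1 \<le> x * ln x" using assms by (intro xlnx_tangent) auto
    then have "- (x * ln x) \<le> 1 - x" by simp
    then show ?thesis using assms h by (simp add: xlnx_gap_def)
  qed
qed

lemma ereal_integral_integrable:
  assumes "integrable M g"
  shows "ereal_integral M g = ereal (integral\<^sup>L M g)"
proof -
  have "(\<integral>\<^sup>+x. ennreal (g x) \<partial>M) \<noteq> \<infinity>" "(\<integral>\<^sup>+x. ennreal (- g x) \<partial>M) \<noteq> \<infinity>"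
    using assms by (auto simp: real_integrable_def)
  then show ?thesis using real_lebesgue_integral_def[OF assms]
    by (cases "\<integral>\<^sup>+x. ennreal (g x) \<partial>M"; cases "\<integral>\<^sup>+x. ennreal (- g x) \<partial>M")
       (auto simp: ereal_integral_def)
qed

text \<open>If P has infinite integral, so has the positive part of P - K, since K is integrable,
  while the negative part is at most K. The extended difference is thus never indeterminate.\<close>

lemma ereal_integral_diff_bounded:
  assumes M: "finite_measure M" and [measurable]: "P \<in> borel_measurable M" "K \<in> borel_measurable M"
    and P: "\<And>x. P x \<ge> 0" and K: "\<And>x. 0 \<le> K x" "\<And>x. K x \<le> 1"
  shows "ereal_integral M (\<lambda>x. P x - K x) = enn2ereal (\<integral>\<^sup>+x. ennreal (P x) \<partial>M) - ereal (LINT x|M. K x)"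
proof -
  interpret finite_measure M by fact
  have Ki: "integrable M K" using K by (intro integrable_const_bound[of _ 1]) auto
  show ?thesis
  proof (cases "(\<integral>\<^sup>+x. ennreal (P x) \<partial>M) = \<infinity>")
    case False
    then have Pi: "integrable M P" using P by (intro integrableI_nonneg) (auto simp: top.not_eq_extremum)
    then have "ereal_integral M (\<lambda>x. P x - K x) = ereal ((LINT x|M. P x) - (LINT x|M. K x))"
      using Ki by (subst ereal_integral_integrable) auto
    also have "\<dots> = ereal (LINT x|M. P x) - ereal (LINT x|M. K x)" by simp
    also have "ereal (LINT x|M. P x) = enn2ereal (\<integral>\<^sup>+x. ennreal (P x) \<partial>M)"
      using Pi P by (subst nn_integral_eq_integral) (auto intro!: enn2ereal_ennreal[symmetric] integral_nonneg_AE)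
    finally show ?thesis .
  next
    case True
    have Kf: "(\<integral>\<^sup>+x. ennreal (K x) \<partial>M) < \<infinity>" using Ki K by (simp add: nn_integral_eq_integral)
    have "(\<integral>\<^sup>+x. ennreal (P x) \<partial>M) \<le> (\<integral>\<^sup>+x. ennreal (P x - K x) + ennreal (K x) \<partial>M)"
    proof (intro nn_integral_mono)
      fix x
      have "ennreal (P x) \<le> ennreal (max 0 (P x - K x) + K x)" using K by (intro ennreal_leI) auto
      also have "\<dots> = ennreal (max 0 (P x - K x)) + ennreal (K x)" using K by (intro ennreal_plus) auto
      also have "ennreal (max 0 (P x - K x)) = ennreal (P x - K x)" by (cases "P x - K x \<ge> 0") (auto simp: max_def ennreal_neg)
      finally show "ennreal (P x) \<le> ennreal (P x - K x) + ennreal (K x)" .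
    qed
    also have "\<dots> = (\<integral>\<^sup>+x. ennreal (P x - K x) \<partial>M) + (\<integral>\<^sup>+x. ennreal (K x) \<partial>M)" by (rule nn_integral_add) measurable
    finally have t: "(\<integral>\<^sup>+x. ennreal (P x - K x) \<partial>M) = \<infinity>" using True Kf by (auto simp: top_unique)
    have "(\<integral>\<^sup>+x. ennreal (- (P x - K x)) \<partial>M) \<le> (\<integral>\<^sup>+x. ennreal (K x) \<partial>M)"
      using P by (intro nn_integral_mono ennreal_leI) auto
    then have "(\<integral>\<^sup>+x. ennreal (- (P x - K x)) \<partial>M) < \<infinity>" using Kf by (rule le_less_trans)
    then show ?thesis using t True unfolding ereal_integral_def
      by (cases "\<integral>\<^sup>+x. ennreal (- (P x - K x)) \<partial>M") auto
  qed
qed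

text \<open>With P and E possibly infinite, the signs decide. If E is infinite, either b > 0 and the
  right side is infinite, or b < 0; if b e has a finite limit, an infinite P excludes s > 0. Zero
  coefficients rely on 0 times \<infinity> being 0.\<close>

lemma ereal_limit_inequality:
  fixes s b R :: real and p e r :: "nat \<Rightarrow> real"
  assumes nn: "\<And>n. p n \<ge> 0" "\<And>n. e n \<ge> 0"
    and P: "(\<lambda>n. ennreal (p n)) \<longlonglongrightarrow> P" and E: "(\<lambda>n. ennreal (e n)) \<longlonglongrightarrow> E" and r: "r \<longlonglongrightarrow> R"
    and le: "\<forall>\<^sub>F n in sequentially. s * p n \<le> r n + b * e n" and sb: "b < 0 \<Longrightarrow> s < 0"
  shows "ereal s * enn2ereal P \<le> ereal R + ereal b * enn2ereal E"
proof -
  have reall: "x \<longlonglongrightarrow> enn2real X" if "\<And>n. x n \<ge> 0" "(\<lambda>n. ennreal (x n)) \<longlonglongrightarrow> X" "X \<noteq> top" for x :: "nat \<Rightarrow> real" and X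
    using that by (cases X) auto
  have atop: "filterlim x at_top sequentially" if "(\<lambda>n. ennreal (x n)) \<longlonglongrightarrow> top" for x :: "nat \<Rightarrow> real"
    using that by (simp add: ennreal_tendsto_top_eq_at_top)
  have nolim: False if "filterlim y at_top sequentially" "x \<longlonglongrightarrow> l" "\<forall>\<^sub>F n in sequentially. y n \<le> x n" for x y :: "nat \<Rightarrow> real" and l
  proof -
    have "filterlim x at_top sequentially" by (rule filterlim_at_top_mono[OF that(1,3)])
    then have "filterlim x at_infinity sequentially" by (rule filterlim_at_top_imp_at_infinity)
    then show False using not_tendsto_and_filterlim_at_infinity[OF trivial_limit_sequentially that(2)] by blast
  qed
  consider (pos) "E = top" "b > 0" | (neg) "E = top" "b < 0" | (fin) "E \<noteq> top \<or> b = 0" by linarith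
  then show ?thesis
  proof cases
    case pos
    then show ?thesis by simp
  next
    case neg
    \<comment> \<open>For b < 0 the energies tending to infinity must be compensated by - s p, so P
      is infinite too; \<open>sb\<close> then makes both sides minus infinity.\<close>
    have "P = top"
    proof (rule ccontr)
      assume "P \<noteq> top"
      from reall[OF nn(1) P this] have "(\<lambda>n. r n - s * p n) \<longlonglongrightarrow> R - s * enn2real P" by (intro tendsto_intros r)
      moreover have "filterlim (\<lambda>n. (- b) * e n) at_top sequentially"
        using neg E by (intro filterlim_tendsto_pos_mult_at_top[OF tendsto_const]) (auto intro: atop)
      moreover have "\<forall>\<^sub>F n in sequentially. (- b) * e n \<le> r n - s * p n" using le by eventually_elim simp
      ultimately show False using nolim by blast
    qed
    then show ?thesis using sb neg by simp
  next
    case fin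
    obtain t where t: "(\<lambda>n. b * e n) \<longlonglongrightarrow> t" "ereal b * enn2ereal E = ereal t"
    proof (cases "b = 0")
      case True
      then show ?thesis by (intro that[of 0]) (auto simp: zero_ereal_def[symmetric])
    next
      case False
      then have ne: "E \<noteq> top" using fin by simp
      from reall[OF nn(2) E this] have "(\<lambda>n. b * e n) \<longlonglongrightarrow> b * enn2real E" by (intro tendsto_intros)
      moreover have "ereal b * enn2ereal E = ereal (b * enn2real E)" using ne by (cases E) auto
      ultimately show ?thesis by (rule that)
    qed
    have rt: "(\<lambda>n. r n + b * e n) \<longlonglongrightarrow> R + t" by (intro tendsto_intros r t)
    show ?thesis
    proof (cases "P = top")
      case False
      from reall[OF nn(1) P this] have "(\<lambda>n. s * p n) \<longlonglongrightarrow> s * enn2real P" by (intro tendsto_intros)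
      then have "s * enn2real P \<le> R + t" by (rule tendsto_le[OF trivial_limit_sequentially rt _ le])
      moreover have "ereal s * enn2ereal P = ereal (s * enn2real P)" using False by (cases P) auto
      ultimately show ?thesis by (simp add: t(2))
    next
      case True
      have pt: "filterlim p at_top sequentially" using P True by (intro atop) simp
      have "s \<le> 0"
      proof (rule ccontr)
        assume "\<not> s \<le> 0"
        then have "filterlim (\<lambda>n. s * p n) at_top sequentially"
          by (intro filterlim_tendsto_pos_mult_at_top[OF tendsto_const _ pt]) auto
        then show False using nolim[OF _ rt le] by blast
      qed
      then consider "s < 0" | "s = 0" by linarith
      then show ?thesis
      proof cases
        case 1
        then show ?thesis using True by simp
      next
        case 2
        then have "0 \<le> R + t" using le by (intro tendsto_lowerbound[OF rt]) auto
        then show ?thesis using 2 True by (simp add: t(2) zero_ereal_def)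
      qed
    qed
  qed
qed

lemma Lp_norm_2_square: "(Lp_norm M 2 f)\<^sup>2 = (LINT x|M. nsq (f x))"
proof -
  have "Lp_norm M (ereal 2) f = sqrt (LINT x|M. nsq (f x))"
    unfolding Lp_norm_finite by (simp add: powr_half_sqrt)
  then show ?thesis by simp
qed

section \<open>Entropy and energy on the space of square-integrable even entire functions\<close>

context deformed_bargmann
begin

lemma B_e_2_iff: "f \<in> B_e \<mu> 2 \<longleftrightarrow> f \<in> even_entire \<and> integrable N (\<lambda>z. nsq (f z))"
  by (auto simp: B_e_def Lp_space_finite even_entire_measurable)

lemma B_e_subset_B_e_2:
  assumes "\<epsilon> > 0" "f \<in> B_e \<mu> (2 + \<epsilon>)"
  shows "f \<in> B_e \<mu> 2"
proof -
  have fe: "f \<in> even_entire" and i: "integrable N (\<lambda>z. norm (f z) powr (2 + \<epsilon>))"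
    using assms by (auto simp: B_e_def Lp_space_finite)
  have [measurable]: "f \<in> borel_measurable borel" by (rule even_entire_measurable[OF fe])
  have "integrable N (\<lambda>z. nsq (f z))"
  proof (rule integrable_bound)
    show "integrable N (\<lambda>z. 1 + norm (f z) powr (2 + \<epsilon>))" using i by simp
    have "x\<^sup>2 \<le> 1 + x powr (2 + \<epsilon>)" if "x \<ge> 0" for x :: real
    proof (cases "x \<le> 1")
      case True
      then show ?thesis using that power_le_one[of x 2] by (simp add: add_increasing2)
    next
      case False
      then have "x powr 2 \<le> x powr (2 + \<epsilon>)" using assms(1) by (intro powr_mono) auto
      then show ?thesis using False by simp
    qed
    then show "AE z in N. norm (nsq (f z)) \<le> norm (1 + norm (f z) powr (2 + \<epsilon>))" by (intro AE_I2) simp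
  qed measurable
  then show ?thesis using fe by (simp add: B_e_2_iff)
qed

text \<open>The form in which Fejer approximation applies: the hull term, alone able to be infinite,
  is controlled by convexity, and the gap term converges by bounded convergence.\<close>

lemma entropy_eq:
  assumes [measurable]: "f \<in> borel_measurable borel"
  shows "entropy_L2 N f = enn2ereal (\<integral>\<^sup>+z. ennreal (xlnx_hull (nsq (f z))) \<partial>N)
     - ereal (LINT z|N. xlnx_gap (nsq (f z))) - ereal ((LINT z|N. nsq (f z)) * ln (LINT z|N. nsq (f z)))"
proof -
  have "(\<lambda>z. nsq (f z) * ln (nsq (f z))) = (\<lambda>z. xlnx_hull (nsq (f z)) - xlnx_gap (nsq (f z)))"
    by (simp add: xlnx_gap_def)
  moreover have "ereal_integral N (\<lambda>z. xlnx_hull (nsq (f z)) - xlnx_gap (nsq (f z)))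
    = enn2ereal (\<integral>\<^sup>+z. ennreal (xlnx_hull (nsq (f z))) \<partial>N) - ereal (LINT z|N. xlnx_gap (nsq (f z)))"
    by (rule ereal_integral_diff_bounded) (auto simp: N.finite_measure_axioms xlnx_hull_nonneg xlnx_gap_bounds)
  ultimately show ?thesis unfolding entropy_L2_def Lp_norm_2_square by presburger
qed

lemma entropy_zero:
  assumes [measurable]: "f \<in> borel_measurable borel" and i: "integrable N (\<lambda>z. nsq (f z))"
    and z: "(LINT z|N. nsq (f z)) = 0"
  shows "entropy_L2 N f = 0" "energy_e \<mu> f = 0"
proof -
  have ae: "AE z in N. f z = 0" using z i by (subst (asm) integral_nonneg_eq_0_iff_AE) auto
  have "(\<integral>\<^sup>+z. ennreal (nsq (f z) * ln (nsq (f z))) \<partial>N) = (\<integral>\<^sup>+z. 0 \<partial>N)"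
    "(\<integral>\<^sup>+z. ennreal (- (nsq (f z) * ln (nsq (f z)))) \<partial>N) = (\<integral>\<^sup>+z. 0 \<partial>N)"
    "energy_e \<mu> f = (\<integral>\<^sup>+z. 0 \<partial>N)"
    unfolding energy_e_def by (intro nn_integral_cong_AE; use ae in eventually_elim; simp)+
  then show "entropy_L2 N f = 0" "energy_e \<mu> f = 0"
    unfolding entropy_L2_def Lp_norm_2_square z by (simp_all add: ereal_integral_def zero_ereal_def[symmetric])
qed

text \<open>Jensen's inequality on a probability space: the tangent at the mean of |f|^2 is
  integrated. A mean of 0 or an infinite entropy is settled separately.\<close>

lemma entropy_nonneg:
  assumes f: "f \<in> B_e \<mu> 2"
  shows "entropy_L2 N f \<ge> 0"
proof -
  have fe: "f \<in> even_entire" and i: "integrable N (\<lambda>z. nsq (f z))" using f by (auto simp: B_e_2_iff)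
  have [measurable]: "f \<in> borel_measurable borel" by (rule even_entire_measurable[OF fe])
  define n2 where "n2 = (LINT z|N. nsq (f z))"
  have "n2 \<ge> 0" by (simp add: n2_def)
  then consider "n2 = 0" | "n2 > 0" by linarith
  then show ?thesis
  proof cases
    case 1 then show ?thesis using entropy_zero(1)[OF _ i] by (simp add: n2_def)
  next
    case 2
    show ?thesis
    proof (cases "(\<integral>\<^sup>+z. ennreal (xlnx_hull (nsq (f z))) \<partial>N) = \<infinity>")
      case True
      then show ?thesis by (simp add: entropy_eq)
    next
      case False
      then have hi: "integrable N (\<lambda>z. xlnx_hull (nsq (f z)))"
        by (intro integrableI_nonneg) (auto simp: xlnx_hull_nonneg top.not_eq_extremum)
      have gi: "integrable N (\<lambda>z. xlnx_gap (nsq (f z)))"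
        by (rule N.integrable_const_bound[of _ 1]) (auto simp: xlnx_gap_bounds)
      have li: "integrable N (\<lambda>z. nsq (f z) * ln (nsq (f z)))"
        using integrable_diff[OF hi gi] by (simp add: xlnx_gap_def)
      have "n2 * ln n2 = (LINT z|N. (ln n2 + 1) * nsq (f z) - n2)"
        using i by (simp add: n2_def[symmetric] N.prob_space[simplified] algebra_simps)
      also have "\<dots> \<le> (LINT z|N. nsq (f z) * ln (nsq (f z)))"
        using i li 2 by (intro integral_mono xlnx_tangent) auto
      finally show ?thesis
        unfolding entropy_L2_def ereal_integral_integrable[OF li] Lp_norm_2_square n2_def[symmetric] by simp
    qed
  qed
qed

text \<open>The correlation inequality holds for the polynomial Fejer means, and both sides converge
  even if the energy is infinite. Equality for constants fixes the constant
  \<open>moment 1\<close>.\<close>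

lemma energy_ge:
  assumes f: "f \<in> B_e \<mu> 2"
  shows "ennreal (moment 1 * (LINT z|N. nsq (f z))) \<le> energy_e \<mu> f"
proof -
  have fe: "f \<in> even_entire" and i: "integrable N (\<lambda>z. nsq (f z))" using f by (auto simp: B_e_2_iff)
  obtain c where c: "\<And>z. (\<lambda>k. c k * z ^ k) sums f z" "\<And>k. odd k \<Longrightarrow> c k = 0"
    using even_entire_power_series[OF fe] by blast
  have id: "\<exists>\<alpha>\<ge>0. \<exists>\<beta>. x = \<alpha> * x + \<beta> \<and> (\<forall>y\<ge>0. \<alpha> * y + \<beta> \<le> y)" for x :: real
    by (intro exI[of _ 1] exI[of _ 0] conjI) auto
  let ?s = "\<lambda>n. fejer_mean c (Suc n)"
  have sq: "ennreal (nsq z) * ennreal (nsq w) = ennreal (nsq z * nsq w)" for z w :: complex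
    by (simp add: ennreal_mult)
  have l1: "(\<lambda>n. \<integral>\<^sup>+z. ennreal (nsq (?s n z)) \<partial>N) \<longlonglongrightarrow> (\<integral>\<^sup>+z. ennreal (nsq (f z)) \<partial>N)"
    using nn_integral_fejer_mean_tendsto[OF c(1) fe, of "\<lambda>x. x" "\<lambda>x. 1", OF _ _ id] by simp
  have l2: "(\<lambda>n. energy_e \<mu> (?s n)) \<longlonglongrightarrow> energy_e \<mu> f"
    using nn_integral_fejer_mean_tendsto[OF c(1) fe, of "\<lambda>x. x" "\<lambda>x. x\<^sup>2", OF _ _ id] by (simp add: energy_e_def sq)
  have "ennreal (moment 1) * (\<integral>\<^sup>+z. ennreal (nsq (?s n z)) \<partial>N) \<le> energy_e \<mu> (?s n)" for n
  proof -
    obtain d where d: "\<And>z. ?s n z = (\<Sum>k<Suc n. d k * z ^ k)" using fejer_mean_poly by blast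
    show ?thesis
      unfolding energy_e_def d using poly_energy[where n="Suc n" and d=d] poly_norm_square(1)[where n="Suc n" and d=d] moment_nonneg[of 1]
      by (subst (1 2) nn_integral_eq_integral) (auto simp: ennreal_mult[symmetric] intro!: ennreal_leI simp del: sum.lessThan_Suc)
  qed
  moreover have "(\<lambda>n. ennreal (moment 1) * (\<integral>\<^sup>+z. ennreal (nsq (?s n z)) \<partial>N)) \<longlonglongrightarrow> ennreal (moment 1) * (\<integral>\<^sup>+z. ennreal (nsq (f z)) \<partial>N)"
    by (intro ennreal_tendsto_cmult l1) simp
  ultimately have "ennreal (moment 1) * (\<integral>\<^sup>+z. ennreal (nsq (f z)) \<partial>N) \<le> energy_e \<mu> f"
    using l2 by (intro LIMSEQ_le) auto
  also have "(\<integral>\<^sup>+z. ennreal (nsq (f z)) \<partial>N) = ennreal (LINT z|N. nsq (f z))"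
    using i by (intro nn_integral_eq_integral) auto
  finally show ?thesis using moment_nonneg[of 1] by (simp add: ennreal_mult)
qed

lemma quadratic_form_energy: "quadratic_form_on (B_e \<mu> 2) (energy_e \<mu>)"
  unfolding quadratic_form_on_def
proof (intro conjI allI ballI)
  fix f assume "f \<in> B_e \<mu> 2"
  then have [measurable]: "f \<in> borel_measurable borel" by (auto simp: B_e_2_iff even_entire_measurable)
  show "energy_e \<mu> (\<lambda>x. c * f x) = ennreal (nsq c) * energy_e \<mu> f" for c
  proof -
    have "energy_e \<mu> (\<lambda>x. c * f x) = (\<integral>\<^sup>+z. ennreal (nsq c) * ennreal (nsq z * nsq (f z)) \<partial>N)"
      unfolding energy_e_def by (intro nn_integral_cong) (simp add: ennreal_mult[symmetric] norm_mult power_mult_distrib mult_ac)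
    also have "\<dots> = ennreal (nsq c) * energy_e \<mu> f" unfolding energy_e_def by (rule nn_integral_cmult) measurable
    finally show ?thesis .
  qed
  fix g assume "g \<in> B_e \<mu> 2"
  then have [measurable]: "g \<in> borel_measurable borel" by (auto simp: B_e_2_iff even_entire_measurable)
  have pl: "nsq (x + y) + nsq (x - y) = 2 * nsq x + 2 * nsq y" for x y :: complex
    unfolding cmod_power2 by (simp add: power2_eq_square algebra_simps)
  have "energy_e \<mu> (\<lambda>x. f x + g x) + energy_e \<mu> (\<lambda>x. f x - g x)
     = (\<integral>\<^sup>+z. ennreal (nsq z * nsq (f z + g z)) + ennreal (nsq z * nsq (f z - g z)) \<partial>N)"
    unfolding energy_e_def by (rule nn_integral_add[symmetric]) measurable
  also have "\<dots> = (\<integral>\<^sup>+z. 2 * ennreal (nsq z * nsq (f z)) + 2 * ennreal (nsq z * nsq (g z)) \<partial>N)"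
  proof (intro nn_integral_cong)
    fix z
    have two: "2 * ennreal x = ennreal (2 * x)" if "x \<ge> 0" for x using that by (simp add: ennreal_mult)
    have "nsq z * nsq (f z + g z) + nsq z * nsq (f z - g z)
      = 2 * (nsq z * nsq (f z)) + 2 * (nsq z * nsq (g z))"
      unfolding distrib_left[symmetric] pl by (simp add: algebra_simps)
    then show "ennreal (nsq z * nsq (f z + g z)) + ennreal (nsq z * nsq (f z - g z))
       = 2 * ennreal (nsq z * nsq (f z)) + 2 * ennreal (nsq z * nsq (g z))"
      by (simp add: two ennreal_plus[symmetric] del: ennreal_plus)
  qed
  also have "\<dots> = (\<integral>\<^sup>+z. 2 * ennreal (nsq z * nsq (f z)) \<partial>N) + (\<integral>\<^sup>+z. 2 * ennreal (nsq z * nsq (g z)) \<partial>N)"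
    by (rule nn_integral_add) measurable
  also have "\<dots> = 2 * energy_e \<mu> f + 2 * energy_e \<mu> g"
    unfolding energy_e_def by (subst (1 2) nn_integral_cmult) auto
  finally show "energy_e \<mu> (\<lambda>x. f x + g x) + energy_e \<mu> (\<lambda>x. f x - g x) = 2 * energy_e \<mu> f + 2 * energy_e \<mu> g" .
qed

end

section \<open>The closed subspace\<close>

lemma norm_add_square_le:
  fixes x y :: "'a::real_normed_vector"
  shows "nsq (x + y) \<le> 2 * nsq x + 2 * nsq y"
proof -
  have "nsq (x + y) \<le> (norm x + norm y)\<^sup>2" by (intro power_mono norm_triangle_ineq) simp
  also have "\<dots> \<le> 2 * nsq x + 2 * nsq y"
    using sum_squares_bound[of "norm x" "norm y"] by (simp add: power2_sum)
  finally show ?thesis .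
qed

context deformed_bargmann
begin

lemma B_e_2_add: "f \<in> B_e \<mu> 2 \<Longrightarrow> g \<in> B_e \<mu> 2 \<Longrightarrow> (\<lambda>x. f x + g x) \<in> B_e \<mu> 2"
proof -
  assume f: "f \<in> B_e \<mu> 2" and g: "g \<in> B_e \<mu> 2"
  then have [measurable]: "f \<in> borel_measurable borel" "g \<in> borel_measurable borel"
    by (auto simp: B_e_2_iff even_entire_measurable)
  have "integrable N (\<lambda>z. nsq (f z + g z))"
  proof (rule integrable_bound)
    show "integrable N (\<lambda>z. 2 * nsq (f z) + 2 * nsq (g z))" using f g by (auto simp: B_e_2_iff)
    show "AE z in N. norm (nsq (f z + g z)) \<le> norm (2 * nsq (f z) + 2 * nsq (g z))"
      using norm_add_square_le by (intro AE_I2) auto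
  qed measurable
  then show ?thesis using f g by (auto simp: B_e_2_iff even_entire_def intro!: holomorphic_intros)
qed

lemma B_e_2_cmult: "f \<in> B_e \<mu> 2 \<Longrightarrow> (\<lambda>x. c * f x) \<in> B_e \<mu> 2"
  by (auto simp: B_e_2_iff even_entire_def norm_mult power_mult_distrib intro!: holomorphic_intros)

text \<open>Reproduction and the pointwise kernel bound make point evaluations locally uniformly
  bounded in the L^2 norm. A mean-convergent sequence therefore converges locally uniformly to an
  even entire function, and a subsequence converging almost everywhere identifies it with f.\<close>

lemma closed_L2_subspace_B_e: "closed_L2_subspace N (B_e \<mu> 2)"
  unfolding closed_L2_subspace_def
proof (intro conjI ballI allI impI)
  show "B_e \<mu> 2 \<subseteq> Lp_space N 2" by (auto simp: B_e_def)
  show "(\<lambda>x. 0) \<in> B_e \<mu> 2" by (simp add: B_e_2_iff even_entire_def)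
  show "\<And>f g. f \<in> B_e \<mu> 2 \<Longrightarrow> g \<in> B_e \<mu> 2 \<Longrightarrow> (\<lambda>x. f x + g x) \<in> B_e \<mu> 2" by (rule B_e_2_add)
  show "\<And>c f. f \<in> B_e \<mu> 2 \<Longrightarrow> (\<lambda>x. c * f x) \<in> B_e \<mu> 2" by (rule B_e_2_cmult)
next
  fix F :: "nat \<Rightarrow> complex \<Rightarrow> complex" and f
  assume F: "\<forall>n. F n \<in> B_e \<mu> 2" and f: "f \<in> Lp_space N 2"
    and lim: "(\<lambda>n. Lp_norm N 2 (\<lambda>x. F n x - f x)) \<longlonglongrightarrow> 0"
  have f2: "f \<in> borel_measurable borel" "integrable N (\<lambda>z. nsq (f z))"
    using f Lp_space_finite[of f N 2] by auto
  have F2: "F n \<in> even_entire" "F n \<in> borel_measurable borel" "integrable N (\<lambda>z. nsq (F n z))" for n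
    using F by (auto simp: B_e_2_iff even_entire_measurable)
  note [measurable] = f2(1) F2(2)
  define d where "d n = (LINT z|N. nsq (F n z - f z))" for n
  have dl: "d \<longlonglongrightarrow> 0" using tendsto_power[OF lim, of 2] unfolding Lp_norm_2_square d_def by simp
  have di: "integrable N (\<lambda>z. nsq (F n z - f z))" for n
  proof (rule integrable_bound)
    show "integrable N (\<lambda>z. 2 * nsq (F n z) + 2 * nsq (f z))" using F2 f2 by auto
    show "AE z in N. norm (nsq (F n z - f z)) \<le> norm (2 * nsq (F n z) + 2 * nsq (f z))"
      using norm_add_square_le[of "F n _" "- f _"] by (intro AE_I2) auto
  qed measurable
  \<comment> \<open>For p = 2 the conjugate exponent is 2, so any \<kappa> > 1/2 is allowed in the
    pointwise bound; \<kappa> = 1 is taken.\<close>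
  have p2: "(1::ereal) < 2" "(1::real) > conj_exp 2 / 4" by (simp_all add: conj_exp_def)
  obtain C where C: "C \<ge> 0" "\<And>u w. u \<in> Lp_space N 2 \<Longrightarrow> norm (K_e \<mu> u w) \<le> C * exp (1 * nsq w) * Lp_norm N 2 u"
    using K_e_pointwise_bound[OF p2] by blast
  have ev: "norm (h w) \<le> C * exp (nsq w) * Lp_norm N 2 h" if h: "h \<in> B_e \<mu> 2" for h w
  proof -
    have "h \<in> Lp_space N 2" "h \<in> even_entire" using h by (auto simp: B_e_def)
    then show ?thesis using C(2)[of h w] K_e_reproducing[OF _ Lp_exp_integrable[OF p2(1)]] by auto
  qed
  have diff: "norm (F n w - F m w) \<le> C * exp (nsq w) * sqrt (2 * d n + 2 * d m)" for n m w
  proof -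
    have "(\<lambda>x. F n x + (- 1) * F m x) \<in> B_e \<mu> 2" using F by (intro B_e_2_add B_e_2_cmult) auto
    then have B: "(\<lambda>x. F n x - F m x) \<in> B_e \<mu> 2" by simp
    have "(Lp_norm N 2 (\<lambda>x. F n x - F m x))\<^sup>2 = (LINT z|N. nsq (F n z - F m z))" by (rule Lp_norm_2_square)
    also have "\<dots> \<le> (LINT z|N. 2 * nsq (F n z - f z) + 2 * nsq (F m z - f z))"
    proof (rule integral_mono)
      show "integrable N (\<lambda>z. nsq (F n z - F m z))" using B by (simp add: B_e_2_iff)
      show "integrable N (\<lambda>z. 2 * nsq (F n z - f z) + 2 * nsq (F m z - f z))" using di by simp
      fix z
      show "nsq (F n z - F m z) \<le> 2 * nsq (F n z - f z) + 2 * nsq (F m z - f z)"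
        using norm_add_square_le[of "F n z - f z" "f z - F m z"] by (simp add: norm_minus_commute)
    qed
    also have "\<dots> = 2 * d n + 2 * d m" using di by (simp add: d_def)
    finally have "Lp_norm N 2 (\<lambda>x. F n x - F m x) \<le> sqrt (2 * d n + 2 * d m)" by (rule real_le_rsqrt)
    then have "C * exp (nsq w) * Lp_norm N 2 (\<lambda>x. F n x - F m x) \<le> C * exp (nsq w) * sqrt (2 * d n + 2 * d m)"
      using C(1) by (intro mult_left_mono) auto
    then show ?thesis by (rule order_trans[OF ev[OF B]])
  qed
  have d0: "d n \<ge> 0" for n by (simp add: d_def)
  have "Cauchy (\<lambda>n. F n w)" for w
  proof (rule metric_CauchyI)
    fix e :: real assume e: "e > 0"
    define c where "c = C * exp (nsq w) + 1"
    have c: "c > 0" using C(1) by (simp add: c_def add_nonneg_pos)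
    obtain M where M: "\<And>n. n \<ge> M \<Longrightarrow> d n < (e / c)\<^sup>2 / 4"
      using order_tendstoD(2)[OF dl, of "(e / c)\<^sup>2 / 4"] e c by (auto simp: eventually_sequentially)
    show "\<exists>M. \<forall>m\<ge>M. \<forall>n\<ge>M. dist (F m w) (F n w) < e"
    proof (intro exI allI impI)
      fix m n assume mn: "m \<ge> M" "n \<ge> M"
      have "2 * d m + 2 * d n < (e / c)\<^sup>2" using M[OF mn(1)] M[OF mn(2)] by linarith
      then have s: "sqrt (2 * d m + 2 * d n) < e / c" using e c by (intro real_less_lsqrt) auto
      have "dist (F m w) (F n w) \<le> C * exp (nsq w) * sqrt (2 * d m + 2 * d n)" using diff by (simp add: dist_norm)
      also have "\<dots> \<le> c * sqrt (2 * d m + 2 * d n)" using d0 by (intro mult_right_mono) (auto simp: c_def)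
      also have "\<dots> < c * (e / c)" using s c by (intro mult_strict_left_mono)
      finally show "dist (F m w) (F n w) < e" using c by simp
    qed
  qed
  then have conv: "convergent (\<lambda>n. F n w)" for w by (simp add: Cauchy_convergent)
  define g where "g w = lim (\<lambda>n. F n w)" for w
  have gl: "(\<lambda>n. F n w) \<longlonglongrightarrow> g w" for w unfolding g_def using conv convergent_LIMSEQ_iff by blast
  have gd: "norm (F n w - g w) \<le> C * exp (nsq w) * sqrt (2 * d n)" for n w
  proof -
    have "(\<lambda>m. norm (F n w - F m w)) \<longlonglongrightarrow> norm (F n w - g w)" by (intro tendsto_intros gl)
    moreover have "(\<lambda>m. C * exp (nsq w) * sqrt (2 * d n + 2 * d m)) \<longlonglongrightarrow> C * exp (nsq w) * sqrt (2 * d n + 2 * 0)"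
      by (intro tendsto_intros dl)
    ultimately show ?thesis using diff by (intro LIMSEQ_le) auto
  qed
  have ghol: "g holomorphic_on UNIV"
  proof (rule holomorphic_uniform_sequence[of UNIV F])
    show "\<And>n. F n holomorphic_on UNIV" using F2(1) by (simp add: even_entire_def)
    fix x :: complex
    have "uniform_limit (cball x 1) F g sequentially"
    proof (rule uniform_limitI)
      fix e :: real assume e: "e > 0"
      define c where "c = C * exp ((norm x + 1)\<^sup>2)"
      have "(\<lambda>n. c * sqrt (2 * d n)) \<longlonglongrightarrow> c * sqrt (2 * 0)" by (intro tendsto_intros dl)
      then have "\<forall>\<^sub>F n in sequentially. c * sqrt (2 * d n) < e" using order_tendstoD(2)[of _ "c * sqrt (2 * 0)"] e by simp
      then show "\<forall>\<^sub>F n in sequentially. \<forall>w\<in>cball x 1. dist (F n w) (g w) < e"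
      proof eventually_elim
        fix n assume n: "c * sqrt (2 * d n) < e"
        show "\<forall>w\<in>cball x 1. dist (F n w) (g w) < e"
        proof
          fix w assume "w \<in> cball x 1"
          then have "norm w \<le> norm x + 1" using norm_triangle_ineq2[of w x] by (simp add: dist_norm norm_minus_commute)
          then have "C * exp (nsq w) * sqrt (2 * d n) \<le> c * sqrt (2 * d n)"
            unfolding c_def using C(1) d0 by (intro mult_right_mono mult_left_mono) (auto intro: power_mono)
          then show "dist (F n w) (g w) < e" using gd[of n w] n by (simp add: dist_norm)
        qed
      qed
    qed
    then show "\<exists>d>0. cball x d \<subseteq> UNIV \<and> uniform_limit (cball x d) F g sequentially" by (intro exI[of _ 1]) auto
  qed simp
  have geven: "g (- w) = g w" for w
  proof -
    have "F n (- w) = F n w" for n using F2(1)[of n] by (simp add: even_entire_def)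
    then show ?thesis using gl[of w] gl[of "- w"] LIMSEQ_unique by auto
  qed
  have ge: "g \<in> even_entire" using ghol geven by (simp add: even_entire_def)
  then have gm[measurable]: "g \<in> borel_measurable borel" by (rule even_entire_measurable)
  obtain r where r: "strict_mono r" "AE z in N. (\<lambda>n. nsq (F (r n) z - f z)) \<longlonglongrightarrow> 0"
  proof -
    have "(\<lambda>n. LINT z|N. norm (nsq (F n z - f z))) \<longlonglongrightarrow> 0" using dl unfolding d_def[abs_def] by simp
    then show ?thesis using tendsto_L1_AE_subseq[of N "\<lambda>n z. nsq (F n z - f z)", OF di] that by blast
  qed
  have ae: "AE z in N. f z = g z"
    using r(2)
  proof eventually_elim
    fix z assume "(\<lambda>n. nsq (F (r n) z - f z)) \<longlonglongrightarrow> 0"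
    then have "(\<lambda>n. F (r n) z) \<longlonglongrightarrow> f z" by (simp add: tendsto_norm_zero_iff LIM_zero_iff power_tendsto_0_iff)
    moreover have "(\<lambda>n. F (r n) z) \<longlonglongrightarrow> g z" using LIMSEQ_subseq_LIMSEQ[OF gl r(1)] by (simp add: comp_def)
    ultimately show "f z = g z" by (rule LIMSEQ_unique)
  qed
  have "integrable N (\<lambda>z. nsq (g z))"
    by (rule integrable_cong_AE_imp[OF f2(2)]) (use ae in \<open>auto elim: eventually_mono\<close>)
  then show "\<exists>g\<in>B_e \<mu> 2. AE x in N. f x = g x" using ae ge by (intro bexI[of _ g]) (auto simp: B_e_2_iff)
qed

end

section \<open>The energy-entropy inequality\<close>

context deformed_bargmann_pqa
begin

text \<open>From (p - 2)^2 \<ge> 0 one gets p p' \<ge> 4, so q > p gives p' q > 4. For p =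
  \<infinity> the assumption cannot hold.\<close>

lemma recip_less_imp:
  assumes "recip_exp p > 1 / q" shows "conj_exp p * q / 4 > 1"
  using p
proof (cases p rule: ereal_gt_one_cases)
  case 1
  then show ?thesis using assms q by (simp add: recip_exp_def)
next
  case (2 r)
  have "q > r" using assms 2 q by (simp add: recip_exp_def field_simps)
  have "(r - 2)\<^sup>2 \<ge> 0" by simp
  then have "4 * (r - 1) \<le> r * r" by (simp add: power2_eq_square algebra_simps)
  also have "r * r < r * q" using \<open>q > r\<close> 2 by simp
  finally show ?thesis using 2 by (simp add: conj_exp_def field_simps)
qed

text \<open>Again p p' \<ge> 4: if p' q < 4 then q < p. This ties the sign of a to that of the
  entropy coefficient.\<close>

lemma conj_less_imp:
  assumes "conj_exp p * q / 4 < 1" shows "recip_exp p < 1 / q"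
  using p
proof (cases p rule: ereal_gt_one_cases)
  case 1
  then show ?thesis using q by (simp add: recip_exp_def)
next
  case (2 r)
  have lt: "r * q < 4 * (r - 1)" using assms 2 by (simp add: conj_exp_def field_simps)
  have "q < r"
  proof (rule ccontr)
    assume "\<not> q < r"
    then have "r * r \<le> r * q" using 2 by (intro mult_left_mono) auto
    moreover have "4 * (r - 1) \<le> r * r" using zero_le_power2[of "r - 2"] by (simp add: power2_eq_square algebra_simps)
    ultimately show False using lt by linarith
  qed
  then show ?thesis using 2 q by (simp add: recip_exp_def field_simps)
qed

lemma energy_entropy:
  assumes f: "f \<in> B_e \<mu> 2"
  shows "ee_lhs p q \<mu> f \<le> ee_rhs p q a \<mu> f"
proof -
  have fe: "f \<in> even_entire" and i: "integrable N (\<lambda>z. nsq (f z))" using f by (auto simp: B_e_2_iff)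
  have fm[measurable]: "f \<in> borel_measurable borel" by (rule even_entire_measurable[OF fe])
  define n2 where "n2 = (LINT z|N. nsq (f z))"
  have "n2 \<ge> 0" by (simp add: n2_def)
  then consider "n2 = 0" | "n2 > 0" by linarith
  then show ?thesis
  proof cases
    case 1
    then show ?thesis using entropy_zero[OF fm i]
      unfolding ee_lhs_def ee_rhs_def Lp_norm_2_square by (simp add: n2_def zero_ereal_def[symmetric] zero_ennreal.rep_eq)
  next
    case 2
    define s where "s = recip_exp p - 1 / q"
    define b where "b = a / q"
    obtain c where c: "\<And>z. (\<lambda>k. c k * z ^ k) sums f z" "\<And>k. odd k \<Longrightarrow> c k = 0"
      using even_entire_power_series[OF fe] by blast
    let ?s = "\<lambda>n. fejer_mean c (Suc n)"
    have sg: "slow_growth (?s n)" for n by (rule fejer_mean_slow_growth[OF c(2)])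
    have id: "\<exists>\<alpha>\<ge>0. \<exists>\<beta>. x = \<alpha> * x + \<beta> \<and> (\<forall>y\<ge>0. \<alpha> * y + \<beta> \<le> y)" for x :: real
      by (intro exI[of _ 1] exI[of _ 0] conjI) auto
    define m where "m n = (LINT z|N. nsq (?s n z))" for n
    define e where "e n = (LINT z|N. nsq z * nsq (?s n z))" for n
    define P where "P n = (LINT z|N. xlnx_hull (nsq (?s n z)))" for n
    define k where "k n = (LINT z|N. xlnx_gap (nsq (?s n z)))" for n
    define k' where "k' = (LINT z|N. xlnx_gap (nsq (f z)))"
    have mi: "integrable N (\<lambda>z. nsq (?s n z))" and ei: "integrable N (\<lambda>z. nsq z * nsq (?s n z))" for n
    proof -
      obtain d where d: "\<And>z. ?s n z = (\<Sum>k<Suc n. d k * z ^ k)" using fejer_mean_poly by blast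
      show "integrable N (\<lambda>z. nsq (?s n z))" "integrable N (\<lambda>z. nsq z * nsq (?s n z))"
        unfolding d by (rule poly_norm_square(1) poly_energy(1))+
    qed
    have gi: "integrable N (\<lambda>z. xlnx_gap (nsq (?s n z)))" for n
      by (rule N.integrable_const_bound[of _ 1]) (auto simp: xlnx_gap_bounds)
    have hi: "integrable N (\<lambda>z. xlnx_hull (nsq (?s n z)))" for n
      using integrable_add[OF gi[of n] slow_growth_xlnx_integrable[OF sg[of n]]] by (simp add: xlnx_gap_def)
    have xl: "(LINT z|N. nsq (?s n z) * ln (nsq (?s n z))) = P n - k n" for n
      unfolding P_def k_def using hi gi by (subst integral_diff[symmetric]) (auto simp: xlnx_gap_def)
    have "(\<lambda>n. \<integral>\<^sup>+z. ennreal (nsq (?s n z)) \<partial>N) \<longlonglongrightarrow> (\<integral>\<^sup>+z. ennreal (nsq (f z)) \<partial>N)"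
      using nn_integral_fejer_mean_tendsto[OF c(1) fe, of "\<lambda>x. x" "\<lambda>x. 1", OF _ _ id] by simp
    then have "(\<lambda>n. ennreal (m n)) \<longlonglongrightarrow> ennreal n2"
      using mi i by (simp add: nn_integral_eq_integral m_def n2_def)
    then have ml: "m \<longlonglongrightarrow> n2" by (rule tendsto_ennrealD) (simp_all add: m_def n2_def)
    have "(\<lambda>n. \<integral>\<^sup>+z. ennreal (xlnx_hull (nsq (?s n z))) \<partial>N) \<longlonglongrightarrow> (\<integral>\<^sup>+z. ennreal (xlnx_hull (nsq (f z))) \<partial>N)"
      using nn_integral_fejer_mean_tendsto[OF c(1) fe, of xlnx_hull "\<lambda>x. 1", OF _ _ xlnx_hull_support continuous_on_xlnx_hull] by simp
    then have Pl: "(\<lambda>n. ennreal (P n)) \<longlonglongrightarrow> (\<integral>\<^sup>+z. ennreal (xlnx_hull (nsq (f z))) \<partial>N)"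
      using hi by (simp add: nn_integral_eq_integral P_def xlnx_hull_nonneg)
    have sq: "ennreal (nsq z) * ennreal (nsq w) = ennreal (nsq z * nsq w)" for z w :: complex
      by (simp add: ennreal_mult)
    have "(\<lambda>n. \<integral>\<^sup>+z. ennreal (nsq z * nsq (?s n z)) \<partial>N) \<longlonglongrightarrow> energy_e \<mu> f"
      using nn_integral_fejer_mean_tendsto[OF c(1) fe, of "\<lambda>x. x" "\<lambda>x. x\<^sup>2", OF _ _ id] by (simp add: energy_e_def sq)
    then have el: "(\<lambda>n. ennreal (e n)) \<longlonglongrightarrow> energy_e \<mu> f"
      using ei by (simp add: nn_integral_eq_integral e_def)
    have kl: "k \<longlonglongrightarrow> k'"
      unfolding k_def k'_def
    proof (rule integral_dominated_convergence[where w = "\<lambda>z. 1"])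
      show "AE z in N. (\<lambda>n. xlnx_gap (nsq (?s n z))) \<longlonglongrightarrow> xlnx_gap (nsq (f z))"
      proof (rule AE_I2)
        fix z
        have "(\<lambda>n. nsq (?s n z)) \<longlonglongrightarrow> nsq (f z)"
          by (intro tendsto_intros LIMSEQ_Suc[OF fejer_mean_tendsto[OF c(1)]])
        then show "(\<lambda>n. xlnx_gap (nsq (?s n z))) \<longlonglongrightarrow> xlnx_gap (nsq (f z))"
          by (rule continuous_on_tendsto_compose[OF continuous_on_xlnx_gap]) auto
      qed
    qed (auto simp: xlnx_gap_bounds)
    \<comment> \<open>Everything with a finite limit; the hull integrals and the energies, which may
      diverge, are kept apart.\<close>
    define r where "r n = m n * (ln A + s * ln (m n)) + s * k n" for n
    have rl: "r \<longlonglongrightarrow> n2 * (ln A + s * ln n2) + s * k'"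
      unfolding r_def using 2 by (intro tendsto_intros ml kl) auto
    have "\<forall>\<^sub>F n in sequentially. m n > 0" by (rule order_tendstoD(1)[OF ml 2])
    then have le: "\<forall>\<^sub>F n in sequentially. s * P n \<le> r n + b * e n"
    proof eventually_elim
      fix n assume "m n > 0"
      then have "s * (P n - k n) - b * e n \<le> m n * (ln A + s * ln (m n))"
        using energy_entropy_slow_growth[OF sg, of n] unfolding xl m_def[symmetric] e_def[symmetric] s_def b_def by simp
      then show "s * P n \<le> r n + b * e n" by (simp add: r_def algebra_simps)
    qed
    have sb: "s < 0" if "b < 0"
    proof -
      have "a < 0" using that q by (simp add: b_def divide_less_0_iff)
      then have "conj_exp p * q / 4 < 1" using a by simp
      then show ?thesis using conj_less_imp by (simp add: s_def)
    qed
    have nn: "P n \<ge> 0" "e n \<ge> 0" for n by (auto simp: P_def e_def xlnx_hull_nonneg intro!: integral_nonneg_AE)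
    let ?P = "\<integral>\<^sup>+z. ennreal (xlnx_hull (nsq (f z))) \<partial>N"
    have main: "ereal s * enn2ereal ?P \<le> ereal (n2 * (ln A + s * ln n2) + s * k') + ereal b * enn2ereal (energy_e \<mu> f)"
      by (rule ereal_limit_inequality[OF nn Pl el rl le sb])
    \<comment> \<open>Finite terms may be moved across even for infinite X; with s = 0 the left side
      is 0 in both forms.\<close>
    have shift: "ereal s * (enn2ereal X - ereal x - ereal y) \<le> ereal z + Y"
      if "ereal s * enn2ereal X \<le> ereal (z + s * y + s * x) + Y" for X x y z Y
    proof (cases X)
      case (real u)
      then show ?thesis using that by (cases Y) (auto simp: algebra_simps)
    next
      case top
      then show ?thesis using that
        by (cases Y; cases "s = 0"; cases "s > 0") (auto simp: zero_ereal_def)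
    qed
    show ?thesis
      unfolding ee_lhs_def ee_rhs_def entropy_eq[OF fm] Lp_norm_2_square n2_def[symmetric] s_def[symmetric] b_def[symmetric] k'_def[symmetric]
      by (rule shift) (use main in \<open>simp add: algebra_simps\<close>)
  qed
qed

text \<open>For a > 0 the logarithm of A may be negative, but not below - (a / q)
  \<open>moment 1\<close>; the lower bound for the energy carries the same constant, so the two
  contributions cancel.\<close>

lemma ee_rhs_nonneg:
  assumes f: "f \<in> B_e \<mu> 2" and a0: "a \<ge> 0"
  shows "0 \<le> ee_rhs p q a \<mu> f"
proof -
  define n2 where "n2 = (LINT z|N. nsq (f z))"
  have n2: "n2 \<ge> 0" by (simp add: n2_def)
  have E: "ennreal (moment 1 * n2) \<le> energy_e \<mu> f" unfolding n2_def by (rule energy_ge[OF f])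
  have b: "a / q \<ge> 0" using a0 q by simp
  have "- (a / q) * moment 1 * n2 \<le> ln A * n2" using ln_A_e_ge n2 by (intro mult_right_mono) simp_all
  then have "0 \<le> ln A * n2 + a / q * (moment 1 * n2)" by simp
  then have "0 \<le> ereal (ln A * n2) + ereal (a / q) * ereal (moment 1 * n2)" by (simp add: zero_ereal_def)
  also have "\<dots> \<le> ereal (ln A * n2) + ereal (a / q) * enn2ereal (energy_e \<mu> f)"
  proof (intro add_left_mono ereal_mult_left_mono)
    show "ereal (moment 1 * n2) \<le> enn2ereal (energy_e \<mu> f)"
      using E n2 moment_nonneg[of 1] by (metis enn2ereal_ennreal less_eq_ennreal.rep_eq mult_nonneg_nonneg)
  qed (use b in simp)
  finally show ?thesis unfolding ee_rhs_def Lp_norm_2_square n2_def .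
qed

lemma ee_lhs_nonpos:
  assumes "f \<in> B_e \<mu> 2" "recip_exp p - 1 / q \<le> 0"
  shows "ee_lhs p q \<mu> f \<le> 0"
  unfolding ee_lhs_def using assms entropy_nonneg[OF assms(1)]
  by (cases "entropy_L2 N f") (auto simp: mult_nonpos_nonneg zero_ereal_def)

text \<open>Division by the positive entropy coefficient. The maximum with 0 is taken because ln A
  may be negative here, whereas the constant in front of the norm has to be nonnegative.\<close>

lemma direct_case:
  assumes "recip_exp p > 1 / q"
  shows "direct_log_sobolev N (B_e \<mu> 2) (energy_e \<mu>) ((a / q) / (recip_exp p - 1 / q))
     (max 0 (ln A / (recip_exp p - 1 / q)))"
  unfolding direct_log_sobolev_def
proof (intro conjI ballI closed_L2_subspace_B_e quadratic_form_energy)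
  define s where "s = recip_exp p - 1 / q"
  have s: "s > 0" using assms by (simp add: s_def)
  have a0: "a > 0" using recip_less_imp[OF assms] a by linarith
  then show "(a / q) / (recip_exp p - 1 / q) > 0" using s q by (simp add: s_def)
  fix f assume f: "f \<in> B_e \<mu> 2"
  define n2 where "n2 = (Lp_norm N 2 f)\<^sup>2"
  have n2: "n2 \<ge> 0" by (simp add: n2_def)
  have "ereal s * entropy_L2 N f \<le> ereal (ln A * n2) + ereal (a / q) * enn2ereal (energy_e \<mu> f)"
    using energy_entropy[OF f] by (simp add: ee_lhs_def ee_rhs_def s_def n2_def)
  then have "entropy_L2 N f \<le> ereal ((a / q) / s) * enn2ereal (energy_e \<mu> f) + ereal (ln A / s * n2)"
    using s a0 q entropy_nonneg[OF f]
    by (cases "energy_e \<mu> f"; cases "entropy_L2 N f") (auto simp: field_simps)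
  also have "\<dots> \<le> ereal ((a / q) / s) * enn2ereal (energy_e \<mu> f) + ereal (max 0 (ln A / s) * n2)"
  proof (rule add_left_mono)
    have "ln A / s * n2 \<le> max 0 (ln A / s) * n2" using n2 by (intro mult_right_mono) auto
    then show "ereal (ln A / s * n2) \<le> ereal (max 0 (ln A / s) * n2)" by (simp only: ereal_less_eq)
  qed
  finally show "entropy_L2 N f \<le> ereal ((a / q) / (recip_exp p - 1 / q)) * enn2ereal (energy_e \<mu> f)
     + ereal (max 0 (ln A / (recip_exp p - 1 / q)) * (Lp_norm N 2 f)\<^sup>2)" by (simp add: s_def n2_def)
qed simp

lemma neg_case:
  assumes a0: "a < 0"
  shows "(\<lambda>z. 1) \<in> B_ea \<mu> q a" "Lp_norm Na (ereal q) (\<lambda>z. 1) \<ge> 1" "A \<ge> 1"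
proof -
  show "(\<lambda>z. 1) \<in> B_ea \<mu> q a" using K_e_mem_B_ea[OF one_Lp(1)[OF p]] by (simp add: K_e_one)
  have "0 \<le> - a * moment 1" using a0 moment_nonneg[of 1] by (simp add: mult_nonpos_nonneg)
  then have "1 \<le> exp (- a * moment 1)" by simp
  then have "1 \<le> (LINT z|N. exp (- a * nsq z))" using integral_exp_ge by linarith
  then have one: "1 \<le> (LINT z|N. exp (- a * nsq z)) powr (1 / q)" using q by (intro ge_one_powr_ge_zero) auto
  then show "Lp_norm Na (ereal q) (\<lambda>z. 1) \<ge> 1" by (simp add: Lp_norm_one)
  show "A \<ge> 1" using one A_e_ge by linarith
qed

text \<open>Entropy and energy both have negative coefficients, so they change sides before dividing
  by - a / q > 0. Here A \<ge> 1 makes the norm constant nonnegative as it stands.\<close>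

lemma reverse_case:
  assumes c: "conj_exp p * q / 4 < 1" and a0: "a < 0"
  shows "reverse_log_sobolev N (B_e \<mu> 2) (energy_e \<mu>) ((1 / q - recip_exp p) / (- a / q)) (ln A / (- a / q))"
  unfolding reverse_log_sobolev_def
proof (intro conjI ballI closed_L2_subspace_B_e quadratic_form_energy)
  define s where "s = 1 / q - recip_exp p"
  define b where "b = - a / q"
  have s: "s > 0" using conj_less_imp[OF c] by (simp add: s_def)
  have b: "b > 0" using a0 q by (simp add: b_def divide_neg_pos)
  show "(1 / q - recip_exp p) / (- a / q) > 0" unfolding s_def[symmetric] b_def[symmetric] using s b by simp
  have "ln A \<ge> 0" using neg_case(3)[OF a0] by simp
  then show "ln A / (- a / q) \<ge> 0" unfolding b_def[symmetric] using b by simp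
  fix f assume f: "f \<in> B_e \<mu> 2"
  define n2 where "n2 = (Lp_norm N 2 f)\<^sup>2"
  have "ereal (- s) * entropy_L2 N f \<le> ereal (ln A * n2) + ereal (- b) * enn2ereal (energy_e \<mu> f)"
    using energy_entropy[OF f] by (simp add: ee_lhs_def ee_rhs_def s_def b_def n2_def)
  then have "enn2ereal (energy_e \<mu> f) \<le> ereal (s / b) * entropy_L2 N f + ereal (ln A / b * n2)"
    using s b entropy_nonneg[OF f]
    by (cases "energy_e \<mu> f"; cases "entropy_L2 N f") (auto simp: field_simps)
  then show "enn2ereal (energy_e \<mu> f) \<le> ereal ((1 / q - recip_exp p) / (- a / q)) * entropy_L2 N f
     + ereal (ln A / (- a / q) * (Lp_norm N 2 f)\<^sup>2)" by (simp add: s_def b_def n2_def)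
qed

end

theorem theorem4p3:
  fixes \<mu> q a :: real and p :: ereal
  assumes "\<mu> > - 1/2" and "1 < p" and "p \<le> \<infinity>" and "1 \<le> q"
    and "a > conj_exp p * q / 4 - 1"
  shows
    "(\<forall>f. (\<exists>\<epsilon>>0. f \<in> B_e \<mu> (2 + \<epsilon>)) \<or>
          (f \<in> B_e \<mu> 2 \<and> 1 < p \<and> p \<le> 2 \<and> 1 \<le> q \<and> q \<le> 2 \<and> entropy_L2 (nu_e \<mu>) f < \<infinity>)
        \<longrightarrow> ee_lhs p q \<mu> f \<le> ee_rhs p q a \<mu> f)
     \<and>
     (recip_exp p > 1 / q \<longrightarrow>
        conj_exp p * q / 4 - 1 > 0 \<and> a > 0 \<and>
        recip_exp p - 1 / q > 0 \<and> a / q > 0 \<and>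
        (\<forall>f \<in> B_e \<mu> 2. ee_lhs p q \<mu> f \<le> ee_rhs p q a \<mu> f) \<and>
        direct_log_sobolev (nu_e \<mu>) (B_e \<mu> 2) (energy_e \<mu>)
          ((a / q) / (recip_exp p - 1 / q))
          (max 0 (ln (A_e p q a \<mu>) / (recip_exp p - 1 / q))))
     \<and>
     (recip_exp p \<le> 1 / q \<and> conj_exp p * q / 4 - 1 \<ge> 0 \<longrightarrow>
        a > 0 \<and> a / q > 0 \<and> recip_exp p - 1 / q \<le> 0 \<and>
        prob_space (nu_e \<mu>) \<and>
        (\<forall>f \<in> B_e \<mu> 2. entropy_L2 (nu_e \<mu>) f \<ge> 0 \<and>
           ee_lhs p q \<mu> f \<le> 0 \<and> 0 \<le> ee_rhs p q a \<mu> f))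
     \<and>
     (conj_exp p * q / 4 - 1 < 0 \<longrightarrow>
        recip_exp p < 1 / q \<and> recip_exp p - 1 / q < 0 \<and>
        (a < 0 \<longrightarrow>
           a / q < 0 \<and>
           (\<forall>f \<in> B_e \<mu> 2. ee_lhs p q \<mu> f \<le> ee_rhs p q a \<mu> f) \<and>
           reverse_log_sobolev (nu_e \<mu>) (B_e \<mu> 2) (energy_e \<mu>)
             ((1 / q - recip_exp p) / (- a / q))
             (ln (A_e p q a \<mu>) / (- a / q)) \<and>
           (\<lambda>z. 1) \<in> B_ea \<mu> q a \<and> K_e \<mu> (\<lambda>z. 1) = (\<lambda>z. 1) \<and>
           Lp_norm (nu_ea \<mu> a) (ereal q) (\<lambda>z. 1) \<ge> 1 \<and>
           A_e p q a \<mu> \<ge> 1 \<and> ln (A_e p q a \<mu>) \<ge> 0) \<and>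
        (a \<ge> 0 \<longrightarrow>
           (\<forall>f \<in> B_e \<mu> 2. ee_lhs p q \<mu> f \<le> 0 \<and> 0 \<le> ee_rhs p q a \<mu> f)))"
proof -
  interpret deformed_bargmann_pqa \<mu> p q a
    using assms by unfold_locales
  have q0: "q > 0" using q by simp
  show ?thesis
  proof (intro conjI impI allI ballI)
    fix f
    assume "(\<exists>\<epsilon>>0. f \<in> B_e \<mu> (2 + \<epsilon>)) \<or>
          (f \<in> B_e \<mu> 2 \<and> 1 < p \<and> p \<le> 2 \<and> 1 \<le> q \<and> q \<le> 2 \<and> entropy_L2 (nu_e \<mu>) f < \<infinity>)"
    then have "f \<in> B_e \<mu> 2" using B_e_subset_B_e_2 by blast
    then show "ee_lhs p q \<mu> f \<le> ee_rhs p q a \<mu> f" by (rule energy_entropy)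
  next
    assume r: "recip_exp p > 1 / q"
    show "conj_exp p * q / 4 - 1 > 0" using recip_less_imp[OF r] by simp
    then show "a > 0" using a by linarith
    then show "a / q > 0" using q0 by simp
    show "recip_exp p - 1 / q > 0" using r by simp
    show "direct_log_sobolev (nu_e \<mu>) (B_e \<mu> 2) (energy_e \<mu>) ((a / q) / (recip_exp p - 1 / q))
          (max 0 (ln (A_e p q a \<mu>) / (recip_exp p - 1 / q)))" by (rule direct_case[OF r])
  next
    assume h: "recip_exp p \<le> 1 / q \<and> conj_exp p * q / 4 - 1 \<ge> 0"
    show a0: "a > 0" using h a by linarith
    then show "a / q > 0" using q0 by simp
    show le: "recip_exp p - 1 / q \<le> 0" using h by simp
    show "prob_space (nu_e \<mu>)" by (rule N.prob_space_axioms)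
    fix f assume f: "f \<in> B_e \<mu> 2"
    show "entropy_L2 (nu_e \<mu>) f \<ge> 0" by (rule entropy_nonneg[OF f])
    show "ee_lhs p q \<mu> f \<le> 0" by (rule ee_lhs_nonpos[OF f le])
    show "0 \<le> ee_rhs p q a \<mu> f" using a0 by (intro ee_rhs_nonneg[OF f]) simp
  next
    assume c: "conj_exp p * q / 4 - 1 < 0"
    then have c': "conj_exp p * q / 4 < 1" by simp
    show r: "recip_exp p < 1 / q" by (rule conj_less_imp[OF c'])
    then show "recip_exp p - 1 / q < 0" by simp
    {
      assume a0: "a < 0"
      show "a / q < 0" using a0 q0 by (simp add: divide_neg_pos)
      show "reverse_log_sobolev (nu_e \<mu>) (B_e \<mu> 2) (energy_e \<mu>) ((1 / q - recip_exp p) / (- a / q))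
             (ln (A_e p q a \<mu>) / (- a / q))" by (rule reverse_case[OF c' a0])
      show "(\<lambda>z. 1) \<in> B_ea \<mu> q a" "Lp_norm (nu_ea \<mu> a) (ereal q) (\<lambda>z. 1) \<ge> 1" "A_e p q a \<mu> \<ge> 1"
        by (rule neg_case[OF a0])+
      then show "ln (A_e p q a \<mu>) \<ge> 0" by simp
      show "K_e \<mu> (\<lambda>z. 1) = (\<lambda>z. 1)" by (rule K_e_one)
    }
    fix f assume a0: "a \<ge> 0" and f: "f \<in> B_e \<mu> 2"
    show "ee_lhs p q \<mu> f \<le> 0" using r by (intro ee_lhs_nonpos[OF f]) simp
    show "0 \<le> ee_rhs p q a \<mu> f" by (rule ee_rhs_nonneg[OF f a0])
  \<comment> \<open>The goals left over are the instances of the inequality on the whole space in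
    the direct and the reverse case.\<close>
  qed (rule energy_entropy, assumption)+
qed

end
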